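(* Let $Q$ be an acyclic quiver and $\mathbf d \in \mathbb N^{Q_0}$ a dimension vector. Then there exists a dense open subset $U_{\mathbf d} \subset \mathrm{rep}(Q,\mathbf d)$ such that the Caldero-Chapoton map $M \mapsto X_M$ is constant over $U_{\mathbf d}$. Moreover, if $U'_{\mathbf d}$ is another dense open subset of $\mathrm{rep}(Q,\mathbf d)$ over which the Caldero-Chapoton map is constant, then the values of the Caldero-Chapoton map on $U_{\mathbf d}$ and on $U'_{\mathbf d}$ are the same.
   Context: Let $k=\mathbb C$. A quiver $Q=(Q_0,Q_1)$ is finite and connected; it is acyclic if it has no oriented cycle. $\mathrm{rep}(Q)$ is the category of finite-dimensional representations of $Q$ over $k$; the dimension vector of $M$ is $\mathbf{dim}\, M=(\dim M(i))_{i\in Q_0}\in\mathbb N^{Q_0}$. For $\mathbf d\in\mathbb N^{Q_0}$, $\mathrm{rep}(Q,\mathbf d)=\prod_{\alpha: i\to j\in Q_1}\mathrm{Hom}_k(k^{d_i},k^{d_j})$ is the affine variety of representations of dimension vector $\mathbf d$ (Zariski topology). $\alpha_i$ is the $i$-th vector of the canonical basis of $\mathbb Z^{Q_0}$, and $\langle-,-\rangle$ is the Euler form on $\mathbb Z^{Q_0}$, determined by $\langle \mathbf{dim}\, M,\mathbf{dim}\, N\rangle=\dim\mathrm{Hom}_{kQ}(M,N)-\dim\mathrm{Ext}^1_{kQ}(M,N)$. For a representation $M$ and $\mathbf e\in\mathbb N^{Q_0}$, $\mathrm{Gr}_{\mathbf e}(M)$ is the projective variety of subrepresentations of $M$ of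 dimension vector $\mathbf e$, and $\chi$ is the Euler-Poincaré characteristic. The Caldero-Chapoton map on representations is $$X_M=\sum_{\mathbf e}\chi(\mathrm{Gr}_{\mathbf e}(M))\prod_{i\in Q_0}u_i^{-\langle \mathbf e,\alpha_i\rangle-\langle\alpha_i,\mathbf{dim}\, M-\mathbf e\rangle}\in\mathbb Z[u_i^{\pm1}, i\in Q_0].$$ *)

theory Defs
  imports
    "Jordan_Normal_Form.DL_Rank"
    "Graph_Theory.Graph_Theory"
    "HOL-Homology.Homology"
    "HOL-Library.Poly_Mapping"
begin

text \<open>
  A quiver is a \<^typ>\<open>('v, 'a) pre_digraph\<close> of \<open>Graph_Theory\<close>, whose arcs may be parallel or loops;
  an arrow \<open>a\<close> goes from \<open>tail Q a\<close> to \<open>head Q a\<close>.  Dimension vectors and elements of the lattice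
  of integral vectors on the vertices are functions on the type of vertices; only their values on
  \<open>verts Q\<close> matter.
\<close>

definition rep_space :: "('v, 'a) pre_digraph \<Rightarrow> ('v \<Rightarrow> nat) \<Rightarrow> ('a \<Rightarrow> complex mat) set" where
  "rep_space Q d = (\<Pi>\<^sub>E a\<in>arcs Q. carrier_mat (d (head Q a)) (d (tail Q a)))"


section \<open>Zariski topology on the representation space\<close>

text \<open>The polynomial functions in the matrix entries.\<close>

inductive_set rep_poly_functions ::
    "('v, 'a) pre_digraph \<Rightarrow> ('v \<Rightarrow> nat) \<Rightarrow> (('a \<Rightarrow> complex mat) \<Rightarrow> complex) set"
  for Q d where
  const: "(\<lambda>M. c) \<in> rep_poly_functions Q d"
| coord: "\<lbrakk>a \<in> arcs Q; i < d (head Q a); j < d (tail Q a)\<rbrakk>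
    \<Longrightarrow> (\<lambda>M. M a $$ (i, j)) \<in> rep_poly_functions Q d"
| add: "\<lbrakk>f \<in> rep_poly_functions Q d; g \<in> rep_poly_functions Q d\<rbrakk>
    \<Longrightarrow> (\<lambda>M. f M + g M) \<in> rep_poly_functions Q d"
| mult: "\<lbrakk>f \<in> rep_poly_functions Q d; g \<in> rep_poly_functions Q d\<rbrakk>
    \<Longrightarrow> (\<lambda>M. f M * g M) \<in> rep_poly_functions Q d"

definition rep_zariski :: "('v, 'a) pre_digraph \<Rightarrow> ('v \<Rightarrow> nat) \<Rightarrow> ('a \<Rightarrow> complex mat) topology" where
  "rep_zariski Q d = topology (\<lambda>U. \<exists>F \<subseteq> rep_poly_functions Q d.
     U = rep_space Q d - {M \<in> rep_space Q d. \<forall>f\<in>F. f M = 0})"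

lemma openin_rep_zariski:
  fixes Q :: "('v, 'a) pre_digraph"
  shows "openin (rep_zariski Q d) U \<longleftrightarrow> (\<exists>F \<subseteq> rep_poly_functions Q d.
     U = rep_space Q d - {M \<in> rep_space Q d. \<forall>f\<in>F. f M = 0})"
proof -
  define P where "P = rep_poly_functions Q d"
  define D where "D F = rep_space Q d - {M \<in> rep_space Q d. \<forall>f\<in>F. f M = 0}"
    for F :: "(('a \<Rightarrow> complex mat) \<Rightarrow> complex) set"
  have D_iff: "M \<in> D F \<longleftrightarrow> M \<in> rep_space Q d \<and> (\<exists>f\<in>F. f M \<noteq> 0)" for M F
    unfolding D_def by blast
  have "istopology (\<lambda>U. \<exists>F \<subseteq> P. U = D F)"
    unfolding istopology_def
  proof (intro conjI allI impI)
    fix S T assume "\<exists>F\<subseteq>P. S = D F" "\<exists>F\<subseteq>P. T = D F"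
    then obtain F G where F: "F \<subseteq> P" "S = D F" and G: "G \<subseteq> P" "T = D G" by auto
    define H where "H = (\<lambda>p M. fst p M * snd p M) ` (F \<times> G)"
    have "H \<subseteq> P" using F(1) G(1) unfolding H_def P_def
      by (auto intro!: rep_poly_functions.mult)
    moreover have "S \<inter> T = D H"
    proof (rule Set.set_eqI)
      fix M
      have "(\<exists>h\<in>H. h M \<noteq> 0) \<longleftrightarrow> (\<exists>f\<in>F. f M \<noteq> 0) \<and> (\<exists>g\<in>G. g M \<noteq> 0)"
      proof -
        have "(\<exists>h\<in>H. h M \<noteq> 0) \<longleftrightarrow> (\<exists>p\<in>F \<times> G. fst p M * snd p M \<noteq> 0)"
          unfolding H_def by simp
        then show ?thesis by auto
      qed
      then show "M \<in> S \<inter> T \<longleftrightarrow> M \<in> D H" unfolding F(2) G(2) Int_iff D_iff by blast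
    qed
    ultimately show "\<exists>F\<subseteq>P. S \<inter> T = D F" by blast
  next
    fix K assume K: "\<forall>U\<in>K. \<exists>F\<subseteq>P. U = D F"
    define H where "H = \<Union>{F. F \<subseteq> P \<and> D F \<in> K}"
    have "H \<subseteq> P" unfolding H_def by blast
    moreover have "\<Union>K = D H"
    proof (rule Set.set_eqI)
      fix M
      have "M \<in> \<Union>K \<longleftrightarrow> (\<exists>F\<subseteq>P. D F \<in> K \<and> M \<in> D F)" using K by (metis Union_iff)
      also have "\<dots> \<longleftrightarrow> M \<in> D H" unfolding D_iff H_def by blast
      finally show "M \<in> \<Union>K \<longleftrightarrow> M \<in> D H" .
    qed
    ultimately show "\<exists>F\<subseteq>P. \<Union>K = D F" by blast
  qed
  then show ?thesis
    unfolding rep_zariski_def P_def D_def by (simp add: topology_inverse')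
qed

lemma topspace_rep_zariski: "topspace (rep_zariski Q d) = rep_space Q d"
proof (rule subset_antisym)
  have "openin (rep_zariski Q d) (rep_space Q d)"
    unfolding openin_rep_zariski
    by (rule exI[of _ "{\<lambda>M. 1}"]) (auto intro: rep_poly_functions.const)
  then show "rep_space Q d \<subseteq> topspace (rep_zariski Q d)" by (rule openin_subset)
  show "topspace (rep_zariski Q d) \<subseteq> rep_space Q d"
  proof -
    have "U \<subseteq> rep_space Q d" if "openin (rep_zariski Q d) U" for U
      using that unfolding openin_rep_zariski by (elim exE conjE, hypsubst) (rule Diff_subset)
    then show ?thesis by simp
  qed
qed

definition dense_open :: "'b topology \<Rightarrow> 'b set \<Rightarrow> bool" where
  "dense_open X U \<longleftrightarrow> openin X U \<and> X closure_of U = topspace X"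


section \<open>Quiver Grassmannians with their analytic topology\<close>

definition mat_topology :: "nat \<Rightarrow> nat \<Rightarrow> complex mat topology" where
  "mat_topology nr nc = pullback_topology (carrier_mat nr nc)
     (\<lambda>A. \<lambda>ij\<in>{..<nr} \<times> {..<nc}. A $$ ij)
     (product_topology (\<lambda>_. euclidean) ({..<nr} \<times> {..<nc}))"

definition quotient_topology :: "'b topology \<Rightarrow> ('b \<Rightarrow> 'c) \<Rightarrow> 'c topology" where
  "quotient_topology X f =
     topology (\<lambda>U. U \<subseteq> f ` topspace X \<and> openin X {x \<in> topspace X. f x \<in> U})"

lemma openin_quotient_topology:
  "openin (quotient_topology X f) U \<longleftrightarrow>
     U \<subseteq> f ` topspace X \<and> openin X {x \<in> topspace X. f x \<in> U}"
proof -
  have "istopology (\<lambda>U. U \<subseteq> f ` topspace X \<and> openin X {x \<in> topspace X. f x \<in> U})"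
    unfolding istopology_def
  proof (intro conjI allI impI)
    fix S T
    assume S: "S \<subseteq> f ` topspace X \<and> openin X {x \<in> topspace X. f x \<in> S}"
      and T: "T \<subseteq> f ` topspace X \<and> openin X {x \<in> topspace X. f x \<in> T}"
    then show "S \<inter> T \<subseteq> f ` topspace X" by blast
    have "{x \<in> topspace X. f x \<in> S \<inter> T} =
        {x \<in> topspace X. f x \<in> S} \<inter> {x \<in> topspace X. f x \<in> T}" by blast
    then show "openin X {x \<in> topspace X. f x \<in> S \<inter> T}" using S T by auto
  next
    fix K assume K: "\<forall>U\<in>K. U \<subseteq> f ` topspace X \<and> openin X {x \<in> topspace X. f x \<in> U}"
    then show "\<Union>K \<subseteq> f ` topspace X" by blast
    have "{x \<in> topspace X. f x \<in> \<Union>K} = (\<Union>U\<in>K. {x \<in> topspace X. f x \<in> U})" by blast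
    then show "openin X {x \<in> topspace X. f x \<in> \<Union>K}" using K by auto
  qed
  then show ?thesis unfolding quotient_topology_def by (simp add: topology_inverse')
qed

lemma topspace_quotient_topology: "topspace (quotient_topology X f) = f ` topspace X"
proof -
  have "openin (quotient_topology X f) (f ` topspace X)"
    unfolding openin_quotient_topology
  proof
    have "{x \<in> topspace X. f x \<in> f ` topspace X} = topspace X" by blast
    then show "openin X {x \<in> topspace X. f x \<in> f ` topspace X}" by simp
  qed simp
  then show ?thesis
    using openin_topspace[of "quotient_topology X f"] openin_subset[of "quotient_topology X f"]
    unfolding openin_quotient_topology by (metis subset_antisym)
qed

lemma quotient_map_quotient_topology: "quotient_map X (quotient_topology X f) f"
  unfolding quotient_map_def topspace_quotient_topology openin_quotient_topology by auto

definition grassmannian :: "nat \<Rightarrow> nat \<Rightarrow> complex Matrix.vec set set" where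
  "grassmannian n r = {W. VectorSpace.subspace class_ring W (module_vec TYPE(complex) n) \<and>
     vectorspace.dim class_ring (module_vec TYPE(complex) n\<lparr>carrier := W\<rparr>) = r}"

text \<open>The Grassmannian is the quotient of the space of \<open>n \<times> r\<close> matrices of rank \<open>r\<close> which
  identifies matrices with the same column space.\<close>

definition grassmannian_topology :: "nat \<Rightarrow> nat \<Rightarrow> complex Matrix.vec set topology" where
  "grassmannian_topology n r =
     quotient_topology (subtopology (mat_topology n r) {A. vec_space.rank n A = r})
       (vec_space.col_space n)"

lemma topspace_mat_topology: "topspace (mat_topology nr nc) = carrier_mat nr nc"
  unfolding mat_topology_def topspace_pullback_topology by auto

lemma topspace_grassmannian_topology:
  "topspace (grassmannian_topology n r) = grassmannian n r"
proof -
  interpret V: vec_space "TYPE(complex)" n .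
  have "V.col_space ` {A \<in> carrier_mat n r. V.rank A = r} = grassmannian n r"
  proof (rule subset_antisym; rule subsetI)
    fix W assume "W \<in> V.col_space ` {A \<in> carrier_mat n r. V.rank A = r}"
    then obtain A where A: "A \<in> carrier_mat n r" "V.rank A = r" "W = V.span (set (cols A))"
      unfolding V.col_space_def by blast
    have "set (cols A) \<subseteq> carrier_vec n" using A(1) cols_dim[of A] by simp
    then have "VectorSpace.subspace class_ring W V.V" unfolding A(3) by (rule V.span_is_subspace)
    then show "W \<in> grassmannian n r" using A unfolding grassmannian_def V.rank_def by simp
  next
    fix W assume "W \<in> grassmannian n r"
    then have W: "VectorSpace.subspace class_ring W V.V"
      and dim: "vectorspace.dim class_ring (V.vs W) = r" unfolding grassmannian_def by auto
    interpret W: vectorspace class_ring "V.vs W" by (rule V.subspace_is_vs[OF W])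
    have sub: "submodule class_ring W V.V" using W by (simp add: VectorSpace.subspace_def)
    have WV: "W \<subseteq> carrier V.V" by (rule submodule.subset[OF sub])
    have bound: "finite S \<and> card S \<le> n" if "S \<subseteq> W" "W.module.lin_indpt S" for S
    proof -
      have "V.lin_indpt S" using V.span_li_not_depend(2)[OF that(1) sub] that(2) by simp
      then show ?thesis using V.li_le_dim[OF V.fin_dim, of S] V.dim_is_n that(1) WV by auto
    qed
    have "W.module.lin_indpt {}" by (simp add: W.module.lin_dep_def)
    then obtain b where b': "finite b" "maximal b (\<lambda>S. S \<subseteq> W \<and> W.module.lin_indpt S)"
      using maximal_exists[of "\<lambda>S. S \<subseteq> W \<and> W.module.lin_indpt S" n "{}"] bound by blast
    then have b: "finite b" "W.basis b" using W.max_li_is_basis by auto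
    have bW: "b \<subseteq> W" using b by (simp add: W.basis_def)
    have "W.module.span b = W" using b by (simp add: W.basis_def)
    then have sp: "V.span b = W" using V.span_li_not_depend(1)[OF bW sub] by simp
    obtain bs where bs: "set bs = b" "distinct bs" using finite_distinct_list[OF b(1)] by blast
    have len: "length bs = r" using W.dim_basis[OF b] dim bs distinct_card by fastforce
    have bc: "set bs \<subseteq> carrier_vec n" using bW bs submodule.subset[OF sub] by auto
    have cols: "cols (mat_of_cols n bs) = bs" using bc by (rule cols_mat_of_cols)
    have "mat_of_cols n bs \<in> carrier_mat n r" using len by auto
    moreover have "V.rank (mat_of_cols n bs) = r"
      unfolding V.rank_def cols bs(1) sp using dim .
    moreover have "V.col_space (mat_of_cols n bs) = W"
      unfolding V.col_space_def cols bs(1) sp ..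
    ultimately show "W \<in> V.col_space ` {A \<in> carrier_mat n r. V.rank A = r}" by blast
  qed
  moreover have "{A \<in> carrier_mat n r. V.rank A = r} = carrier_mat n r \<inter> {A. V.rank A = r}"
    by blast
  ultimately show ?thesis
    unfolding grassmannian_topology_def topspace_quotient_topology topspace_subtopology
      topspace_mat_topology by argo
qed

definition subreps ::
    "('v, 'a) pre_digraph \<Rightarrow> ('v \<Rightarrow> nat) \<Rightarrow> ('a \<Rightarrow> complex mat) \<Rightarrow> ('v \<Rightarrow> nat)
      \<Rightarrow> ('v \<Rightarrow> complex Matrix.vec set) set" where
  "subreps Q d M e = {N \<in> \<Pi>\<^sub>E i\<in>verts Q. grassmannian (d i) (e i).
     \<forall>a\<in>arcs Q. \<forall>v\<in>N (tail Q a). M a *\<^sub>v v \<in> N (head Q a)}"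

definition quiver_grassmannian ::
    "('v, 'a) pre_digraph \<Rightarrow> ('v \<Rightarrow> nat) \<Rightarrow> ('a \<Rightarrow> complex mat) \<Rightarrow> ('v \<Rightarrow> nat)
      \<Rightarrow> ('v \<Rightarrow> complex Matrix.vec set) topology" where
  "quiver_grassmannian Q d M e =
     subtopology (product_topology (\<lambda>i. grassmannian_topology (d i) (e i)) (verts Q))
       (subreps Q d M e)"

lemma topspace_quiver_grassmannian:
  "topspace (quiver_grassmannian Q d M e) = subreps Q d M e"
  unfolding quiver_grassmannian_def topspace_subtopology topspace_product_topology
  by (auto simp: topspace_grassmannian_topology subreps_def)


section \<open>Euler-Poincare characteristic\<close>

text \<open>The rank of a finitely generated abelian group (written multiplicatively, as the homology
  groups of the library are).\<close>

definition int_independent :: "('b, 'm) monoid_scheme \<Rightarrow> 'b set \<Rightarrow> bool" where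
  "int_independent G S \<longleftrightarrow> finite S \<and> S \<subseteq> carrier G \<and>
     (\<forall>c :: 'b \<Rightarrow> int. finprod G (\<lambda>x. x [^]\<^bsub>G\<^esub> c x) S = \<one>\<^bsub>G\<^esub> \<longrightarrow> (\<forall>x\<in>S. c x = 0))"

definition abelian_rank :: "('b, 'm) monoid_scheme \<Rightarrow> nat" where
  "abelian_rank G = Sup (card ` {S. int_independent G S})"

definition betti :: "nat \<Rightarrow> 'b topology \<Rightarrow> nat" where
  "betti p X = abelian_rank (homology_group (int p) X)"

text \<open>Meaningful when the total homology is finitely generated, in particular for complex
  projective varieties with their analytic topology.\<close>

definition euler_characteristic :: "'b topology \<Rightarrow> int" where
  "euler_characteristic X = (\<Sum>p | betti p X \<noteq> 0. (-1) ^ p * int (betti p X))"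


section \<open>Morphisms, extensions and the Euler form\<close>

text \<open>The vector space of families of matrices of shapes \<open>r i \<times> c i\<close>, for \<open>i \<in> I\<close>.  The
  multiplicative part of the record is not used.\<close>

definition mat_families ::
    "'i set \<Rightarrow> ('i \<Rightarrow> nat) \<Rightarrow> ('i \<Rightarrow> nat) \<Rightarrow> (complex, 'i \<Rightarrow> complex mat) module" where
  "mat_families I r c =
     \<lparr>carrier = (\<Pi>\<^sub>E i\<in>I. carrier_mat (r i) (c i)),
      monoid.mult = undefined, one = undefined,
      ring.zero = (\<lambda>i\<in>I. 0\<^sub>m (r i) (c i)),
      add = (\<lambda>f g. \<lambda>i\<in>I. f i + g i),
      smult = (\<lambda>k f. \<lambda>i\<in>I. k \<cdot>\<^sub>m f i)\<rparr>"

text \<open>Morphisms from \<open>M\<close>, of dimension vector \<open>d\<close>, to \<open>N\<close>, of dimension vector \<open>e\<close>.\<close>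

definition rep_hom ::
    "('v, 'a) pre_digraph \<Rightarrow> ('v \<Rightarrow> nat) \<Rightarrow> ('a \<Rightarrow> complex mat) \<Rightarrow> ('v \<Rightarrow> nat) \<Rightarrow> ('a \<Rightarrow> complex mat)
      \<Rightarrow> ('v \<Rightarrow> complex mat) set" where
  "rep_hom Q d M e N = {f \<in> \<Pi>\<^sub>E i\<in>verts Q. carrier_mat (e i) (d i).
     \<forall>a\<in>arcs Q. N a * f (tail Q a) = f (head Q a) * M a}"

definition hom_dim ::
    "('v, 'a) pre_digraph \<Rightarrow> ('v \<Rightarrow> nat) \<Rightarrow> ('a \<Rightarrow> complex mat) \<Rightarrow> ('v \<Rightarrow> nat) \<Rightarrow> ('a \<Rightarrow> complex mat)
      \<Rightarrow> nat" where
  "hom_dim Q d M e N =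
     vectorspace.dim class_ring (mat_families (verts Q) e d\<lparr>carrier := rep_hom Q d M e N\<rparr>)"

text \<open>
  Extensions of \<open>M\<close> by \<open>N\<close>.  Choosing linear splittings at the vertices, every short exact sequence
  from \<open>N\<close> to \<open>M\<close> is equivalent to one whose middle term is \<open>k\<^bsup>e\<^esup> \<oplus> k\<^bsup>d\<^esup>\<close> with block upper triangular
  matrices \<open>(N, z; 0, M)\<close> and the obvious inclusion and projection.  The Baer sum corresponds to
  the addition of the blocks \<open>z\<close>, so the group of extensions is the space of all \<open>z\<close> modulo
  those giving a split sequence.
\<close>

definition extension_cocycles ::
    "('v, 'a) pre_digraph \<Rightarrow> ('v \<Rightarrow> nat) \<Rightarrow> ('v \<Rightarrow> nat) \<Rightarrow> (complex, 'a \<Rightarrow> complex mat) module" where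
  "extension_cocycles Q d e =
     mat_families (arcs Q) (\<lambda>a. e (head Q a)) (\<lambda>a. d (tail Q a))"

definition extension_rep ::
    "('v, 'a) pre_digraph \<Rightarrow> ('v \<Rightarrow> nat) \<Rightarrow> ('a \<Rightarrow> complex mat) \<Rightarrow> ('v \<Rightarrow> nat) \<Rightarrow> ('a \<Rightarrow> complex mat)
      \<Rightarrow> ('a \<Rightarrow> complex mat) \<Rightarrow> ('a \<Rightarrow> complex mat)" where
  "extension_rep Q d M e N z =
     (\<lambda>a\<in>arcs Q. four_block_mat (N a) (z a) (0\<^sub>m (d (head Q a)) (e (tail Q a))) (M a))"

definition split_cocycles ::
    "('v, 'a) pre_digraph \<Rightarrow> ('v \<Rightarrow> nat) \<Rightarrow> ('a \<Rightarrow> complex mat) \<Rightarrow> ('v \<Rightarrow> nat) \<Rightarrow> ('a \<Rightarrow> complex mat)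
      \<Rightarrow> ('a \<Rightarrow> complex mat) set" where
  "split_cocycles Q d M e N = {z \<in> carrier (extension_cocycles Q d e).
     \<exists>s \<in> rep_hom Q d M (\<lambda>i. e i + d i) (extension_rep Q d M e N z).
       \<forall>i\<in>verts Q. Matrix.mat (d i) (e i + d i) (\<lambda>(p, q). if q = e i + p then 1 else 0) * s i
         = 1\<^sub>m (d i)}"

definition ext_dim ::
    "('v, 'a) pre_digraph \<Rightarrow> ('v \<Rightarrow> nat) \<Rightarrow> ('a \<Rightarrow> complex mat) \<Rightarrow> ('v \<Rightarrow> nat) \<Rightarrow> ('a \<Rightarrow> complex mat)
      \<Rightarrow> int" where
  "ext_dim Q d M e N =
     int (vectorspace.dim class_ring (extension_cocycles Q d e))
     - int (vectorspace.dim class_ring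
         (extension_cocycles Q d e\<lparr>carrier := split_cocycles Q d M e N\<rparr>))"

text \<open>The first condition expresses that the form lives on the lattice of integral vectors on
  \<open>verts Q\<close>.\<close>

definition is_euler_form ::
    "('v, 'a) pre_digraph \<Rightarrow> (('v \<Rightarrow> int) \<Rightarrow> ('v \<Rightarrow> int) \<Rightarrow> int) \<Rightarrow> bool" where
  "is_euler_form Q B \<longleftrightarrow>
     (\<forall>x x' y y'. (\<forall>i\<in>verts Q. x i = x' i \<and> y i = y' i) \<longrightarrow> B x y = B x' y') \<and>
     (\<forall>x x' y. B (\<lambda>i. x i + x' i) y = B x y + B x' y) \<and>
     (\<forall>x y y'. B x (\<lambda>i. y i + y' i) = B x y + B x y') \<and>
     (\<forall>d e. \<forall>M\<in>rep_space Q d. \<forall>N\<in>rep_space Q e.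
        B (\<lambda>i. int (d i)) (\<lambda>i. int (e i)) = int (hom_dim Q d M e N) - ext_dim Q d M e N)"

definition euler_form ::
    "('v, 'a) pre_digraph \<Rightarrow> ('v \<Rightarrow> int) \<Rightarrow> ('v \<Rightarrow> int) \<Rightarrow> int" where
  "euler_form Q = (THE B. is_euler_form Q B)"

text \<open>
  The complex computing morphisms and extensions shows that the Euler form is well defined and
  gives the usual formula for it, in \<open>euler_form_eq\<close> below.
\<close>

lemma mat_families_simps:
  "carrier (mat_families I r c) = (\<Pi>\<^sub>E i\<in>I. carrier_mat (r i) (c i))"
  "\<zero>\<^bsub>mat_families I r c\<^esub> = (\<lambda>i\<in>I. 0\<^sub>m (r i) (c i))"
  "f \<oplus>\<^bsub>mat_families I r c\<^esub> g = (\<lambda>i\<in>I. f i + g i)"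
  "k \<odot>\<^bsub>mat_families I r c\<^esub> f = (\<lambda>i\<in>I. k \<cdot>\<^sub>m f i)"
  by (simp_all add: mat_families_def)

lemma mat_families_dim:
  assumes "f \<in> carrier (mat_families I r c)" "i \<in> I"
  shows "f i \<in> carrier_mat (r i) (c i)" "dim_row (f i) = r i" "dim_col (f i) = c i"
  using assms by (auto simp: mat_families_simps)

lemma mat_families_eqI:
  assumes "f \<in> carrier (mat_families I r c)" "g \<in> carrier (mat_families I r c)"
    and "\<And>i p q. \<lbrakk>i \<in> I; p < r i; q < c i\<rbrakk> \<Longrightarrow> f i $$ (p, q) = g i $$ (p, q)"
  shows "f = g"
proof (rule extensionalityI[of _ I])
  show "f \<in> extensional I" "g \<in> extensional I"
    using assms by (auto simp: mat_families_simps PiE_def)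
  fix i assume i: "i \<in> I"
  show "f i = g i"
    by (rule eq_matI)
      (use assms i mat_families_dim[OF assms(1) i] mat_families_dim[OF assms(2) i] in auto)
qed

lemma mat_families_closed:
  "\<zero>\<^bsub>mat_families I r c\<^esub> \<in> carrier (mat_families I r c)"
  "\<lbrakk>f \<in> carrier (mat_families I r c); g \<in> carrier (mat_families I r c)\<rbrakk>
    \<Longrightarrow> f \<oplus>\<^bsub>mat_families I r c\<^esub> g \<in> carrier (mat_families I r c)"
  "f \<in> carrier (mat_families I r c) \<Longrightarrow> k \<odot>\<^bsub>mat_families I r c\<^esub> f \<in> carrier (mat_families I r c)"
  by (auto simp: mat_families_simps PiE_iff)

lemma mat_families_index:
  assumes "i \<in> I" "p < r i" "q < c i"
  shows "\<zero>\<^bsub>mat_families I r c\<^esub> i $$ (p, q) = 0"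
    and "g \<in> carrier (mat_families I r c) \<Longrightarrow>
      (f \<oplus>\<^bsub>mat_families I r c\<^esub> g) i $$ (p, q) = f i $$ (p, q) + g i $$ (p, q)"
    and "f \<in> carrier (mat_families I r c) \<Longrightarrow>
      (k \<odot>\<^bsub>mat_families I r c\<^esub> f) i $$ (p, q) = k * f i $$ (p, q)"
  using assms by (auto simp: mat_families_simps PiE_iff)

lemma vectorspace_mat_families: "vectorspace class_ring (mat_families I r c)"
proof -
  let ?V = "mat_families I r c"
  have "Module.module class_ring ?V"
  proof (rule module_criteria, goal_cases)
    case 1 show ?case by (rule class_cring.cring_axioms)
  next
    case 4
    show ?case
    proof
      fix v assume v: "v \<in> carrier ?V"
      have n: "(-1) \<odot>\<^bsub>?V\<^esub> v \<in> carrier ?V" using v by (rule mat_families_closed)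
      show "\<exists>n\<in>carrier ?V. v \<oplus>\<^bsub>?V\<^esub> n = \<zero>\<^bsub>?V\<^esub>"
        using v n by (intro bexI[OF _ n] mat_families_eqI[of _ I r c])
          (simp_all add: mat_families_closed mat_families_index)
    qed
  qed (auto intro!: mat_families_eqI[of _ I r c] simp: mat_families_closed mat_families_index algebra_simps)
  then show ?thesis by (simp add: vectorspace_def class_field)
qed

lemma finsum_mat_families_index:
  assumes "finite A" "f \<in> A \<rightarrow> carrier (mat_families I r c)" "i \<in> I" "p < r i" "q < c i"
  shows "finsum (mat_families I r c) f A i $$ (p, q) = (\<Sum>x\<in>A. f x i $$ (p, q))"
proof -
  interpret V: vectorspace class_ring "mat_families I r c" by (rule vectorspace_mat_families)
  from assms show ?thesis
  proof (induction A rule: finite_induct)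
    case empty then show ?case by (simp add: mat_families_simps)
  next
    case (insert x A)
    have c: "finsum (mat_families I r c) f A \<in> carrier (mat_families I r c)"
      using insert.prems by (intro V.M.finsum_closed) auto
    have "finsum (mat_families I r c) f A i \<in> carrier_mat (r i) (c i)"
      using c insert.prems by (auto simp: mat_families_simps)
    moreover have "f x i \<in> carrier_mat (r i) (c i)"
      using insert.prems by (auto simp: mat_families_simps)
    ultimately show ?case
      using insert
      by (subst V.M.finsum_insert) (auto simp: mat_families_simps)
  qed
qed

lemma dim_mat_families:
  assumes I: "finite I"
  shows "vectorspace.fin_dim class_ring (mat_families I r c)" (is ?fd)
    and "vectorspace.dim class_ring (mat_families I r c) = (\<Sum>i\<in>I. r i * c i)" (is ?dim)
proof -
  let ?V = "mat_families I r c"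
  interpret V: vectorspace class_ring ?V by (rule vectorspace_mat_families)
  define S where "S = (SIGMA i:I. {..<r i} \<times> {..<c i})"
  define u :: "'a \<times> nat \<times> nat \<Rightarrow> 'a \<Rightarrow> complex mat" where
    "u = (\<lambda>(i, p, q). \<lambda>j\<in>I. Matrix.mat (r j) (c j) (\<lambda>(p', q'). if (j, p', q') = (i, p, q) then 1 else 0))"
  have uV: "u s \<in> carrier ?V" for s
    by (auto simp: u_def mat_families_simps split: prod.splits)
  have uidx: "u s i $$ (p, q) = (if s = (i, p, q) then 1 else 0)"
    if "(i, p, q) \<in> S" for s i p q
    using that by (auto simp: u_def S_def split: prod.splits)
  have finS: "finite S" using I by (auto simp: S_def)
  have inj: "inj_on u S"
  proof (rule inj_onI)
    fix s t assume st: "s \<in> S" "t \<in> S" "u s = u t"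
    obtain i p q where s: "s = (i, p, q)" by (cases s) auto
    have "u t i $$ (p, q) = 1" using uidx[of i p q s] st s by auto
    then show "s = t" using uidx[of i p q t] st s by (auto split: if_splits)
  qed
  have lc: "V.module.lincomb a (u ` S) i $$ (p, q) = a (u (i, p, q))" if s: "(i, p, q) \<in> S" for a i p q
  proof -
    have ij: "i \<in> I" "p < r i" "q < c i" using s by (auto simp: S_def)
    have "V.module.lincomb a (u ` S) i $$ (p, q) = (\<Sum>x\<in>u ` S. (a x \<odot>\<^bsub>?V\<^esub> x) i $$ (p, q))"
      unfolding V.module.lincomb_def
      by (rule finsum_mat_families_index) (use finS ij uV in auto)
    also have "\<dots> = (\<Sum>s\<in>S. (a (u s) \<odot>\<^bsub>?V\<^esub> u s) i $$ (p, q))"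
      using inj by (simp add: sum.reindex)
    also have "\<dots> = (\<Sum>s\<in>S. if s = (i, p, q) then a (u (i, p, q)) else 0)"
    proof (rule sum.cong[OF refl])
      fix t assume "t \<in> S"
      have "u t i \<in> carrier_mat (r i) (c i)" using uV[of t] ij by (auto simp: mat_families_simps)
      then show "(a (u t) \<odot>\<^bsub>?V\<^esub> u t) i $$ (p, q) = (if t = (i, p, q) then a (u (i, p, q)) else 0)"
        using ij uidx[OF s, of t] by (auto simp: mat_families_simps)
    qed
    also have "\<dots> = a (u (i, p, q))" using finS s by simp
    finally show ?thesis .
  qed
  have fu: "finite (u ` S)" "u ` S \<subseteq> carrier ?V" using finS uV by auto
  have li: "V.module.lin_indpt (u ` S)"
  proof (rule V.module.finite_lin_indpt2[OF fu])
    fix a assume a: "a \<in> u ` S \<rightarrow> carrier class_ring" and 0: "V.module.lincomb a (u ` S) = \<zero>\<^bsub>?V\<^esub>"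
    show "\<forall>v\<in>u ` S. a v = \<zero>\<^bsub>class_ring\<^esub>"
    proof
      fix v assume "v \<in> u ` S"
      then obtain i p q where s: "(i, p, q) \<in> S" "v = u (i, p, q)" by auto
      then show "a v = \<zero>\<^bsub>class_ring\<^esub>"
        using lc[OF s(1), of a] 0 by (auto simp: mat_families_simps S_def)
    qed
  qed
  have gen: "V.module.span (u ` S) = carrier ?V"
  proof
    show "V.module.span (u ` S) \<subseteq> carrier ?V" using fu(2) V.module.span_is_subset2 by blast
    show "carrier ?V \<subseteq> V.module.span (u ` S)"
    proof
      fix v assume v: "v \<in> carrier ?V"
      define a where "a = (\<lambda>x. case inv_into S u x of (i, p, q) \<Rightarrow> v i $$ (p, q))"
      have lcV: "V.module.lincomb a (u ` S) \<in> carrier ?V"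
        using fu by (intro V.module.lincomb_closed) auto
      have "V.module.lincomb a (u ` S) = v"
      proof (rule extensionalityI[of _ I])
        show "V.module.lincomb a (u ` S) \<in> extensional I" "v \<in> extensional I"
          using lcV v by (auto simp: mat_families_simps PiE_def)
        fix i assume i: "i \<in> I"
        have c1: "V.module.lincomb a (u ` S) i \<in> carrier_mat (r i) (c i)" "v i \<in> carrier_mat (r i) (c i)"
          using lcV v i by (auto simp: mat_families_simps)
        show "V.module.lincomb a (u ` S) i = v i"
        proof (rule eq_matI)
          fix p q assume "p < dim_row (v i)" "q < dim_col (v i)"
          then have s: "(i, p, q) \<in> S" using c1 i by (auto simp: S_def)
          show "V.module.lincomb a (u ` S) i $$ (p, q) = v i $$ (p, q)"
            unfolding lc[OF s] a_def using inj s by simp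
        qed (use c1 in auto)
      qed
      then show "v \<in> V.module.span (u ` S)"
        unfolding V.module.span_def using fu by force
    qed
  qed
  show ?fd unfolding V.fin_dim_def using fu gen by blast
  have "V.dim = card (u ` S)"
    by (rule V.dim_basis[OF fu(1)]) (use li gen fu in \<open>auto simp: V.basis_def\<close>)
  also have "\<dots> = card S" using inj by (rule card_image)
  also have "\<dots> = (\<Sum>i\<in>I. r i * c i)" using I by (simp add: S_def)
  finally show ?dim .
qed

lemma projection_index:
  assumes "(s :: complex mat) \<in> carrier_mat (e + d) n" "p < d" "q < n"
  shows "(Matrix.mat d (e + d) (\<lambda>(p, q). if q = e + p then 1 else 0) * s) $$ (p, q) = s $$ (e + p, q)"
proof -
  have "(Matrix.mat d (e + d) (\<lambda>(p, q). if q = e + p then 1 else 0) * s) $$ (p, q)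
      = (\<Sum>k\<in>{0..<e + d}. (if k = e + p then 1 else 0) * s $$ (k, q))"
    using assms by (simp add: scalar_prod_def)
  also have "\<dots> = (\<Sum>k\<in>{0..<e + d}. if k = e + p then s $$ (k, q) else 0)"
    by (rule sum.cong) auto
  also have "\<dots> = s $$ (e + p, q)" using assms by simp
  finally show ?thesis .
qed

lemma mult_four_block_column:
  assumes "(N :: complex mat) \<in> carrier_mat eh et" "M \<in> carrier_mat dh dt" "z \<in> carrier_mat eh dt"
    "h \<in> carrier_mat et dt" "g \<in> carrier_mat eh dh"
  shows "four_block_mat N z (0\<^sub>m dh et) M * (h @\<^sub>r 1\<^sub>m dt) = (N * h + z) @\<^sub>r M"
    and "(g @\<^sub>r 1\<^sub>m dh) * M = (g * M) @\<^sub>r M"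
proof -
  have "four_block_mat N z (0\<^sub>m dh et) M * (h @\<^sub>r 1\<^sub>m dt) =
      four_block_mat (N * h + z * 1\<^sub>m dt) (N * 0\<^sub>m et 0 + z * 0\<^sub>m dt 0)
        (0\<^sub>m dh et * h + M * 1\<^sub>m dt) (0\<^sub>m dh et * 0\<^sub>m et 0 + M * 0\<^sub>m dt 0)"
    unfolding append_rows_def
    by (subst mult_four_block_mat[of _ eh et _ dt _ dh _ _ dt _ 0]) (use assms in auto)
  also have "\<dots> = (N * h + z) @\<^sub>r M"
    unfolding append_rows_def by (rule cong_four_block_mat) (use assms in auto)
  finally show "four_block_mat N z (0\<^sub>m dh et) M * (h @\<^sub>r 1\<^sub>m dt) = (N * h + z) @\<^sub>r M" .
  have M: "M = four_block_mat M (0\<^sub>m dh 0) (0\<^sub>m 0 dt) (0\<^sub>m 0 0)"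
    by (rule eq_matI) (use assms in auto)
  have "(g @\<^sub>r 1\<^sub>m dh) * M = (g @\<^sub>r 1\<^sub>m dh) * four_block_mat M (0\<^sub>m dh 0) (0\<^sub>m 0 dt) (0\<^sub>m 0 0)"
    using M by simp
  also have "\<dots> = four_block_mat (g * M + 0\<^sub>m eh 0 * 0\<^sub>m 0 dt) (g * 0\<^sub>m dh 0 + 0\<^sub>m eh 0 * 0\<^sub>m 0 0)
        (1\<^sub>m dh * M + 0\<^sub>m dh 0 * 0\<^sub>m 0 dt) (1\<^sub>m dh * 0\<^sub>m dh 0 + 0\<^sub>m dh 0 * 0\<^sub>m 0 0)"
    unfolding append_rows_def
    by (subst mult_four_block_mat[of _ eh dh _ 0 _ dh _ _ dt _ 0]) (use assms in auto)
  also have "\<dots> = (g * M) @\<^sub>r M"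
    unfolding append_rows_def by (rule cong_four_block_mat) (use assms in auto)
  finally show "(g @\<^sub>r 1\<^sub>m dh) * M = (g * M) @\<^sub>r M" .
qed

lemma append_rows_inject:
  assumes "(A :: complex mat) \<in> carrier_mat m n" "B \<in> carrier_mat m n" "C \<in> carrier_mat k n"
    and eq: "A @\<^sub>r C = B @\<^sub>r C"
  shows "A = B"
proof (rule eq_matI)
  fix p q assume "p < dim_row B" "q < dim_col B"
  then have pq: "p < m" "q < n" using assms by auto
  have "(A @\<^sub>r C) $$ (p, q) = (B @\<^sub>r C) $$ (p, q)" using eq by simp
  then show "A $$ (p, q) = B $$ (p, q)"
    using pq assms(1-3) by (simp add: append_rows_def)
qed (use assms in auto)

context
  fixes Q :: "('v, 'a) pre_digraph" and d e :: "'v \<Rightarrow> nat" and M N :: "'a \<Rightarrow> complex mat"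
  assumes Q: "fin_digraph Q" and M: "M \<in> rep_space Q d" and N: "N \<in> rep_space Q e"
begin

definition coboundary :: "('v \<Rightarrow> complex mat) \<Rightarrow> 'a \<Rightarrow> complex mat" where
  "coboundary f = (\<lambda>a\<in>arcs Q. f (head Q a) * M a - N a * f (tail Q a))"

interpretation fin_digraph Q by (rule Q)

lemma arrow_carrier:
  assumes "a \<in> arcs Q"
  shows "M a \<in> carrier_mat (d (head Q a)) (d (tail Q a))"
    and "N a \<in> carrier_mat (e (head Q a)) (e (tail Q a))"
  using M N assms by (auto simp: rep_space_def)

lemma vertex_carrier:
  assumes "f \<in> carrier (mat_families (verts Q) e d)" "a \<in> arcs Q"
  shows "f (head Q a) \<in> carrier_mat (e (head Q a)) (d (head Q a))"
    and "f (tail Q a) \<in> carrier_mat (e (tail Q a)) (d (tail Q a))"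
  using assms by (auto simp: mat_families_simps)

lemma linear_map_coboundary:
  "linear_map class_ring (mat_families (verts Q) e d) (extension_cocycles Q d e) coboundary"
proof -
  let ?V = "mat_families (verts Q) e d" and ?W = "extension_cocycles Q d e"
  have "coboundary \<in> LinearCombinations.module_hom class_ring ?V ?W"
    unfolding LinearCombinations.module_hom_def mem_Collect_eq
  proof (intro conjI allI impI)
    show "coboundary \<in> carrier ?V \<rightarrow> carrier ?W"
    proof
      fix f assume f: "f \<in> carrier ?V"
      have "f (head Q a) * M a - N a * f (tail Q a) \<in> carrier_mat (e (head Q a)) (d (tail Q a))"
        if a: "a \<in> arcs Q" for a
        using arrow_carrier[OF a] vertex_carrier[OF f a] by auto
      then show "coboundary f \<in> carrier ?W"
        by (simp add: extension_cocycles_def mat_families_simps coboundary_def)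
    qed
    fix f g assume "f \<in> carrier ?V \<and> g \<in> carrier ?V"
    then have f: "f \<in> carrier ?V" and g: "g \<in> carrier ?V" by auto
    show "coboundary (f \<oplus>\<^bsub>?V\<^esub> g) = coboundary f \<oplus>\<^bsub>?W\<^esub> coboundary g"
    proof (rule extensionalityI[of _ "arcs Q"])
      fix a assume a: "a \<in> arcs Q"
      note c = arrow_carrier[OF a] vertex_carrier[OF f a] vertex_carrier[OF g a]
      have "(f (head Q a) + g (head Q a)) * M a - N a * (f (tail Q a) + g (tail Q a)) =
         (f (head Q a) * M a + g (head Q a) * M a) - (N a * f (tail Q a) + N a * g (tail Q a))"
        using c by (simp add: add_mult_distrib_mat[of _ "e (head Q a)" "d (head Q a)"]
            mult_add_distrib_mat[of _ "e (head Q a)" "e (tail Q a)"])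
      also have "\<dots> = (f (head Q a) * M a - N a * f (tail Q a)) +
          (g (head Q a) * M a - N a * g (tail Q a))"
        by (rule eq_matI) (use c in \<open>auto simp del: index_mult_mat(1)\<close>)
      finally show "coboundary (f \<oplus>\<^bsub>?V\<^esub> g) a = (coboundary f \<oplus>\<^bsub>?W\<^esub> coboundary g) a"
        using a by (simp add: coboundary_def extension_cocycles_def mat_families_simps)
    qed (auto simp: coboundary_def extension_cocycles_def mat_families_simps)
  next
    fix k :: complex and f assume "k \<in> carrier class_ring \<and> f \<in> carrier ?V"
    then have f: "f \<in> carrier ?V" by auto
    show "coboundary (k \<odot>\<^bsub>?V\<^esub> f) = k \<odot>\<^bsub>?W\<^esub> coboundary f"
    proof (rule extensionalityI[of _ "arcs Q"])
      fix a assume a: "a \<in> arcs Q"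
      note c = arrow_carrier[OF a] vertex_carrier[OF f a]
      have "(k \<cdot>\<^sub>m f (head Q a)) * M a - N a * (k \<cdot>\<^sub>m f (tail Q a)) =
         k \<cdot>\<^sub>m (f (head Q a) * M a) - k \<cdot>\<^sub>m (N a * f (tail Q a))"
        using c by (simp add: mult_smult_distrib[of _ "e (head Q a)" "e (tail Q a)"]
          mult_smult_assoc_mat[of _ "e (head Q a)" "d (head Q a)"])
      also have "\<dots> = k \<cdot>\<^sub>m (f (head Q a) * M a - N a * f (tail Q a))"
        by (rule eq_matI) (use c in \<open>auto simp: algebra_simps simp del: index_mult_mat(1)\<close>)
      finally show "coboundary (k \<odot>\<^bsub>?V\<^esub> f) a = (k \<odot>\<^bsub>?W\<^esub> coboundary f) a"
        using a by (simp add: coboundary_def extension_cocycles_def mat_families_simps)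
    qed (auto simp: coboundary_def extension_cocycles_def mat_families_simps)
  qed
  then show ?thesis
    by (simp add: linear_map_def mod_hom_def mod_hom_axioms_def extension_cocycles_def
        vectorspace_mat_families vectorspace_mat_families[unfolded vectorspace_def])
qed

lemma rep_hom_eq_kernel:
  "rep_hom Q d M e N = {f \<in> carrier (mat_families (verts Q) e d).
     coboundary f = \<zero>\<^bsub>extension_cocycles Q d e\<^esub>}"
proof -
  have "(\<forall>a\<in>arcs Q. N a * f (tail Q a) = f (head Q a) * M a) \<longleftrightarrow>
      coboundary f = \<zero>\<^bsub>extension_cocycles Q d e\<^esub>"
    if f: "f \<in> carrier (mat_families (verts Q) e d)" for f
  proof -
    have "N a * f (tail Q a) = f (head Q a) * M a \<longleftrightarrow>
        f (head Q a) * M a - N a * f (tail Q a) = 0\<^sub>m (e (head Q a)) (d (tail Q a))"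
      if a: "a \<in> arcs Q" for a
    proof -
      note c = arrow_carrier[OF a] vertex_carrier[OF f a]
      have 1: "N a * f (tail Q a) \<in> carrier_mat (e (head Q a)) (d (tail Q a))"
        "f (head Q a) * M a \<in> carrier_mat (e (head Q a)) (d (tail Q a))"
        using c by auto
      have "X = Y \<longleftrightarrow> Y - X = 0\<^sub>m m n" if "X \<in> carrier_mat m n" "Y \<in> carrier_mat m n"
        for X Y :: "complex mat" and m n
        using that by (auto simp: mat_eq_iff)
      from this[OF 1] show ?thesis .
    qed
    then show ?thesis
      by (auto simp: coboundary_def extension_cocycles_def mat_families_simps fun_eq_iff
          restrict_def)
  qed
  then show ?thesis unfolding rep_hom_def by (auto simp: mat_families_simps)
qed

lemma split_cocycles_eq_image:
  "split_cocycles Q d M e N = coboundary ` carrier (mat_families (verts Q) e d)"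
proof (rule subset_antisym)
  interpret L: linear_map class_ring "mat_families (verts Q) e d" "extension_cocycles Q d e" coboundary
    by (rule linear_map_coboundary)
  have key: "N a * h (tail Q a) + z a = h (head Q a) * M a \<longleftrightarrow> z a = coboundary h a"
    if h: "h \<in> carrier (mat_families (verts Q) e d)" and z: "z \<in> carrier (extension_cocycles Q d e)"
      and a: "a \<in> arcs Q" for z h a
  proof -
    note c = arrow_carrier[OF a] vertex_carrier[OF h a]
    have "X + Z = Y \<longleftrightarrow> Z = Y - X"
      if "X \<in> carrier_mat m n" "Y \<in> carrier_mat m n" "Z \<in> carrier_mat m n"
      for X Y Z :: "complex mat" and m n
      using that by (auto simp: mat_eq_iff algebra_simps)
    from this[of "N a * h (tail Q a)" "e (head Q a)" "d (tail Q a)" "h (head Q a) * M a" "z a"]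
    show ?thesis using c z a
      by (auto simp: coboundary_def extension_cocycles_def mat_families_simps)
  qed
  have block: "extension_rep Q d M e N z a * (h (tail Q a) @\<^sub>r 1\<^sub>m (d (tail Q a))) =
        (h (head Q a) @\<^sub>r 1\<^sub>m (d (head Q a))) * M a \<longleftrightarrow> z a = coboundary h a"
    if h: "h \<in> carrier (mat_families (verts Q) e d)" and z: "z \<in> carrier (extension_cocycles Q d e)"
      and a: "a \<in> arcs Q" for z h a
  proof -
    note c = arrow_carrier[OF a] vertex_carrier[OF h a]
    have za: "z a \<in> carrier_mat (e (head Q a)) (d (tail Q a))"
      using z a by (auto simp: extension_cocycles_def mat_families_simps)
    have "extension_rep Q d M e N z a * (h (tail Q a) @\<^sub>r 1\<^sub>m (d (tail Q a))) =
        (N a * h (tail Q a) + z a) @\<^sub>r M a"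
      using a mult_four_block_column(1)[OF c(2,1) za c(4) c(3)] by (simp add: extension_rep_def)
    moreover have "(h (head Q a) @\<^sub>r 1\<^sub>m (d (head Q a))) * M a = (h (head Q a) * M a) @\<^sub>r M a"
      using mult_four_block_column(2)[OF c(2,1) za c(4) c(3)] .
    moreover have "(N a * h (tail Q a) + z a) @\<^sub>r M a = (h (head Q a) * M a) @\<^sub>r M a \<longleftrightarrow>
        N a * h (tail Q a) + z a = h (head Q a) * M a"
    proof -
      have "N a * h (tail Q a) + z a \<in> carrier_mat (e (head Q a)) (d (tail Q a))"
        "h (head Q a) * M a \<in> carrier_mat (e (head Q a)) (d (tail Q a))"
        using c za by auto
      from append_rows_inject[OF this c(1)] show ?thesis by metis
    qed
    ultimately show ?thesis using key[OF h z a] by simp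
  qed
  show "split_cocycles Q d M e N \<subseteq> coboundary ` carrier (mat_families (verts Q) e d)"
  proof
    fix z assume "z \<in> split_cocycles Q d M e N"
    then obtain s where z: "z \<in> carrier (extension_cocycles Q d e)"
      and s: "s \<in> rep_hom Q d M (\<lambda>i. e i + d i) (extension_rep Q d M e N z)"
      and sp: "\<And>i. i \<in> verts Q \<Longrightarrow>
        Matrix.mat (d i) (e i + d i) (\<lambda>(p, q). if q = e i + p then 1 else 0) * s i = 1\<^sub>m (d i)"
      unfolding split_cocycles_def by blast
    define h where "h = (\<lambda>i\<in>verts Q. Matrix.mat (e i) (d i) (\<lambda>(p, q). s i $$ (p, q)))"
    have h: "h \<in> carrier (mat_families (verts Q) e d)"
      by (auto simp: h_def mat_families_simps)
    have sh: "s i = h i @\<^sub>r 1\<^sub>m (d i)" if i: "i \<in> verts Q" for i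
    proof -
      have si: "s i \<in> carrier_mat (e i + d i) (d i)" using s i by (auto simp: rep_hom_def)
      have low: "s i $$ (e i + p, q) = (if p = q then 1 else 0)" if "p < d i" "q < d i" for p q
        using projection_index[OF si that] sp[OF i] that by simp
      show ?thesis
      proof (rule eq_matI)
        fix p q assume "p < dim_row (h i @\<^sub>r 1\<^sub>m (d i))" "q < dim_col (h i @\<^sub>r 1\<^sub>m (d i))"
        then have pq: "p < e i + d i" "q < d i" using i by (auto simp: append_rows_def h_def)
        show "s i $$ (p, q) = (h i @\<^sub>r 1\<^sub>m (d i)) $$ (p, q)"
        proof (cases "p < e i")
          case True then show ?thesis using i pq by (simp add: append_rows_def h_def)
        next
          case False then show ?thesis using i pq low[of "p - e i" q]
            by (simp add: append_rows_def h_def)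
        qed
      qed (use si i in \<open>auto simp: append_rows_def h_def\<close>)
    qed
    have "z a = coboundary h a" if a: "a \<in> arcs Q" for a
      using block[OF h z a] s a sh by (auto simp: rep_hom_def)
    then have "z = coboundary h"
      using z by (intro extensionalityI[of _ "arcs Q"])
        (auto simp: coboundary_def extension_cocycles_def mat_families_simps PiE_def)
    then show "z \<in> coboundary ` carrier (mat_families (verts Q) e d)" using h by blast
  qed
  show "coboundary ` carrier (mat_families (verts Q) e d) \<subseteq> split_cocycles Q d M e N"
  proof (rule image_subsetI)
    fix h assume h: "h \<in> carrier (mat_families (verts Q) e d)"
    have z: "coboundary h \<in> carrier (extension_cocycles Q d e)" using h by (rule L.f_im)
    define s where "s = (\<lambda>i\<in>verts Q. h i @\<^sub>r 1\<^sub>m (d i))"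
    have hi: "h i \<in> carrier_mat (e i) (d i)" if "i \<in> verts Q" for i
      using h that by (auto simp: mat_families_simps)
    have sc: "s \<in> (\<Pi>\<^sub>E i\<in>verts Q. carrier_mat (e i + d i) (d i))"
      using hi by (auto simp: s_def)
    have "s \<in> rep_hom Q d M (\<lambda>i. e i + d i) (extension_rep Q d M e N (coboundary h))"
      unfolding rep_hom_def using sc block[OF h z] by (simp add: s_def)
    moreover have "Matrix.mat (d i) (e i + d i) (\<lambda>(p, q). if q = e i + p then 1 else 0) * s i = 1\<^sub>m (d i)"
      if i: "i \<in> verts Q" for i
    proof (rule eq_matI)
      have si: "s i \<in> carrier_mat (e i + d i) (d i)" using sc i by auto
      fix p q assume "p < dim_row (1\<^sub>m (d i) :: complex mat)" "q < dim_col (1\<^sub>m (d i) :: complex mat)"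
      then have pq: "p < d i" "q < d i" by auto
      show "(Matrix.mat (d i) (e i + d i) (\<lambda>(p, q). if q = e i + p then 1 else 0) * s i) $$ (p, q)
          = 1\<^sub>m (d i) $$ (p, q)"
        using projection_index[OF si pq] hi[OF i] i pq by (simp add: s_def append_rows_def)
    qed (use hi[OF i] i in \<open>auto simp: s_def append_rows_def\<close>)
    ultimately show "coboundary h \<in> split_cocycles Q d M e N"
      unfolding split_cocycles_def using z by blast
  qed
qed

lemma hom_dim_minus_ext_dim:
  "int (hom_dim Q d M e N) - ext_dim Q d M e N =
    (\<Sum>i\<in>verts Q. int (d i) * int (e i)) - (\<Sum>a\<in>arcs Q. int (d (tail Q a)) * int (e (head Q a)))"
proof -
  interpret L: linear_map class_ring "mat_families (verts Q) e d" "extension_cocycles Q d e" coboundary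
    by (rule linear_map_coboundary)
  have "vectorspace.dim class_ring (L.W.vs L.imT) + vectorspace.dim class_ring (L.V.vs L.kerT)
      = vectorspace.dim class_ring (mat_families (verts Q) e d)"
    by (rule L.rank_nullity) (rule dim_mat_families, simp)
  moreover have "L.imT = split_cocycles Q d M e N" "L.kerT = rep_hom Q d M e N"
    unfolding split_cocycles_eq_image rep_hom_eq_kernel L.im_def L.ker_def by auto
  ultimately have "int (hom_dim Q d M e N) - ext_dim Q d M e N =
      int (vectorspace.dim class_ring (mat_families (verts Q) e d)) -
      int (vectorspace.dim class_ring (extension_cocycles Q d e))"
    unfolding hom_dim_def ext_dim_def by simp
  also have "\<dots> = (\<Sum>i\<in>verts Q. int (d i) * int (e i)) -
      (\<Sum>a\<in>arcs Q. int (d (tail Q a)) * int (e (head Q a)))"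
    unfolding extension_cocycles_def by (simp add: dim_mat_families mult.commute)
  finally show ?thesis .
qed

end

lemma is_euler_form_unique:
  assumes Q: "fin_digraph Q"
  shows "is_euler_form Q B \<longleftrightarrow> B = (\<lambda>x y. (\<Sum>i\<in>verts Q. x i * y i) -
    (\<Sum>a\<in>arcs Q. x (tail Q a) * y (head Q a)))" (is "_ \<longleftrightarrow> B = ?F")
proof
  interpret fin_digraph Q by (rule Q)
  show "is_euler_form Q B" if "B = ?F"
    unfolding that is_euler_form_def
  proof (intro conjI allI impI ballI)
    fix x x' y y' :: "'a \<Rightarrow> int" assume "\<forall>i\<in>verts Q. x i = x' i \<and> y i = y' i"
    then show "?F x y = ?F x' y'" by simp
  next
    fix d e M N assume "M \<in> rep_space Q d" "N \<in> rep_space Q e"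
    then show "?F (\<lambda>i. int (d i)) (\<lambda>i. int (e i)) = int (hom_dim Q d M e N) - ext_dim Q d M e N"
      by (simp only: hom_dim_minus_ext_dim[OF Q])
  qed (simp_all add: algebra_simps sum.distrib)
  show "B = ?F" if B: "is_euler_form Q B"
  proof -
    have addl: "B (\<lambda>i. x i + x' i) y = B x y + B x' y"
      and addr: "B x (\<lambda>i. y i + y' i) = B x y + B x y'" for x x' y y'
      using B unfolding is_euler_form_def by blast+
    have nat: "B (\<lambda>i. int (d i)) (\<lambda>i. int (e i)) = ?F (\<lambda>i. int (d i)) (\<lambda>i. int (e i))" for d e
    proof -
      have Z: "(\<lambda>a\<in>arcs Q. 0\<^sub>m (c (head Q a)) (c (tail Q a))) \<in> rep_space Q c" for c
        by (auto simp: rep_space_def)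
      show ?thesis
        using B Z unfolding is_euler_form_def by (metis (no_types, lifting) hom_dim_minus_ext_dim[OF Q])
    qed
    show ?thesis
    proof (intro ext)
      fix x y :: "'a \<Rightarrow> int"
      define p where "p z = (\<lambda>i. int (nat (z i)))" for z :: "'a \<Rightarrow> int"
      define n where "n z = (\<lambda>i. int (nat (- z i)))" for z :: "'a \<Rightarrow> int"
      have pn: "(\<lambda>i. z i + n z i) = p z" for z by (auto simp: p_def n_def)
      have pn': "z i + n z i = p z i" for z i by (simp add: p_def n_def)
      have addlF: "?F (\<lambda>i. x i + x' i) y = ?F x y + ?F x' y"
        and addrF: "?F x (\<lambda>i. y i + y' i) = ?F x y + ?F x y'" for x x' y y' :: "'a \<Rightarrow> int"
        by (simp_all add: algebra_simps sum.distrib)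
      have base: "B (f x) (g y) = ?F (f x) (g y)" if "f \<in> {p, n}" "g \<in> {p, n}" for f g
        using that by (elim insertE emptyE) (simp_all only: p_def n_def nat)
      have r: "B (f x) y = ?F (f x) y" if "f \<in> {p, n}" for f
        using addr[of "f x" y "n y"] addrF[of "f x" y "n y"] base[OF that, of n] base[OF that, of p]
        unfolding pn pn' by simp
      show "B x y = ?F x y"
        using addl[of x "n x" y] addlF[of x "n x" y] r[of n] r[of p] unfolding pn pn' by simp
    qed
  qed
qed

lemma euler_form_eq:
  assumes "fin_digraph Q"
  shows "is_euler_form Q (euler_form Q)"
    and "euler_form Q x y =
      (\<Sum>i\<in>verts Q. x i * y i) - (\<Sum>a\<in>arcs Q. x (tail Q a) * y (head Q a))"
proof -
  have "euler_form Q = (\<lambda>x y. (\<Sum>i\<in>verts Q. x i * y i) -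
      (\<Sum>a\<in>arcs Q. x (tail Q a) * y (head Q a)))"
    unfolding euler_form_def is_euler_form_unique[OF assms] by simp
  then show "is_euler_form Q (euler_form Q)"
    and "euler_form Q x y =
      (\<Sum>i\<in>verts Q. x i * y i) - (\<Sum>a\<in>arcs Q. x (tail Q a) * y (head Q a))"
    using is_euler_form_unique[OF assms] by auto
qed



section \<open>The Caldero-Chapoton map\<close>

text \<open>Integral Laurent polynomials in the variables \<open>u\<^sub>i\<close>: the exponents are finitely
  supported functions to \<^typ>\<open>int\<close>, so that the ring is the group ring of the free abelian
  group on the vertices.\<close>

type_synonym 'v laurent = "('v \<Rightarrow>\<^sub>0 int) \<Rightarrow>\<^sub>0 int"

definition laurent_var_power :: "'v \<Rightarrow> int \<Rightarrow> 'v laurent" where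
  "laurent_var_power i n = Poly_Mapping.single (Poly_Mapping.single i n) 1"

abbreviation basis_vector :: "'v \<Rightarrow> 'v \<Rightarrow> int" where
  "basis_vector i \<equiv> (\<lambda>j. if j = i then 1 else 0)"

text \<open>The quiver Grassmannian is empty unless \<open>e \<le> d\<close> pointwise, so the sum is finite.\<close>

definition caldero_chapoton ::
    "('v, 'a) pre_digraph \<Rightarrow> ('v \<Rightarrow> nat) \<Rightarrow> ('a \<Rightarrow> complex mat) \<Rightarrow> 'v laurent" where
  "caldero_chapoton Q d M =
     (\<Sum>e \<in> (\<Pi>\<^sub>E i\<in>verts Q. {..d i}).
        of_int (euler_characteristic (quiver_grassmannian Q d M e)) *
        (\<Prod>i\<in>verts Q. laurent_var_power i
           (- euler_form Q (\<lambda>j. int (e j)) (basis_vector i)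
            - euler_form Q (basis_vector i) (\<lambda>j. int (d j) - int (e j)))))"

end

theory Submission
  imports Defs "HOL-Analysis.Uniform_Limit" "HOL-Analysis.Homotopy"
begin

text \<open>
  There is a nonzero polynomial function \<open>f\<close> on the representation space such that \<open>f M \<noteq> 0\<close> forces
  the extensions of \<open>N\<close> by \<open>M / N\<close> to vanish for all subrepresentations \<open>N\<close> of \<open>M\<close>, of all dimension
  vectors (generic smoothness).  Otherwise an ultraproduct of copies of the complex numbers contains
  a representation \<open>m\<close> at which no nonzero polynomial function vanishes, a subrepresentation of it
  given by an idempotent \<open>P\<close>, and a nonzero element \<open>l\<close> of the dual of the space of extensions.  The partial
  derivatives with respect to the entries of \<open>m\<close> extend to derivations of this field of
  characteristic 0.  Differentiating \<open>m P = P m P\<close> and pairing with \<open>l\<close> shows that the trace of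
  \<open>l\<close> against each derivative of \<open>m\<close> is zero, hence \<open>l = 0\<close>.

  Let \<open>f M \<noteq> 0\<close>.  Subspaces are encoded by Hermitian projections, so that all subrepresentations
  form a compact set, and an iteration deforms those of any representation close to \<open>M\<close>
  continuously into those of any other one, fixing them if the two representations agree.  So the
  quiver Grassmannians of \<open>M\<close> and of nearby representations are homotopy equivalent.  The points
  with \<open>f \<noteq> 0\<close> on a complex line through two such representations are the complement of a finite
  set, which is connected; hence the Betti numbers, and with them \<open>X\<^sub>M\<close>, are the same at both.
\<close>


section \<open>Matrices with finite support\<close>

text \<open>The tangent space of the quiver Grassmannian at \<open>N\<close> is Hom(N, M/N), and its
  obstructions lie in Ext(N, M/N). Where the latter vanishes, being a subrepresentation is an
  equation with surjective derivative, and solutions persist when \<open>M\<close> moves. One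
  polynomial has to exclude obstructions at infinitely many \<open>N\<close>; instead of eliminating
  \<open>N\<close> by dimension theory, all would-be counterexamples are collected in one generic
  representation. A derivation there also acts on the entries of \<open>P\<close>, which need not be
  polynomials in those of \<open>m\<close>: this is why derivations must be extended. The unknown
  derivative of \<open>P\<close> drops out of the trace.

  On the topological side the new subspace is sought as a graph over the old one, so the equation is
  solved in a linear space. The round trip between two Grassmannians is then joined to the identity
  by letting the intermediate representation run along a segment.\<close>

text \<open>Matrices with rows and columns indexed by an arbitrary type form a non-unital ring; all
  representations and all their subspaces, of all dimensions, live in one such ring, so that no
  side conditions on dimensions are needed.\<close>

typedef (overloaded) ('i, 'k::zero) fmat = "{f :: 'i \<Rightarrow> 'i \<Rightarrow> 'k. finite {(i, j). f i j \<noteq> 0}}"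
  morphisms entry Fmat
  by (rule exI[of _ "\<lambda>i j. 0"]) simp

setup_lifting type_definition_fmat

lemma fmat_eqI: "(\<And>i j. entry X i j = entry Y i j) \<Longrightarrow> X = Y"
  unfolding entry_inject[symmetric] by (intro ext)

lemma finite_entries: "finite {p. entry X (fst p) (snd p) \<noteq> 0}"
proof -
  have "{p. entry X (fst p) (snd p) \<noteq> 0} = {(i, j). entry X i j \<noteq> 0}" by auto
  then show ?thesis using entry[of X] by simp
qed

definition indices :: "('i, 'k::zero) fmat \<Rightarrow> 'i set" where
  "indices X = (\<Union>p\<in>{p. entry X (fst p) (snd p) \<noteq> 0}. {fst p, snd p})"

lemma finite_indices [simp]: "finite (indices X)"
  unfolding indices_def by (rule finite_UN_I[OF finite_entries]) simp

lemma entry_zero_outside: "i \<notin> indices X \<or> j \<notin> indices X \<Longrightarrow> entry X i j = 0"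
  unfolding indices_def by force

lemma entry_zero_outside_superset: "indices X \<subseteq> J \<Longrightarrow> i \<notin> J \<or> j \<notin> J \<Longrightarrow> entry X i j = 0"
  using entry_zero_outside[of i X j] by blast

lemma Fmat_inverse': "finite B \<Longrightarrow> (\<And>i j. f i j \<noteq> 0 \<Longrightarrow> i \<in> B \<and> j \<in> B) \<Longrightarrow> entry (Fmat f) = f"
  by (rule Fmat_inverse) (auto intro: finite_subset[of _ "B \<times> B"])

instantiation fmat :: (type, ab_group_add) ab_group_add
begin

lift_definition zero_fmat :: "('a, 'b) fmat" is "\<lambda>i j. 0" by simp

lift_definition plus_fmat :: "('a, 'b) fmat \<Rightarrow> ('a, 'b) fmat \<Rightarrow> ('a, 'b) fmat"
  is "\<lambda>f g i j. f i j + g i j"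
  subgoal for f g
    by (rule finite_subset[of _ "{(i, j). f i j \<noteq> 0} \<union> {(i, j). g i j \<noteq> 0}"]) auto
  done

lift_definition uminus_fmat :: "('a, 'b) fmat \<Rightarrow> ('a, 'b) fmat" is "\<lambda>f i j. - f i j" by simp

definition "X - Y = X + - (Y :: ('a, 'b) fmat)"

lemma entry_zero [simp]: "entry (0 :: ('a, 'b) fmat) i j = 0" by transfer simp

lemma entry_plus [simp]: "entry (X + Y :: ('a, 'b) fmat) i j = entry X i j + entry Y i j"
  by transfer simp

lemma entry_uminus [simp]: "entry (- X :: ('a, 'b) fmat) i j = - entry X i j" by transfer simp

lemma entry_minus [simp]: "entry (X - Y :: ('a, 'b) fmat) i j = entry X i j - entry Y i j"
  by (simp add: minus_fmat_def)

instance
  by standard (rule fmat_eqI, simp add: algebra_simps)+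

end

lemma entry_sum [simp]: "entry (sum f A) i j = (\<Sum>a\<in>A. entry (f a) i j)"
  by (induction A rule: infinite_finite_induct) auto

instantiation fmat :: (type, ring) ring
begin

definition "X * Y = Fmat (\<lambda>i k. \<Sum>j\<in>indices X. entry X i j * entry Y j k)"

lemma entry_times_indices:
  "entry (X * Y) i k = (\<Sum>j\<in>indices X. entry X i j * entry (Y :: ('a, 'b) fmat) j k)"
proof -
  have "entry (X * Y) = (\<lambda>i k. \<Sum>j\<in>indices X. entry X i j * entry Y j k)"
    unfolding times_fmat_def
  proof (rule Fmat_inverse'[of "indices X \<union> indices Y"])
    fix i k assume "(\<Sum>j\<in>indices X. entry X i j * entry Y j k) \<noteq> 0"
    then obtain j where "entry X i j * entry Y j k \<noteq> 0" by (rule sum.not_neutral_contains_not_neutral)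
    then have "entry X i j \<noteq> 0" "entry Y j k \<noteq> 0" by auto
    then show "i \<in> indices X \<union> indices Y \<and> k \<in> indices X \<union> indices Y"
      using entry_zero_outside[of i X j] entry_zero_outside[of j Y k] by auto
  qed simp
  then show ?thesis by simp
qed

text \<open>Any finite \<open>J\<close> covering the nonzero summands will do, so all products
  occurring in one identity can be expanded over the same index set.\<close>

lemma entry_times:
  fixes X Y :: "('a, 'b) fmat"
  assumes "finite J" "\<And>j. j \<notin> J \<Longrightarrow> entry X i j = 0 \<or> entry Y j k = 0"
  shows "entry (X * Y) i k = (\<Sum>j\<in>J. entry X i j * entry Y j k)"
proof -
  have "entry (X * Y) i k = (\<Sum>j\<in>J \<union> indices X. entry X i j * entry Y j k)"
    unfolding entry_times_indices
    by (rule sum.mono_neutral_left) (use assms in \<open>auto simp: entry_zero_outside\<close>)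
  also have "\<dots> = (\<Sum>j\<in>J. entry X i j * entry Y j k)"
    by (rule sum.mono_neutral_right) (use assms(1) in simp, simp, use assms(2) in fastforce)
  finally show ?thesis .
qed

instance
proof
  fix X Y Z :: "('a, 'b) fmat"
  show "X * Y * Z = X * (Y * Z)"
  proof (rule fmat_eqI)
    fix i l
    define J where "J = indices X \<union> indices Y \<union> indices Z"
    have J: "finite J" by (simp add: J_def)
    have o: "j \<notin> J \<Longrightarrow> entry X i' j = 0" "j \<notin> J \<Longrightarrow> entry Y j i' = 0" "j \<notin> J \<Longrightarrow> entry Y i' j = 0" 
      "j \<notin> J \<Longrightarrow> entry Z j i' = 0" for j i'
      by (simp_all add: J_def entry_zero_outside)
    have "entry (X * Y * Z) i l = (\<Sum>k\<in>J. entry (X * Y) i k * entry Z k l)"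
      by (rule entry_times[OF J]) (simp add: o)
    also have "\<dots> = (\<Sum>k\<in>J. \<Sum>j\<in>J. entry X i j * entry Y j k * entry Z k l)"
      by (simp add: entry_times[OF J] o sum_distrib_right)
    also have "\<dots> = (\<Sum>j\<in>J. \<Sum>k\<in>J. entry X i j * (entry Y j k * entry Z k l))"
      by (subst sum.swap) (simp add: mult.assoc)
    also have "\<dots> = (\<Sum>j\<in>J. entry X i j * entry (Y * Z) j l)"
      by (simp add: entry_times[OF J] o sum_distrib_left)
    also have "\<dots> = entry (X * (Y * Z)) i l"
      by (rule entry_times[OF J, symmetric]) (simp add: o)
    finally show "entry (X * Y * Z) i l = entry (X * (Y * Z)) i l" .
  qed
  show "(X + Y) * Z = X * Z + Y * Z"
  proof (rule fmat_eqI)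
    fix i l
    define J where "J = indices X \<union> indices Y \<union> indices Z"
    have J: "finite J" by (simp add: J_def)
    have o: "j \<notin> J \<Longrightarrow> entry Z j i' = 0" for j i'
      by (simp_all add: J_def entry_zero_outside)
    show "entry ((X + Y) * Z) i l = entry (X * Z + Y * Z) i l"
      by (simp add: entry_times[OF J] o distrib_right sum.distrib)
  qed
  show "X * (Y + Z) = X * Y + X * Z"
    by (rule fmat_eqI) (simp add: entry_times_indices distrib_left sum.distrib)
qed

end

lemma indices_subset_entry: "indices X \<subseteq> B \<longleftrightarrow> (\<forall>i j. entry X i j \<noteq> 0 \<longrightarrow> i \<in> B \<and> j \<in> B)"
proof
  assume "indices X \<subseteq> B"
  then show "\<forall>i j. entry X i j \<noteq> 0 \<longrightarrow> i \<in> B \<and> j \<in> B" using entry_zero_outside[of _ X] by blast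
qed (auto simp: indices_def)

text \<open>Support relations take over the role of dimensions: they say between which coordinate
  spaces a matrix acts, and \<open>rel_times\<close> composes them.\<close>

definition rel :: "('i \<times> 'i) set \<Rightarrow> ('i, 'k::zero) fmat \<Rightarrow> bool" where
  "rel R X \<longleftrightarrow> (\<forall>i j. entry X i j \<noteq> 0 \<longrightarrow> (i, j) \<in> R)"

lemma rel_zero [simp]: "rel R 0" by (simp add: rel_def)

lemma rel_plus:
  fixes X :: "('i, 'k::ab_group_add) fmat"
  shows "rel R X \<Longrightarrow> rel R Y \<Longrightarrow> rel R (X + Y)"
  unfolding rel_def by (metis entry_plus add.right_neutral)

lemma rel_uminus:
  fixes X :: "('i, 'k::ab_group_add) fmat"
  shows "rel R X \<Longrightarrow> rel R (- X)"
  unfolding rel_def by simp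

lemma rel_minus:
  fixes X :: "('i, 'k::ab_group_add) fmat"
  shows "rel R X \<Longrightarrow> rel R Y \<Longrightarrow> rel R (X - Y)"
  using rel_plus[of R X "- Y"] rel_uminus[of R Y] by simp

lemma rel_sum: "(\<And>a. a \<in> A \<Longrightarrow> rel R (f a)) \<Longrightarrow> rel R (sum f A)"
  by (induction A rule: infinite_finite_induct) (auto intro: rel_plus)

lemma rel_times:
  fixes X :: "('i, 'k::ring) fmat"
  assumes "rel R X" "rel S Y" "R O S \<subseteq> T"
  shows "rel T (X * Y)"
  unfolding rel_def
proof (intro allI impI)
  fix i k assume "entry (X * Y) i k \<noteq> 0"
  then obtain j where "entry X i j * entry Y j k \<noteq> 0"
    unfolding entry_times_indices by (rule sum.not_neutral_contains_not_neutral)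
  then have "entry X i j \<noteq> 0" "entry Y j k \<noteq> 0" by auto
  then show "(i, k) \<in> T" using assms unfolding rel_def by blast
qed

definition tr :: "('i, 'k::comm_ring) fmat \<Rightarrow> 'k" where
  "tr X = (\<Sum>i\<in>indices X. entry X i i)"

lemma tr_eq: "finite B \<Longrightarrow> (\<And>i. i \<notin> B \<Longrightarrow> entry X i i = 0) \<Longrightarrow> tr X = (\<Sum>i\<in>B. entry X i i)"
proof -
  assume B: "finite B" "\<And>i. i \<notin> B \<Longrightarrow> entry X i i = 0"
  have "tr X = (\<Sum>i\<in>B \<union> indices X. entry X i i)"
    unfolding tr_def by (rule sum.mono_neutral_left) (use B in \<open>auto simp: entry_zero_outside\<close>)
  also have "\<dots> = (\<Sum>i\<in>B. entry X i i)"
    by (rule sum.mono_neutral_right) (use B in auto)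
  finally show ?thesis .
qed

lemma tr_plus: "tr (X + Y) = tr X + tr Y"
proof -
  define B where "B = indices X \<union> indices Y"
  have "finite B" "\<And>i. i \<notin> B \<Longrightarrow> entry X i i = 0" "\<And>i. i \<notin> B \<Longrightarrow> entry Y i i = 0"
    by (simp_all add: B_def entry_zero_outside)
  then show ?thesis by (simp add: tr_eq[of B] sum.distrib)
qed

lemma tr_zero [simp]: "tr 0 = 0" by (simp add: tr_def)

lemma tr_uminus: "tr (- X) = - tr X"
  by (subst tr_eq[of "indices X"]) (simp_all add: tr_def entry_zero_outside sum_negf)

lemma tr_minus: "tr (X - Y) = tr X - tr Y"
  using tr_plus[of X "- Y"] by (simp add: tr_uminus)

lemma tr_sum: "tr (sum f A) = (\<Sum>a\<in>A. tr (f a))"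
  by (induction A rule: infinite_finite_induct) (auto simp: tr_plus)

lemma tr_commute: "tr (X * Y) = tr (Y * X)"
proof -
  define J where "J = indices X \<union> indices Y"
  have J: "finite J" by (simp add: J_def)
  have o: "j \<notin> J \<Longrightarrow> entry X i' j = 0" "j \<notin> J \<Longrightarrow> entry Y j i' = 0" "j \<notin> J \<Longrightarrow> entry Y i' j = 0" 
      "j \<notin> J \<Longrightarrow> entry X j i' = 0" for j i'
    by (simp_all add: J_def entry_zero_outside)
  have "tr (X * Y) = (\<Sum>i\<in>J. \<Sum>j\<in>J. entry X i j * entry Y j i)"
    by (subst tr_eq[OF J]) (simp_all add: entry_times[OF J] o)
  also have "\<dots> = (\<Sum>j\<in>J. \<Sum>i\<in>J. entry Y j i * entry X i j)"
    by (subst sum.swap) (simp add: mult.commute)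
  also have "\<dots> = tr (Y * X)"
    by (subst tr_eq[OF J]) (simp_all add: entry_times[OF J] o)
  finally show ?thesis .
qed

lift_definition munit :: "'i \<Rightarrow> 'i \<Rightarrow> 'k::zero \<Rightarrow> ('i, 'k) fmat"
  is "\<lambda>i j c i' j'. if i' = i \<and> j' = j then c else 0"
  subgoal for i j c by (rule finite_subset[of _ "{(i, j)}"]) auto
  done

lemma entry_munit [simp]: "entry (munit i j c) i' j' = (if i' = i \<and> j' = j then c else 0)"
  by transfer simp

definition map_fmat :: "('k \<Rightarrow> 'l) \<Rightarrow> ('i, 'k::zero) fmat \<Rightarrow> ('i, 'l::zero) fmat" where
  "map_fmat f X = Fmat (\<lambda>i j. f (entry X i j))"

lemma entry_map_fmat: "f 0 = 0 \<Longrightarrow> entry (map_fmat f X) i j = f (entry X i j)"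
  unfolding map_fmat_def
  by (subst Fmat_inverse'[of "indices X"]) (auto, (metis entry_zero_outside)+)


section \<open>The Frobenius inner product\<close>

instantiation fmat :: (type, real_vector) real_vector
begin

lift_definition scaleR_fmat :: "real \<Rightarrow> ('a, 'b) fmat \<Rightarrow> ('a, 'b) fmat" is "\<lambda>c f i j. c *\<^sub>R f i j"
  subgoal for c f by (rule finite_subset[of _ "{(i, j). f i j \<noteq> 0}"]) auto
  done

lemma entry_scaleR [simp]: "entry (c *\<^sub>R X :: ('a, 'b) fmat) i j = c *\<^sub>R entry X i j"
  by transfer simp

instance
  by standard (rule fmat_eqI, simp add: scaleR_add_right scaleR_add_left)+

end

instantiation fmat :: (type, real_inner) real_inner
begin

definition inner_fmat :: "('a, 'b) fmat \<Rightarrow> ('a, 'b) fmat \<Rightarrow> real" where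
  "inner_fmat X Y = (\<Sum>p | entry X (fst p) (snd p) \<noteq> 0. inner (entry X (fst p) (snd p)) (entry Y (fst p) (snd p)))"

definition norm_fmat :: "('a, 'b) fmat \<Rightarrow> real" where "norm_fmat X = sqrt (inner X X)"
definition sgn_fmat :: "('a, 'b) fmat \<Rightarrow> ('a, 'b) fmat" where "sgn_fmat X = inverse (norm X) *\<^sub>R X"
definition dist_fmat :: "('a, 'b) fmat \<Rightarrow> ('a, 'b) fmat \<Rightarrow> real" where "dist_fmat X Y = norm (X - Y)"
definition uniformity_fmat :: "(('a, 'b) fmat \<times> ('a, 'b) fmat) filter" where
  "uniformity_fmat = (INF e\<in>{0 <..}. principal {(x, y). dist x y < e})"
definition open_fmat :: "('a, 'b) fmat set \<Rightarrow> bool" where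
  "open_fmat U = (\<forall>x\<in>U. eventually (\<lambda>(x', y). x' = x \<longrightarrow> y \<in> U) uniformity)"

lemma inner_fmat_eq:
  fixes X Y :: "('a, 'b) fmat"
  assumes "finite S" "\<And>i j. (i, j) \<notin> S \<Longrightarrow> entry X i j = 0 \<or> entry Y i j = 0"
  shows "inner X Y = (\<Sum>p\<in>S. inner (entry X (fst p) (snd p)) (entry Y (fst p) (snd p)))"
proof -
  let ?f = "\<lambda>p. inner (entry X (fst p) (snd p)) (entry Y (fst p) (snd p))"
  have "inner X Y = sum ?f (S \<union> {p. entry X (fst p) (snd p) \<noteq> 0})"
    unfolding inner_fmat_def
    by (rule sum.mono_neutral_left) (use assms finite_entries[of X] in auto)
  also have "\<dots> = sum ?f S"
    by (rule sum.mono_neutral_right) (use assms finite_entries[of X] in force)+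
  finally show ?thesis .
qed

instance
proof
  fix X Y Z :: "('a, 'b) fmat" and r :: real
  define S where "S = (indices X \<union> indices Y \<union> indices Z) \<times> (indices X \<union> indices Y \<union> indices Z)"
  have S: "finite S" by (simp add: S_def)
  have o: "entry X i j = 0 \<and> entry Y i j = 0 \<and> entry Z i j = 0" if "(i, j) \<notin> S" for i j
    using that by (auto simp: S_def entry_zero_outside)
  note e = inner_fmat_eq[OF S]
  show "inner X Y = inner Y X" by (simp add: e o inner_commute)
  show "inner (X + Y) Z = inner X Z + inner Y Z" by (simp add: e o inner_add_left sum.distrib)
  show "inner (r *\<^sub>R X) Y = r * inner X Y" by (simp add: e o sum_distrib_left)
  show "0 \<le> inner X X" by (simp add: e o sum_nonneg)
  show "inner X X = 0 \<longleftrightarrow> X = 0"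
  proof
    assume "inner X X = 0"
    then have 0: "\<forall>p\<in>S. inner (entry X (fst p) (snd p)) (entry X (fst p) (snd p)) = 0"
      using S by (simp add: e o sum_nonneg_eq_0_iff)
    have "entry X i j = 0" for i j
      using 0 o by (cases "(i, j) \<in> S") force+
    then show "X = 0" by (intro fmat_eqI) simp
  qed (simp add: inner_fmat_def)
qed (simp_all add: norm_fmat_def sgn_fmat_def dist_fmat_def uniformity_fmat_def open_fmat_def)

end

lemma norm_entry_le: "norm (entry X i j) \<le> norm X"
proof -
  let ?S = "insert (i, j) (indices X \<times> indices X)"
  have "(norm (entry X i j))\<^sup>2 \<le> (\<Sum>p\<in>?S. (norm (entry X (fst p) (snd p)))\<^sup>2)"
    by (rule order_trans[OF _ sum_mono2[of _ "{(i, j)}"]]) auto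
  also have "\<dots> = inner X X"
    by (subst inner_fmat_eq[of ?S]) (auto simp: entry_zero_outside power2_norm_eq_inner)
  finally show ?thesis by (simp add: norm_fmat_def real_le_rsqrt)
qed

lemma norm_fmat_sqr:
  assumes "finite J" "indices X \<subseteq> J"
  shows "(norm X)\<^sup>2 = (\<Sum>i\<in>J. \<Sum>j\<in>J. (norm (entry X i j))\<^sup>2)"
proof -
  have "(norm X)\<^sup>2 = inner X X" by (simp add: power2_norm_eq_inner)
  also have "\<dots> = (\<Sum>p\<in>J \<times> J. (norm (entry X (fst p) (snd p)))\<^sup>2)"
    by (subst inner_fmat_eq[of "J \<times> J"])
      (use assms in \<open>auto simp: entry_zero_outside_superset power2_norm_eq_inner\<close>)
  finally show ?thesis by (simp add: sum.cartesian_product case_prod_beta)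
qed

instance fmat :: (type, "{real_inner, real_normed_field}") real_normed_algebra
proof
  fix X Y :: "('a, 'b) fmat" and r :: real
  show "r *\<^sub>R X * Y = r *\<^sub>R (X * Y)"
  proof (rule fmat_eqI)
    fix i k
    show "entry (r *\<^sub>R X * Y) i k = entry (r *\<^sub>R (X * Y)) i k"
      by (simp add: entry_times[of "indices X"] entry_zero_outside scaleR_sum_right)
  qed
  show "X * r *\<^sub>R Y = r *\<^sub>R (X * Y)"
    by (rule fmat_eqI) (simp add: entry_times[of "indices X"] entry_zero_outside scaleR_sum_right)
  define J where "J = indices X \<union> indices Y \<union> indices (X * Y)"
  have J: "finite J" "indices X \<subseteq> J" "indices Y \<subseteq> J" "indices (X * Y) \<subseteq> J" by (auto simp: J_def)
  have "(norm (X * Y))\<^sup>2 = (\<Sum>i\<in>J. \<Sum>k\<in>J. (norm (entry (X * Y) i k))\<^sup>2)"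
    by (rule norm_fmat_sqr) (use J in auto)
  also have "\<dots> \<le> (\<Sum>i\<in>J. \<Sum>k\<in>J. (\<Sum>j\<in>J. (norm (entry X i j))\<^sup>2) * (\<Sum>j\<in>J. (norm (entry Y j k))\<^sup>2))"
  proof (intro sum_mono)
    fix i k
    have "norm (entry (X * Y) i k) \<le> (\<Sum>j\<in>J. norm (entry X i j) * norm (entry Y j k))"
      by (subst entry_times[of J])
        (use J in \<open>auto simp: entry_zero_outside_superset norm_mult intro!: sum_norm_le\<close>)
    also have "\<dots> \<le> L2_set (\<lambda>j. norm (entry X i j)) J * L2_set (\<lambda>j. norm (entry Y j k)) J"
      using L2_set_mult_ineq[of "\<lambda>j. norm (entry X i j)" "\<lambda>j. norm (entry Y j k)" J] by simp
    finally have "(norm (entry (X * Y) i k))\<^sup>2 \<le>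
        (L2_set (\<lambda>j. norm (entry X i j)) J * L2_set (\<lambda>j. norm (entry Y j k)) J)\<^sup>2"
      by (rule power_mono) simp
    then show "(norm (entry (X * Y) i k))\<^sup>2 \<le>
        (\<Sum>j\<in>J. (norm (entry X i j))\<^sup>2) * (\<Sum>j\<in>J. (norm (entry Y j k))\<^sup>2)"
      by (simp add: L2_set_def power_mult_distrib sum_nonneg)
  qed
  also have "\<dots> = (\<Sum>i\<in>J. \<Sum>j\<in>J. (norm (entry X i j))\<^sup>2) * (\<Sum>k\<in>J. \<Sum>j\<in>J. (norm (entry Y j k))\<^sup>2)"
    by (simp add: sum_product)
  also have "\<dots> = (norm X * norm Y)\<^sup>2"
    by (subst (2) sum.swap) (simp add: norm_fmat_sqr[OF J(1,2)] norm_fmat_sqr[OF J(1,3)] power_mult_distrib)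
  finally show "norm (X * Y) \<le> norm X * norm Y" by (rule power2_le_imp_le) simp
qed

lemma bounded_linear_entry: "bounded_linear (\<lambda>X. entry X i j)"
  by (rule bounded_linear_intro[of _ 1]) (auto simp: norm_entry_le)

lemma fmat_eq_sum_munit:
  assumes "finite B" "indices X \<subseteq> B"
  shows "X = (\<Sum>i\<in>B. \<Sum>j\<in>B. munit i j (entry X i j))"
proof (rule fmat_eqI)
  fix i j
  have "(\<Sum>x\<in>B. \<Sum>y\<in>B. if i = x \<and> j = y then entry X x y else 0)
      = (\<Sum>x\<in>B. if i = x then (\<Sum>y\<in>B. if j = y then entry X x y else 0) else 0)"
    by (intro sum.cong) auto
  also have "\<dots> = (if i \<in> B \<and> j \<in> B then entry X i j else 0)" using assms by simp
  also have "\<dots> = entry X i j" using assms(2) entry_zero_outside by fastforce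
  finally show "entry X i j = entry (\<Sum>i\<in>B. \<Sum>j\<in>B. munit i j (entry X i j)) i j" by simp
qed

lemma bounded_linear_munit: "bounded_linear (munit i j :: 'k::real_inner \<Rightarrow> ('i, 'k) fmat)"
proof (rule bounded_linear_intro[of _ 1])
  fix x y :: 'k and r :: real
  show "munit i j (x + y) = (munit i j x + munit i j y :: ('i, 'k) fmat)" by (rule fmat_eqI) simp
  show "munit i j (r *\<^sub>R x) = (r *\<^sub>R munit i j x :: ('i, 'k) fmat)" by (rule fmat_eqI) simp
  have "inner (munit i j x) (munit i j x :: ('i, 'k) fmat) = inner x x"
    by (subst inner_fmat_eq[of "{(i, j)}"]) auto
  then show "norm (munit i j x :: ('i, 'k) fmat) \<le> norm x * 1"
    by (simp add: norm_fmat_def norm_eq_sqrt_inner)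
qed

lemma closed_indices_subset: "closed {X :: ('i, 'k::real_inner) fmat. indices X \<subseteq> B}"
proof -
  have "{X :: ('i, 'k) fmat. indices X \<subseteq> B} =
      (\<Inter>i. \<Inter>j. if i \<in> B \<and> j \<in> B then UNIV else {X. entry X i j = 0})"
    by (auto simp: indices_subset_entry split: if_splits)
  moreover have "closed {X :: ('i, 'k) fmat. entry X i j = 0}" for i j
    by (intro closed_Collect_eq continuous_intros bounded_linear.continuous_on[OF bounded_linear_entry])
  ultimately show ?thesis by (simp only:) (intro closed_INT ballI, simp)
qed

text \<open>The space of all finitely supported matrices may be infinite dimensional, hence the
  fixed finite support. The set is closed and contained in a finite sum of images of compact balls
  under the maps \<open>munit i j\<close>, and sums of compact sets are compact.\<close>

lemma compact_fmat_ball: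
  assumes B: "finite B"
  shows "compact {X :: ('i, 'k::{real_inner, heine_borel}) fmat. indices X \<subseteq> B \<and> norm X \<le> r}"
proof -
  have sums: "compact {\<Sum>a\<in>A. f a (x a) | x. \<forall>a\<in>A. x a \<in> cball 0 r}"
    if "finite A" "\<And>a. bounded_linear (f a)" for A :: "'c set" and f :: "'c \<Rightarrow> 'k \<Rightarrow> ('i, 'k) fmat"
    using that(1)
  proof induction
    case empty then show ?case by simp
  next
    case (insert a A)
    have "{\<Sum>a\<in>insert a A. f a (x a) | x. \<forall>a\<in>insert a A. x a \<in> cball 0 r} =
        {y + z | y z. y \<in> f a ` cball 0 r \<and> z \<in> {\<Sum>a\<in>A. f a (x a) | x. \<forall>a\<in>A. x a \<in> cball 0 r}}"
    proof (rule subset_antisym; rule subsetI)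
      fix w assume "w \<in> {\<Sum>a\<in>insert a A. f a (x a) | x. \<forall>a\<in>insert a A. x a \<in> cball 0 r}"
      then show "w \<in> {y + z | y z. y \<in> f a ` cball 0 r \<and> z \<in> {\<Sum>a\<in>A. f a (x a) | x. \<forall>a\<in>A. x a \<in> cball 0 r}}"
        using insert.hyps by (auto 4 4)
    next
      fix w assume "w \<in> {y + z | y z. y \<in> f a ` cball 0 r \<and> z \<in> {\<Sum>a\<in>A. f a (x a) | x. \<forall>a\<in>A. x a \<in> cball 0 r}}"
      then obtain c x where w: "c \<in> cball 0 r" "\<forall>a\<in>A. x a \<in> cball 0 r" "w = f a c + (\<Sum>a\<in>A. f a (x a))"
        by auto
      have "(\<Sum>b\<in>A. f b (if b = a then c else x b)) = (\<Sum>b\<in>A. f b (x b))"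
        by (rule sum.cong) (use insert.hyps in auto)
      then show "w \<in> {\<Sum>a\<in>insert a A. f a (x a) | x. \<forall>a\<in>insert a A. x a \<in> cball 0 r}"
        using insert.hyps w by (intro CollectI exI[of _ "\<lambda>b. if b = a then c else x b"]) auto
    qed
    moreover have "compact (f a ` cball 0 r)"
      by (intro compact_continuous_image compact_cball bounded_linear.continuous_on[OF that(2)] continuous_intros)
    ultimately show ?case using insert.IH compact_sums by (simp only:)
  qed
  let ?C = "{\<Sum>p\<in>B\<times>B. munit (fst p) (snd p) (x p) :: ('i, 'k) fmat | x. \<forall>p\<in>B\<times>B. x p \<in> cball 0 r}"
  have "compact ?C"
    by (rule sums[of "B \<times> B" "\<lambda>p. munit (fst p) (snd p)"]) (use B bounded_linear_munit in auto)
  moreover have "closed ({X :: ('i, 'k) fmat. indices X \<subseteq> B} \<inter> cball 0 r)"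
    by (intro closed_Int closed_indices_subset closed_cball)
  moreover have "{X. indices X \<subseteq> B \<and> norm X \<le> r} = ?C \<inter> ({X. indices X \<subseteq> B} \<inter> cball 0 r)"
  proof -
    have "X \<in> ?C" if X: "indices X \<subseteq> B" "norm X \<le> r" for X :: "('i, 'k) fmat"
      using fmat_eq_sum_munit[OF B X(1)] order_trans[OF norm_entry_le X(2)]
      by (intro CollectI exI[of _ "\<lambda>p. entry X (fst p) (snd p)"])
        (auto simp: sum.cartesian_product case_prod_beta)
    then show ?thesis by auto
  qed
  ultimately show ?thesis by (simp add: compact_Int_closed)
qed

section \<open>Conjugate transpose and adjointness for the Frobenius product\<close>

definition adj :: "('i, complex) fmat \<Rightarrow> ('i, complex) fmat" where
  "adj X = Fmat (\<lambda>i j. cnj (entry X j i))"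

lemma entry_adj [simp]: "entry (adj X) i j = cnj (entry X j i)"
  unfolding adj_def by (subst Fmat_inverse'[of "indices X"]) (auto, (metis entry_zero_outside)+)

lemma adj_adj [simp]: "adj (adj X) = X" by (rule fmat_eqI) simp
lemma adj_zero [simp]: "adj 0 = 0" by (rule fmat_eqI) simp
lemma adj_plus: "adj (X + Y) = adj X + adj Y" by (rule fmat_eqI) simp
lemma adj_minus: "adj (X - Y) = adj X - adj Y" by (rule fmat_eqI) simp
lemma adj_sum: "adj (sum f A) = (\<Sum>a\<in>A. adj (f a))"
  by (induction A rule: infinite_finite_induct) (auto simp: adj_plus)
lemma adj_times: "adj (X * Y) = adj Y * adj X"
proof (rule fmat_eqI)
  fix i k
  define J where "J = indices X \<union> indices Y"
  have "finite J" "j \<notin> J \<Longrightarrow> entry X i' j = 0" for i' j by (simp_all add: J_def entry_zero_outside)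
  then show "entry (adj (X * Y)) i k = entry (adj Y * adj X) i k"
    by (simp add: entry_times[of J] mult.commute)
qed
lemma rel_adj: "rel R X \<Longrightarrow> R\<inverse> \<subseteq> S \<Longrightarrow> rel S (adj X)" unfolding rel_def by auto

lemma inner_eq_tr: "inner X Y = Re (tr (adj X * Y))"
proof -
  define J where "J = indices X \<union> indices Y"
  have J: "finite J" by (simp add: J_def)
  have o: "j \<notin> J \<Longrightarrow> entry X i' j = 0" "j \<notin> J \<Longrightarrow> entry Y j i' = 0" "j \<notin> J \<Longrightarrow> entry Y i' j = 0" 
      "j \<notin> J \<Longrightarrow> entry X j i' = 0" for j i'
    by (simp_all add: J_def entry_zero_outside)
  have "inner X Y = (\<Sum>i\<in>J. \<Sum>j\<in>J. inner (entry X i j) (entry Y i j))"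
    by (subst inner_fmat_eq[of "J \<times> J"]) (use J o in \<open>auto simp: sum.cartesian_product case_prod_beta\<close>)
  also have "\<dots> = (\<Sum>j\<in>J. \<Sum>i\<in>J. inner (entry X i j) (entry Y i j))" by (rule sum.swap)
  also have "\<dots> = Re (\<Sum>j\<in>J. \<Sum>i\<in>J. cnj (entry X i j) * entry Y i j)"
    by (simp add: inner_complex_def)
  also have "\<dots> = Re (tr (adj X * Y))"
    by (subst tr_eq[OF J]) (simp_all add: entry_times[OF J] o)
  finally show ?thesis .
qed

lemma norm_adj [simp]: "norm (adj X) = norm X"
  by (simp add: norm_eq_sqrt_inner inner_eq_tr tr_commute)

lemma bounded_linear_adj: "bounded_linear adj"
proof (rule bounded_linear_intro[of _ 1])
  show "adj (r *\<^sub>R x) = r *\<^sub>R adj x" for r x by (rule fmat_eqI) simp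
qed (auto simp: adj_plus)

lemma inner_times_left: "inner (X * Y) Z = inner Y (adj X * Z)"
  by (simp add: inner_eq_tr adj_times mult.assoc)

lemma inner_times_right: "inner (X * Y) Z = inner X (Z * adj Y)"
  unfolding inner_eq_tr adj_times
  by (simp add: mult.assoc tr_commute[of "adj Y"])

hide_const (open) up_ring.coeff up_ring.monom

section \<open>Extension of derivations\<close>

text \<open>A derivation from a unital subring \<open>R\<close> into the whole ring. Values outside
  \<open>R\<close> are allowed, because the derivative of an element algebraic over \<open>R\<close>
  is a quotient that need not lie in the ring generated by it.\<close>

definition derivation_on :: "'k::comm_ring_1 set \<Rightarrow> ('k \<Rightarrow> 'k) \<Rightarrow> bool" where
  "derivation_on R D \<longleftrightarrow> 1 \<in> R \<and>
     (\<forall>x\<in>R. \<forall>y\<in>R. x - y \<in> R \<and> x * y \<in> R \<and> D (x - y) = D x - D y \<and> D (x * y) = D x * y + x * D y)"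

lemma derivation_onD:
  assumes "derivation_on R D"
  shows "1 \<in> R" "0 \<in> R" "x \<in> R \<Longrightarrow> y \<in> R \<Longrightarrow> x - y \<in> R" "x \<in> R \<Longrightarrow> y \<in> R \<Longrightarrow> x + y \<in> R"
    "x \<in> R \<Longrightarrow> - x \<in> R" "x \<in> R \<Longrightarrow> y \<in> R \<Longrightarrow> x * y \<in> R" "D 0 = 0" "D 1 = 0"
    "x \<in> R \<Longrightarrow> y \<in> R \<Longrightarrow> D (x - y) = D x - D y" "x \<in> R \<Longrightarrow> y \<in> R \<Longrightarrow> D (x + y) = D x + D y"
    "x \<in> R \<Longrightarrow> y \<in> R \<Longrightarrow> D (x * y) = D x * y + x * D y"
proof -
  have D: "x - y \<in> R" "x * y \<in> R" "D (x - y) = D x - D y" "D (x * y) = D x * y + x * D y"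
    if "x \<in> R" "y \<in> R" for x y
    using assms that unfolding derivation_on_def by blast+
  show 1: "1 \<in> R" using assms unfolding derivation_on_def by blast
  show 0: "0 \<in> R" "D 0 = 0" using D(1,3)[OF 1 1] by auto
  show "D 1 = 0" using D(4)[OF 1 1] by simp
  have m: "- y \<in> R" "D (- y) = - D y" if "y \<in> R" for y using D(1,3)[OF 0(1) that] 0(2) by auto
  then show "x \<in> R \<Longrightarrow> - x \<in> R" by blast
  show "x + y \<in> R" "D (x + y) = D x + D y" if "x \<in> R" "y \<in> R"
    using D(1,3)[OF that(1) m(1)[OF that(2)]] m(2)[OF that(2)] by auto
  show "x \<in> R \<Longrightarrow> y \<in> R \<Longrightarrow> x - y \<in> R" "x \<in> R \<Longrightarrow> y \<in> R \<Longrightarrow> x * y \<in> R" 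
    "x \<in> R \<Longrightarrow> y \<in> R \<Longrightarrow> D (x - y) = D x - D y"
    "x \<in> R \<Longrightarrow> y \<in> R \<Longrightarrow> D (x * y) = D x * y + x * D y"
    using D by blast+
qed

lemma derivation_on_sum:
  assumes D: "derivation_on R D" and f: "\<And>i. i \<in> A \<Longrightarrow> f i \<in> R"
  shows "sum f A \<in> R" "D (sum f A) = (\<Sum>i\<in>A. D (f i))"
  using f by (induction A rule: infinite_finite_induct) (auto simp: derivation_onD[OF D])

text \<open>On the ring generated by \<open>R\<close> and \<open>x\<close> a derivation is
  determined by its value at \<open>x\<close>, which must respect every polynomial relation
  satisfied by \<open>x\<close>. A relation of least degree fixes this value, and characteristic 0
  makes the resulting linear equation solvable.\<close>

lemma derivation_adjoin:
  fixes x :: "'k::field_char_0"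
  assumes D: "derivation_on R D"
  shows "\<exists>R' D'. derivation_on R' D' \<and> R \<subseteq> R' \<and> x \<in> R' \<and> (\<forall>y\<in>R. D' y = D y)"
proof -
  note d = derivation_onD[OF D]
  define PF where "PF = {p :: 'k poly. \<forall>i. coeff p i \<in> R}"
  define DP where "DP = map_poly D"
  have cDP: "coeff (DP p) i = D (coeff p i)" for p i
    unfolding DP_def by (rule coeff_map_poly) (rule d(7))
  have PF_diff: "p - q \<in> PF" if "p \<in> PF" "q \<in> PF" for p q using that by (simp add: PF_def d)
  have PF_mult: "p * q \<in> PF" if "p \<in> PF" "q \<in> PF" for p q
    using that by (auto simp: PF_def coeff_mult intro!: derivation_on_sum(1)[OF D] d(6))
  have PF_mon: "monom c n \<in> PF" if "c \<in> R" for c n using that by (simp add: PF_def d)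
  have of_nat_R: "of_nat n \<in> R" for n by (induction n) (auto simp: d)
  have PF_pderiv: "pderiv p \<in> PF" if "p \<in> PF" for p
    using that d(6)[OF of_nat_R[of "Suc _"]] by (simp add: PF_def coeff_pderiv del: of_nat_Suc)
  have DP_diff: "DP (p - q) = DP p - DP q" if "p \<in> PF" "q \<in> PF" for p q
    using that by (intro poly_eqI) (simp add: cDP PF_def d)
  have DP_mult: "DP (p * q) = DP p * q + p * DP q" if "p \<in> PF" "q \<in> PF" for p q
  proof (rule poly_eqI)
    fix n
    have "D (\<Sum>i\<le>n. coeff p i * coeff q (n - i)) = (\<Sum>i\<le>n. D (coeff p i * coeff q (n - i)))"
      using that by (intro derivation_on_sum(2)[OF D] d(6)) (simp_all add: PF_def)
    then show "coeff (DP (p * q)) n = coeff (DP p * q + p * DP q) n"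
      using that by (simp add: cDP coeff_mult PF_def sum.distrib d)
  qed
  \<comment> \<open>The product rule forces this value at \<open>poly p x\<close> once
    \<open>dx\<close> is the derivative of \<open>x\<close>.\<close>
  define T where "T dx p = poly (DP p) x + poly (pderiv p) x * dx" for dx p
  have T_diff: "T dx (p - q) = T dx p - T dx q" if "p \<in> PF" "q \<in> PF" for dx p q
    by (simp add: T_def DP_diff[OF that] pderiv_diff algebra_simps)
  have T_mult: "T dx (p * q) = T dx p * poly q x + poly p x * T dx q" if "p \<in> PF" "q \<in> PF" for dx p q
    by (simp add: T_def DP_mult[OF that] pderiv_mult algebra_simps)
  have "\<exists>dx. \<forall>p\<in>PF. poly p x = 0 \<longrightarrow> T dx p = 0"
  proof (cases "\<exists>p\<in>PF. p \<noteq> 0 \<and> poly p x = 0")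
    case False
    then have "\<forall>p\<in>PF. poly p x = 0 \<longrightarrow> T 0 p = 0" by (force simp: T_def DP_def)
    then show ?thesis by blast
  next
    case True
    then obtain m where m: "m \<in> PF" "m \<noteq> 0" "poly m x = 0"
      and min: "\<And>p. p \<in> PF \<Longrightarrow> p \<noteq> 0 \<Longrightarrow> poly p x = 0 \<Longrightarrow> degree m \<le> degree p"
      using ex_has_least_nat[of "\<lambda>p. p \<in> PF \<and> p \<noteq> 0 \<and> poly p x = 0" _ degree] by blast
    have deg: "degree m \<noteq> 0"
    proof
      assume "degree m = 0"
      then obtain c where "m = [:c:]" by (rule degree_eq_zeroE)
      then show False using m by simp
    qed
    \<comment> \<open>Separability: in characteristic 0 the formal derivative of \<open>m\<close> is
      nonzero and of smaller degree, so by minimality it cannot vanish at \<open>x\<close>.\<close>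
    have m': "poly (pderiv m) x \<noteq> 0"
    proof
      assume "poly (pderiv m) x = 0"
      moreover have "pderiv m \<noteq> 0" using deg by (simp add: pderiv_eq_0_iff)
      ultimately have "degree m \<le> degree (pderiv m)" using min PF_pderiv m(1) by blast
      then show False using deg by (simp add: degree_pderiv)
    qed
    define dx where "dx = - poly (DP m) x / poly (pderiv m) x"
    have Tm: "T dx m = 0" using m' by (simp add: T_def dx_def)
    have "T dx p = 0" if "p \<in> PF" "poly p x = 0" for p
      using that
    proof (induction "degree p" arbitrary: p rule: less_induct)
      case less
      show ?case
      proof (cases "p = 0")
        case True then show ?thesis by (simp add: T_def DP_def)
      next
        case False
        define k where "k = degree p - degree m"
        have le: "degree m \<le> degree p" using min less.prems False by blast
        have l: "lead_coeff m \<in> R" "lead_coeff p \<in> R" using m(1) less.prems by (auto simp: PF_def)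
        \<comment> \<open>Pseudo-division: \<open>R\<close> is only a ring, so both polynomials are
          multiplied by leading coefficients instead of divided. The nonzero factor
          \<open>lead_coeff m\<close> is cancelled in the field at the end.\<close>
        define q1 q2 where "q1 = monom (lead_coeff m) 0 * p" and "q2 = monom (lead_coeff p) k * m"
        have q: "q1 \<in> PF" "q2 \<in> PF" unfolding q1_def q2_def using PF_mon PF_mult l m(1) less.prems by auto
        have dq: "degree q1 = degree p" "degree q2 = degree p"
          using m(2) False le by (simp_all add: q1_def q2_def degree_mult_eq degree_monom_eq k_def)
        have c: "coeff q1 (degree p) = coeff q2 (degree p)"
        proof -
          have "lead_coeff q1 = lead_coeff m * lead_coeff p" "lead_coeff q2 = lead_coeff p * lead_coeff m"
            unfolding q1_def q2_def by (simp_all only: lead_coeff_mult lead_coeff_monom)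
          then show ?thesis using dq by simp
        qed
        have T0: "T dx (q1 - q2) = 0"
        proof (cases "q1 - q2 = 0")
          case True then show ?thesis by (simp add: T_def DP_def)
        next
          case nz: False
          have "degree (q1 - q2) \<noteq> degree p" using c nz
            by (metis coeff_diff diff_self leading_coeff_0_iff)
          moreover have "degree (q1 - q2) \<le> degree p" using dq by (intro degree_diff_le) auto
          ultimately have "degree (q1 - q2) < degree p" by simp
          then show ?thesis
            by (rule less.hyps) (use q PF_diff less.prems m(3) in \<open>auto simp: q1_def q2_def poly_monom\<close>)
        qed
        have "T dx q2 = 0" unfolding q2_def using T_mult[OF PF_mon[OF l(2)] m(1)] m(3) Tm by simp
        moreover have "T dx q1 = lead_coeff m * T dx p"
          unfolding q1_def using T_mult[OF PF_mon[OF l(1)] less.prems(1)] less.prems(2)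
          by (simp add: poly_monom)
        ultimately show ?thesis using T0 T_diff[OF q] m(2) by simp
      qed
    qed
    then show ?thesis by blast
  qed
  then obtain dx where dx: "\<And>p. p \<in> PF \<Longrightarrow> poly p x = 0 \<Longrightarrow> T dx p = 0" by blast
  define R' where "R' = (\<lambda>p. poly p x) ` PF"
  define D' where "D' y = T dx (SOME p. p \<in> PF \<and> poly p x = y)" for y
  \<comment> \<open>Two polynomials with the same value at \<open>x\<close> differ by a relation, on
    which \<open>T dx\<close> is zero, so the choice in \<open>D'\<close> does not matter.\<close>
  have D': "D' (poly p x) = T dx p" if "p \<in> PF" for p
  proof -
    define q where "q = (SOME q. q \<in> PF \<and> poly q x = poly p x)"
    have q: "q \<in> PF \<and> poly q x = poly p x"
      unfolding q_def by (rule someI[of _ p]) (use that in simp)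
    then have "T dx (q - p) = 0" using that by (intro dx PF_diff) auto
    then show ?thesis using T_diff[of q p dx] q that by (simp add: D'_def q_def)
  qed
  have "derivation_on R' D'"
    unfolding derivation_on_def
  proof (intro conjI ballI)
    show "1 \<in> R'" unfolding R'_def
      by (rule image_eqI[OF _ PF_mon[OF d(1), of 0]]) (simp add: poly_monom)
    fix y z assume "y \<in> R'" "z \<in> R'"
    then obtain p q where y: "p \<in> PF" "y = poly p x" and z: "q \<in> PF" "z = poly q x"
      unfolding R'_def by blast
    have yz: "y - z = poly (p - q) x" "y * z = poly (p * q) x" using y z by auto
    show "y - z \<in> R'" "y * z \<in> R'" unfolding R'_def yz
      by (rule imageI, rule PF_diff PF_mult, rule y, rule z)+
    show "D' (y - z) = D' y - D' z"
      unfolding yz unfolding y z D'[OF y(1)] D'[OF z(1)] D'[OF PF_diff[OF y(1) z(1)]]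
      by (rule T_diff[OF y(1) z(1)])
    show "D' (y * z) = D' y * z + y * D' z"
      unfolding yz unfolding y z D'[OF y(1)] D'[OF z(1)] D'[OF PF_mult[OF y(1) z(1)]]
      by (rule T_mult[OF y(1) z(1)])
  qed
  moreover have "c \<in> R' \<and> D' c = D c" if "c \<in> R" for c
  proof -
    have "DP (monom c 0) = monom (D c) 0" unfolding DP_def by (rule map_poly_monom) (rule d)
    then have "T dx (monom c 0) = D c" by (simp add: T_def pderiv_monom poly_monom)
    then have "D' c = D c" using D'[OF PF_mon[OF that, of 0]] by (simp add: poly_monom)
    moreover have "c \<in> R'" unfolding R'_def
      by (rule image_eqI[OF _ PF_mon[OF that, of 0]]) (simp add: poly_monom)
    ultimately show ?thesis by blast
  qed
  moreover have "x \<in> R'" unfolding R'_def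
    by (rule image_eqI[OF _ PF_mon[OF d(1), of 1]]) (simp add: poly_monom)
  ultimately show ?thesis by blast
qed

text \<open>Zorn's lemma for graphs of derivations ordered by inclusion;
  \<open>derivation_adjoin\<close> shows that a maximal one is defined everywhere.\<close>

lemma derivation_extends:
  fixes D :: "'k::field_char_0 \<Rightarrow> 'k"
  assumes D: "derivation_on R D"
  shows "\<exists>D'. derivation_on UNIV D' \<and> (\<forall>y\<in>R. D' y = D y)"
proof -
  define G where "G R D = (\<lambda>x. (x, D x)) ` R" for R and D :: "'k \<Rightarrow> 'k"
  define A where "A = {G R' D' | R' D'. derivation_on R' D' \<and> G R D \<subseteq> G R' D'}"
  have G: "G R D \<subseteq> G R' D' \<longleftrightarrow> R \<subseteq> R' \<and> (\<forall>x\<in>R. D' x = D x)" for R R' D D'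
    unfolding G_def by auto
  have AE: "\<exists>R' D'. X = G R' D' \<and> derivation_on R' D' \<and> G R D \<subseteq> G R' D'" if "X \<in> A" for X
    using that unfolding A_def by simp
  have "\<exists>M\<in>A. \<forall>X\<in>A. M \<subseteq> X \<longrightarrow> X = M"
  proof (rule subset_Zorn_nonempty)
    have "G R D \<in> A" using D unfolding A_def by (intro CollectI exI[of _ R] exI[of _ D]) simp
    then show "A \<noteq> {}" by blast
    fix C assume C: "C \<noteq> {}" "subset.chain A C"
    define S where "S = fst ` \<Union>C"
    define E where "E x = (SOME y. (x, y) \<in> \<Union>C)" for x
    \<comment> \<open>Any two points of the union lie in one member of the chain, so the derivation
      laws can be checked inside that member.\<close>
    have two: "\<exists>R' D'. derivation_on R' D' \<and> G R D \<subseteq> G R' D' \<and> G R' D' \<in> C \<and> {p, q} \<subseteq> G R' D'"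
      if "p \<in> \<Union>C" "q \<in> \<Union>C" for p q
    proof -
      obtain X Y where "p \<in> X" "X \<in> C" "q \<in> Y" "Y \<in> C" using \<open>p \<in> \<Union>C\<close> \<open>q \<in> \<Union>C\<close> by blast
      moreover from this have "X \<subseteq> Y \<or> Y \<subseteq> X" using C(2) unfolding subset_chain_def by blast
      ultimately obtain Z where "Z \<in> C" "{p, q} \<subseteq> Z" by blast
      moreover from this have "Z \<in> A" using C(2) unfolding subset_chain_def by blast
      ultimately show ?thesis using AE[of Z] by metis
    qed
    have E: "E (fst p) = snd p" if "p \<in> \<Union>C" for p
    proof -
      have "(fst p, E (fst p)) \<in> \<Union>C" unfolding E_def by (rule someI[of _ "snd p"]) (use that in simp)
      from two[OF that this] show ?thesis by (auto simp: G_def)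
    qed
    have UC: "\<Union>C = G S E" unfolding G_def S_def using E by force
    have "derivation_on S E"
      unfolding derivation_on_def
    proof (intro conjI ballI)
      obtain X where "X \<in> C" using C(1) by blast
      moreover from this have "X \<in> A" using C(2) unfolding subset_chain_def by blast
      ultimately obtain R' D' where X: "G R' D' \<in> C" "derivation_on R' D'"
        using AE[of X] by metis
      have "(1, D' 1) \<in> \<Union>C" using X derivation_onD(1)[OF X(2)] unfolding G_def by blast
      then show "1 \<in> S" unfolding S_def by force
      fix x y assume "x \<in> S" "y \<in> S"
      then have "(x, E x) \<in> \<Union>C" "(y, E y) \<in> \<Union>C" unfolding UC G_def by auto
      from two[OF this] obtain R' D' where R': "derivation_on R' D'" "G R' D' \<in> C"
        "(x, E x) \<in> G R' D'" "(y, E y) \<in> G R' D'" by blast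
      have xy: "x \<in> R'" "y \<in> R'" using R' by (auto simp: G_def)
      have ED: "E z = D' z \<and> z \<in> S" if "z \<in> R'" for z
      proof -
        have "(z, D' z) \<in> \<Union>C" using R'(2) that unfolding G_def by blast
        then show ?thesis unfolding S_def using E[of "(z, D' z)"] by force
      qed
      show "x - y \<in> S" "x * y \<in> S" "E (x - y) = E x - E y" "E (x * y) = E x * y + x * E y"
        using ED xy derivation_onD[OF R'(1)] by auto
    qed
    moreover have "G R D \<subseteq> \<Union>C"
    proof -
      obtain X where "X \<in> C" using C(1) by blast
      moreover from this have "X \<in> A" using C(2) unfolding subset_chain_def by blast
      then have "G R D \<subseteq> X" using AE[of X] by metis
      ultimately show ?thesis by blast
    qed
    ultimately show "\<Union>C \<in> A" unfolding A_def UC by (intro CollectI exI[of _ S] exI[of _ E]) simp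
  qed
  then obtain M where "M \<in> A" and M_max: "\<And>X. X \<in> A \<Longrightarrow> M \<subseteq> X \<Longrightarrow> X = M" by blast
  moreover obtain R' D' where M: "derivation_on R' D'" "G R D \<subseteq> G R' D'" "M = G R' D'"
    using AE[OF \<open>M \<in> A\<close>] by metis
  ultimately have max: "\<And>X. X \<in> A \<Longrightarrow> G R' D' \<subseteq> X \<Longrightarrow> X = G R' D'" by simp
  have "x \<in> R'" for x
  proof -
    obtain R2 D2 where 2: "derivation_on R2 D2" "R' \<subseteq> R2" "x \<in> R2" "\<forall>y\<in>R'. D2 y = D' y"
      using derivation_adjoin[OF M(1), of x] by blast
    then have sub: "G R' D' \<subseteq> G R2 D2" using G by blast
    then have "G R2 D2 \<in> A" unfolding A_def using 2(1) M(2)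
      by (intro CollectI exI[of _ R2] exI[of _ D2]) simp
    then have "G R2 D2 = G R' D'" using max sub by blast
    then show ?thesis using 2(3) unfolding G_def by auto
  qed
  then have "R' = UNIV" by blast
  then show ?thesis using M G by blast
qed

section \<open>An ultraproduct of fields of complex numbers\<close>

text \<open>Zorn's lemma for proper filters below \<open>F\<close>, finer ones counting as larger.
  Unless \<open>P\<close> is eventually false, adding the set where \<open>P\<close> holds keeps a
  maximal filter proper and therefore does not change it.\<close>

lemma ultrafilter_below:
  fixes F :: "'x filter"
  assumes "F \<noteq> bot"
  shows "\<exists>U. U \<le> F \<and> U \<noteq> bot \<and> (\<forall>P. eventually P U \<or> eventually (\<lambda>x. \<not> P x) U)"
proof -
  define r where "r = {(H, G). H \<le> F \<and> G \<le> H \<and> G \<noteq> (bot :: 'x filter)}"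
  have field: "Field r = {G. G \<le> F \<and> G \<noteq> bot}"
    unfolding r_def Field_def by (auto intro: order_trans dest: bot.extremum_uniqueI)
  have "Partial_order r"
    unfolding partial_order_on_def preorder_on_def refl_on_def trans_on_def antisym_on_def field
    by (auto simp: r_def dest: bot.extremum_uniqueI)
  moreover have "\<exists>u\<in>Field r. \<forall>G\<in>C. (G, u) \<in> r" if C: "C \<in> Chains r" for C
  proof (cases "C = {}")
    case True
    then show ?thesis using assms unfolding field by auto
  next
    case False
    have CG: "G \<le> F" "G \<noteq> bot" if "G \<in> C" for G
      using C that unfolding Chains_def r_def by auto
    have tot: "G \<le> H \<or> H \<le> G" if "G \<in> C" "H \<in> C" for G H
      using C that unfolding Chains_def r_def by auto
    \<comment> \<open>A chain is downward directed, so a property holds eventually for the infimum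
      only if it does for some member; in particular falsity does not.\<close>
    have "eventually P (Inf C) \<longleftrightarrow> (\<exists>G\<in>C. eventually P G)" for P
      by (rule eventually_Inf_base) (use False tot in \<open>auto intro: le_infI1 le_infI2\<close>)
    then have "Inf C \<noteq> bot" using CG(2) unfolding trivial_limit_def by blast
    moreover have "Inf C \<le> F" using False CG(1) by (meson Inf_lower2 ex_in_conv)
    ultimately show ?thesis
      unfolding field by (intro bexI[of _ "Inf C"]) (auto simp: r_def CG Inf_lower)
  qed
  ultimately obtain U where U: "U \<in> Field r" and max: "\<forall>G\<in>Field r. (U, G) \<in> r \<longrightarrow> G = U"
    using Zorns_po_lemma[of r] by blast
  have UF: "U \<le> F" "U \<noteq> bot" using U unfolding field by auto
  have "eventually P U \<or> eventually (\<lambda>x. \<not> P x) U" for P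
  proof (rule disjCI)
    assume n: "\<not> eventually (\<lambda>x. \<not> P x) U"
    define G where "G = inf U (principal {x. P x})"
    have "G \<noteq> bot" using n unfolding G_def trivial_limit_def eventually_inf_principal by simp
    moreover have "G \<le> U" unfolding G_def by simp
    ultimately have "(U, G) \<in> r" "G \<in> Field r"
      using UF unfolding field by (auto simp: r_def)
    then have "G = U" using max by blast
    moreover have "eventually P G" unfolding G_def eventually_inf_principal by simp
    ultimately show "eventually P U" by simp
  qed
  then show ?thesis using UF by blast
qed

text \<open>The factors are indexed by the sets of elements of \<^typ>\<open>'b\<close>, ordered by inclusion.  Below, the
  index \<open>x\<close> is a set of polynomial functions at which the \<open>x\<close>-th representation must not vanish.\<close>

definition ultra :: "'b set filter" where
  "ultra = (SOME U. U \<le> finite_subsets_at_top UNIV \<and> U \<noteq> bot \<and>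
     (\<forall>P. eventually P U \<or> eventually (\<lambda>x. \<not> P x) U))"

lemma ultra:
  shows ultra_le: "ultra \<le> finite_subsets_at_top UNIV"
    and ultra_proper: "ultra \<noteq> bot"
    and ultra_cases: "eventually P ultra \<or> eventually (\<lambda>x. \<not> P x) ultra"
  using someI_ex[OF ultrafilter_below[of "finite_subsets_at_top UNIV"]]
  unfolding ultra_def by auto

quotient_type 'b star = "'b set \<Rightarrow> complex" / "\<lambda>f g. eventually (\<lambda>x. f x = g x) ultra"
proof (rule equivpI)
  show "reflp (\<lambda>f g. eventually (\<lambda>x. f x = g x) ultra)" by (rule reflpI) simp
  show "symp (\<lambda>f g. eventually (\<lambda>x. f x = g x) ultra)" by (rule sympI) (simp add: eq_commute)
  show "transp (\<lambda>f g. eventually (\<lambda>x. f x = g x) ultra)"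
    by (rule transpI) (erule (1) eventually_elim2, simp)
qed

instantiation star :: (type) field
begin

lift_definition zero_star :: "'a star" is "\<lambda>x. 0" .
lift_definition one_star :: "'a star" is "\<lambda>x. 1" .
lift_definition plus_star :: "'a star \<Rightarrow> 'a star \<Rightarrow> 'a star" is "\<lambda>f g x. f x + g x"
  by (erule (1) eventually_elim2) simp
lift_definition minus_star :: "'a star \<Rightarrow> 'a star \<Rightarrow> 'a star" is "\<lambda>f g x. f x - g x"
  by (erule (1) eventually_elim2) simp
lift_definition uminus_star :: "'a star \<Rightarrow> 'a star" is "\<lambda>f x. - f x"
  by (erule eventually_mono) simp
lift_definition times_star :: "'a star \<Rightarrow> 'a star \<Rightarrow> 'a star" is "\<lambda>f g x. f x * g x"
  by (erule (1) eventually_elim2) simp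
lift_definition divide_star :: "'a star \<Rightarrow> 'a star \<Rightarrow> 'a star" is "\<lambda>f g x. f x / g x"
  by (erule (1) eventually_elim2) simp
lift_definition inverse_star :: "'a star \<Rightarrow> 'a star" is "\<lambda>f x. inverse (f x)"
  by (erule eventually_mono) simp

instance
proof
  fix a :: "'a star"
  show "a \<noteq> 0 \<Longrightarrow> inverse a * a = 1"
  proof transfer
    fix f :: "'a set \<Rightarrow> complex" assume "\<not> (\<forall>\<^sub>F x in ultra. f x = 0)"
    \<comment> \<open>The ultrafilter property turns a function that is not almost everywhere zero
      into one that is almost everywhere nonzero, as inversion requires.\<close>
    then have "\<forall>\<^sub>F x in ultra. f x \<noteq> 0" using ultra_cases[of "\<lambda>x. f x = 0"] by simp
    then show "\<forall>\<^sub>F x in ultra. inverse (f x) * f x = 1" by (rule eventually_mono) simp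
  qed
  show "(0 :: 'a star) \<noteq> 1" by transfer (simp add: ultra_proper)
qed (transfer, simp add: algebra_simps divide_inverse)+

end

abbreviation ultraclass :: "('b set \<Rightarrow> complex) \<Rightarrow> 'b star" where "ultraclass \<equiv> abs_star"

lemma ultraclass_eq_iff: "ultraclass f = ultraclass g \<longleftrightarrow> (\<forall>\<^sub>F x in ultra. f x = g x)"
  by (rule star.abs_eq_iff)

lemma ultraclass_hom:
  "ultraclass f + ultraclass g = ultraclass (\<lambda>x. f x + g x)"
  "ultraclass f - ultraclass g = ultraclass (\<lambda>x. f x - g x)"
  "ultraclass f * ultraclass g = ultraclass (\<lambda>x. f x * g x)"
  "- ultraclass f = ultraclass (\<lambda>x. - f x)"
  "0 = ultraclass (\<lambda>x. 0)" "1 = ultraclass (\<lambda>x. 1)"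
  by (simp_all add: plus_star.abs_eq minus_star.abs_eq times_star.abs_eq uminus_star.abs_eq
      zero_star_def one_star_def)

lemma ultraclass_sum: "(\<Sum>i\<in>A. ultraclass (f i)) = ultraclass (\<lambda>x. \<Sum>i\<in>A. f i x)"
  by (induction A rule: infinite_finite_induct) (simp_all add: ultraclass_hom)

instance star :: (type) field_char_0
proof
  have of_nat: "of_nat n = ultraclass (\<lambda>x. of_nat n :: complex)" for n
    by (induction n) (simp_all add: ultraclass_hom)
  show "inj (of_nat :: nat \<Rightarrow> 'a star)"
    by (rule injI) (simp add: of_nat ultraclass_eq_iff ultra_proper)
qed

section \<open>Polynomial functions on the representation space\<close>

lemma rep_poly_functions_prod:
  "(\<And>f. f \<in> F \<Longrightarrow> f \<in> rep_poly_functions Q d) \<Longrightarrow> (\<lambda>M. \<Prod>f\<in>F. f M) \<in> rep_poly_functions Q d"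
  by (induction F rule: infinite_finite_induct)
    (auto intro: rep_poly_functions.const rep_poly_functions.mult)

lemma rep_poly_functions_diff:
  assumes "f \<in> rep_poly_functions Q d" "g \<in> rep_poly_functions Q d"
  shows "(\<lambda>M. f M - g M) \<in> rep_poly_functions Q d"
  using rep_poly_functions.add[OF assms(1) rep_poly_functions.mult[OF rep_poly_functions.const[of "-1"] assms(2)]]
  by simp

definition rep_line ::
    "('v, 'a) pre_digraph \<Rightarrow> ('a \<Rightarrow> complex mat) \<Rightarrow> ('a \<Rightarrow> complex mat) \<Rightarrow> complex \<Rightarrow> 'a \<Rightarrow> complex mat" where
  "rep_line Q M N z = (\<lambda>a\<in>arcs Q. M a + z \<cdot>\<^sub>m (N a - M a))"

lemma rep_space_carrier: "M \<in> rep_space Q d \<Longrightarrow> a \<in> arcs Q \<Longrightarrow> M a \<in> carrier_mat (d (head Q a)) (d (tail Q a))"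
  unfolding rep_space_def by auto

lemma rep_line_in_rep_space:
  assumes "M \<in> rep_space Q d" "N \<in> rep_space Q d"
  shows "rep_line Q M N z \<in> rep_space Q d"
  unfolding rep_space_def rep_line_def
  using assms[THEN rep_space_carrier] by (auto intro!: add_carrier_mat smult_carrier_mat minus_carrier_mat)

lemma rep_line_index:
  assumes "M \<in> rep_space Q d" "N \<in> rep_space Q d" "a \<in> arcs Q" "p < d (head Q a)" "q < d (tail Q a)"
  shows "rep_line Q M N z a $$ (p, q) = M a $$ (p, q) + z * (N a $$ (p, q) - M a $$ (p, q))"
  using assms(3-) assms(1,2)[THEN rep_space_carrier, OF assms(3)] unfolding rep_line_def by auto

lemma rep_space_eqI:
  assumes "M \<in> rep_space Q d" "N \<in> rep_space Q d"
    and "\<And>a p q. a \<in> arcs Q \<Longrightarrow> p < d (head Q a) \<Longrightarrow> q < d (tail Q a) \<Longrightarrow> M a $$ (p, q) = N a $$ (p, q)"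
  shows "M = N"
proof (rule extensionalityI[of _ "arcs Q"])
  show "M \<in> extensional (arcs Q)" "N \<in> extensional (arcs Q)"
    using assms unfolding rep_space_def by (auto simp: PiE_def)
  fix a assume a: "a \<in> arcs Q"
  show "M a = N a"
    by (rule eq_matI) (use a assms assms(1,2)[THEN rep_space_carrier, OF a] in auto)
qed

lemma rep_line_0_1:
  assumes "M \<in> rep_space Q d" "N \<in> rep_space Q d"
  shows "rep_line Q M N 0 = M" "rep_line Q M N 1 = N"
  using assms by (auto intro!: rep_space_eqI[of _ Q d] rep_line_in_rep_space simp: rep_line_index)

lemma rep_poly_on_line:
  assumes "f \<in> rep_poly_functions Q d" "M \<in> rep_space Q d" "N \<in> rep_space Q d"
  shows "\<exists>p. \<forall>z. f (rep_line Q M N z) = poly p z"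
  using assms(1)
proof induction
  case (const c) show ?case by (rule exI[of _ "[:c:]"]) simp
next
  case (coord a i j)
  show ?case
    by (rule exI[of _ "[:M a $$ (i, j), N a $$ (i, j) - M a $$ (i, j):]"])
      (simp add: rep_line_index[OF assms(2,3) coord])
next
  case (add f g)
  then obtain p q where "\<forall>z. f (rep_line Q M N z) = poly p z" "\<forall>z. g (rep_line Q M N z) = poly q z" by blast
  then show ?case by (intro exI[of _ "p + q"]) simp
next
  case (mult f g)
  then obtain p q where "\<forall>z. f (rep_line Q M N z) = poly p z" "\<forall>z. g (rep_line Q M N z) = poly q z" by blast
  then show ?case by (intro exI[of _ "p * q"]) simp
qed

text \<open>The representation space is irreducible: on the complex line through a point where
  \<open>f\<close> is nonzero and a point where \<open>g\<close> is nonzero, both restrict to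
  nonzero polynomials in one variable, and these form a domain.\<close>

lemma rep_poly_mult_nonzero:
  assumes f: "f \<in> rep_poly_functions Q d" and g: "g \<in> rep_poly_functions Q d"
    and "\<exists>M\<in>rep_space Q d. f M \<noteq> 0" "\<exists>M\<in>rep_space Q d. g M \<noteq> 0"
  shows "\<exists>M\<in>rep_space Q d. f M * g M \<noteq> 0"
proof -
  obtain M N where M: "M \<in> rep_space Q d" "f M \<noteq> 0" and N: "N \<in> rep_space Q d" "g N \<noteq> 0"
    using assms by blast
  obtain p q where p: "\<And>z. f (rep_line Q M N z) = poly p z" and q: "\<And>z. g (rep_line Q M N z) = poly q z"
    using rep_poly_on_line[OF f M(1) N(1)] rep_poly_on_line[OF g M(1) N(1)] by blast
  have "p * q \<noteq> 0"
    using p[of 0] q[of 1] M N by (auto simp: rep_line_0_1[OF M(1) N(1)])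
  then obtain z where "poly (p * q) z \<noteq> 0" using poly_all_0_iff_0 by blast
  then show ?thesis using p q rep_line_in_rep_space[OF M(1) N(1), of z]
    by (intro bexI[of _ "rep_line Q M N z"]) auto
qed

lemma rep_poly_prod_nonzero:
  assumes "\<And>f. f \<in> F \<Longrightarrow> f \<in> rep_poly_functions Q d \<and> (\<exists>M\<in>rep_space Q d. f M \<noteq> 0)"
  shows "\<exists>M\<in>rep_space Q d. (\<Prod>f\<in>F. f M) \<noteq> 0"
proof -
  have ne: "\<exists>M. M \<in> rep_space Q d"
    by (rule exI[of _ "\<lambda>a\<in>arcs Q. 0\<^sub>m (d (head Q a)) (d (tail Q a))"]) (auto simp: rep_space_def)
  show ?thesis
    using assms
  proof (induction F rule: infinite_finite_induct)
    case (insert f F)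
    then have "\<exists>M\<in>rep_space Q d. f M * (\<Prod>f\<in>F. f M) \<noteq> 0"
      by (intro rep_poly_mult_nonzero[OF _ rep_poly_functions_prod]) auto
    then show ?case using insert.hyps by simp
  qed (use ne in auto)
qed

section \<open>Partial derivatives with respect to the matrix entries\<close>

definition rep_shift :: "('a \<Rightarrow> complex mat) \<Rightarrow> 'a \<Rightarrow> nat \<Rightarrow> nat \<Rightarrow> complex \<Rightarrow> 'a \<Rightarrow> complex mat" where
  "rep_shift M a p q t = M(a := Matrix.mat (dim_row (M a)) (dim_col (M a))
     (\<lambda>(i, j). M a $$ (i, j) + (if (i, j) = (p, q) then t else 0)))"

lemma rep_shift_in_rep_space:
  "M \<in> rep_space Q d \<Longrightarrow> a \<in> arcs Q \<Longrightarrow> rep_shift M a p q t \<in> rep_space Q d"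
  unfolding rep_space_def rep_shift_def by (auto simp: PiE_def Pi_def extensional_def)

lemma rep_shift_0: "M \<in> rep_space Q d \<Longrightarrow> a \<in> arcs Q \<Longrightarrow> rep_shift M a p q 0 = M"
  unfolding rep_shift_def by (auto simp: fun_eq_iff intro!: eq_matI)

text \<open>Polynomial functions are functions, not formal polynomials, so the derivative is
  specified analytically. It thus depends only on the values of \<open>f\<close> on
  \<open>rep_space Q d\<close>, which makes it well defined at the generic point later.\<close>

lemma rep_poly_partial_derivative:
  assumes "f \<in> rep_poly_functions Q d" "a \<in> arcs Q"
  shows "\<exists>f'\<in>rep_poly_functions Q d. \<forall>M\<in>rep_space Q d.
    ((\<lambda>t. f (rep_shift M a p q t)) has_field_derivative f' M) (at 0)"
  using assms(1)
proof induction
  case (const c)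
  show ?case by (rule bexI[of _ "\<lambda>M. 0"]) (auto intro: rep_poly_functions.const)
next
  case (coord b i j)
  show ?case
  proof (rule bexI[of _ "\<lambda>M. if (b, i, j) = (a, p, q) then 1 else 0"], rule ballI)
    fix M assume M: "M \<in> rep_space Q d"
    have "rep_shift M a p q t b $$ (i, j) = M b $$ (i, j) + (if (b, i, j) = (a, p, q) then t else 0)" for t
      using coord rep_space_carrier[OF M coord(1)] by (auto simp: rep_shift_def)
    then show "((\<lambda>t. rep_shift M a p q t b $$ (i, j)) has_field_derivative
        (if (b, i, j) = (a, p, q) then 1 else 0)) (at 0)"
      by (auto intro!: derivative_eq_intros)
  qed (rule rep_poly_functions.const)
next
  case (add f g)
  then obtain f' g' where "f' \<in> rep_poly_functions Q d" "g' \<in> rep_poly_functions Q d"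
    "\<forall>M\<in>rep_space Q d. ((\<lambda>t. f (rep_shift M a p q t)) has_field_derivative f' M) (at 0)"
    "\<forall>M\<in>rep_space Q d. ((\<lambda>t. g (rep_shift M a p q t)) has_field_derivative g' M) (at 0)" by blast
  then show ?case
    by (intro bexI[of _ "\<lambda>M. f' M + g' M"]) (auto intro!: DERIV_add rep_poly_functions.add)
next
  case (mult f g)
  then obtain f' g' where "f' \<in> rep_poly_functions Q d" "g' \<in> rep_poly_functions Q d"
    "\<forall>M\<in>rep_space Q d. ((\<lambda>t. f (rep_shift M a p q t)) has_field_derivative f' M) (at 0)"
    "\<forall>M\<in>rep_space Q d. ((\<lambda>t. g (rep_shift M a p q t)) has_field_derivative g' M) (at 0)" by blast
  with mult.hyps show ?case
    by (intro bexI[of _ "\<lambda>M. f' M * g M + g' M * f M"])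
      (auto intro!: rep_poly_functions.add rep_poly_functions.mult DERIV_mult[THEN DERIV_cong]
        simp: rep_shift_0[OF _ assms(2)])
qed


section \<open>Generic vanishing of obstructions\<close>

definition block :: "'i \<Rightarrow> 'i \<Rightarrow> 'k::zero mat \<Rightarrow> ('i \<times> nat, 'k) fmat" where
  "block i j A = Fmat (\<lambda>x y. if fst x = i \<and> fst y = j \<and> snd x < dim_row A \<and> snd y < dim_col A
     then A $$ (snd x, snd y) else 0)"

lemma entry_block:
  "entry (block i j A) x y = (if fst x = i \<and> fst y = j \<and> snd x < dim_row A \<and> snd y < dim_col A
     then A $$ (snd x, snd y) else 0)"
proof -
  have "entry (block i j A) = (\<lambda>x y. if fst x = i \<and> fst y = j \<and> snd x < dim_row A \<and> snd y < dim_col A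
     then A $$ (snd x, snd y) else 0)"
    unfolding block_def
    by (rule Fmat_inverse'[of "{i, j} \<times> {..<dim_row A + dim_col A}"]) (auto split: if_splits)
  then show ?thesis by simp
qed

text \<open>Coordinates of the space at the vertex \<open>i\<close>. The labels \<open>Inr\<close>
  are reserved for the rows of families indexed by arrows.\<close>

definition slots :: "('v \<Rightarrow> nat) \<Rightarrow> 'v \<Rightarrow> (('v + 'a) \<times> nat) set" where
  "slots d i = {Inl i} \<times> {..<d i}"

definition vertex_slots :: "('v, 'a) pre_digraph \<Rightarrow> ('v \<Rightarrow> nat) \<Rightarrow> (('v + 'a) \<times> nat) set" where
  "vertex_slots Q d = (\<Union>i\<in>verts Q. slots d i)"

text \<open>A subrepresentation is the image of an idempotent \<open>P\<close>; the families \<open>l\<close> below then form the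
  dual of the space of extensions of the subrepresentation by the quotient.\<close>

definition obstructed ::
    "('v, 'a) pre_digraph \<Rightarrow> ('v \<Rightarrow> nat) \<Rightarrow> ('a \<Rightarrow> (('v + 'a) \<times> nat, 'k::comm_ring_1) fmat) \<Rightarrow> bool" where
  "obstructed Q d m \<longleftrightarrow> (\<exists>P l. indices P \<subseteq> vertex_slots Q d \<and> P * P = P \<and>
     (\<forall>a\<in>arcs Q. m a * P = P * m a * P \<and> l a = P * l a \<and> l a * P = 0 \<and>
       rel (slots d (tail Q a) \<times> slots d (head Q a)) (l a)) \<and>
     P * (\<Sum>a\<in>arcs Q. l a * m a - m a * l a) = 0 \<and> (\<exists>a\<in>arcs Q. l a \<noteq> 0))"

lemma map_fmat_derivation:
  fixes X Y :: "('i, 'k::comm_ring_1) fmat"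
  assumes D: "derivation_on UNIV D"
  shows "map_fmat D (X * Y) = map_fmat D X * Y + X * map_fmat D Y"
proof -
  note d = derivation_onD[OF D]
  show "map_fmat D (X * Y) = map_fmat D X * Y + X * map_fmat D Y"
  proof (rule fmat_eqI)
    fix i k
    have o: "j \<notin> indices X \<Longrightarrow> entry X i j = 0" for j by (simp add: entry_zero_outside)
    then have "entry (X * Y) i k = (\<Sum>j\<in>indices X. entry X i j * entry Y j k)"
      "entry (X * map_fmat D Y) i k = (\<Sum>j\<in>indices X. entry X i j * entry (map_fmat D Y) j k)"
      "entry (map_fmat D X * Y) i k = (\<Sum>j\<in>indices X. entry (map_fmat D X) i j * entry Y j k)"
      by (intro entry_times; simp add: entry_map_fmat d(7))+
    then show "entry (map_fmat D (X * Y)) i k = entry (map_fmat D X * Y + X * map_fmat D Y) i k"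
      by (simp add: entry_map_fmat d derivation_on_sum[OF D] sum.distrib)
  qed
qed

text \<open>Multiplication by \<open>l a\<close> from the left kills every term of the derivative of
  \<open>m a * P = P * m a * P\<close> that begins with \<open>P\<close>. By cyclicity the remaining
  terms express the trace of \<open>l a\<close> against the derivative of \<open>m a\<close> as
  minus the trace of the derivative of \<open>P\<close> against
  \<open>l a * m a - m a * l a\<close>. The sum \<open>c\<close> of these commutators is annihilated
  by \<open>P\<close> on both sides, while the derivative of \<open>P\<close> is the sum of its
  products with \<open>P\<close> from the two sides; hence the total trace is zero.\<close>

lemma trace_derivation:
  fixes P :: "('i, 'k::comm_ring_1) fmat"
  assumes D: "derivation_on UNIV D" and P: "P * P = P"
    and m: "\<And>a. a \<in> A \<Longrightarrow> m a * P = P * m a * P"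
    and l: "\<And>a. a \<in> A \<Longrightarrow> l a = P * l a" "\<And>a. a \<in> A \<Longrightarrow> l a * P = 0"
    and C: "P * (\<Sum>a\<in>A. l a * m a - m a * l a) = 0"
  shows "(\<Sum>a\<in>A. tr (l a * map_fmat D (m a))) = 0"
proof -
  let ?d = "map_fmat D"
  define c where "c = (\<Sum>a\<in>A. l a * m a - m a * l a)"
  note leib = map_fmat_derivation[OF D]
  have arrow: "tr (l a * ?d (m a)) = - tr (?d P * (l a * m a - m a * l a))" if a: "a \<in> A" for a
  proof -
    have "l a * ?d (m a * P) = l a * ?d (P * m a * P)" using m[OF a] by simp
    then have "l a * ?d (m a) * P + l a * m a * ?d P
        = l a * ?d P * m a * P + l a * P * ?d (m a) * P + l a * P * m a * ?d P"
      by (simp add: leib distrib_left distrib_right mult.assoc)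
    then have "tr (l a * ?d (m a) * P) + tr (l a * m a * ?d P) = tr (l a * ?d P * m a * P)"
      using l(2)[OF a] by (simp flip: tr_plus)
    moreover have "tr (l a * ?d (m a) * P) = tr (l a * ?d (m a))"
      using l(1)[OF a] tr_commute[of "l a * ?d (m a)" P] by (metis mult.assoc)
    moreover have "tr (l a * ?d P * m a * P) = tr (?d P * (m a * l a))"
      using l(1)[OF a] tr_commute[of "l a * ?d P * m a" P] tr_commute[of "l a" "?d P * m a"]
      by (metis mult.assoc)
    moreover have "tr (l a * m a * ?d P) = tr (?d P * (l a * m a))"
      by (rule tr_commute)
    ultimately show ?thesis by (simp add: right_diff_distrib tr_minus algebra_simps)
  qed
  have "l a * m a * P = 0" if "a \<in> A" for a
    using m[OF that] l(2)[OF that] by (metis mult.assoc mult_zero_left)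
  then have "c * P = 0"
    unfolding c_def using l(2) by (simp add: sum_distrib_right left_diff_distrib mult.assoc)
  moreover have "P * c = 0" using C unfolding c_def .
  moreover have "?d P = ?d P * P + P * ?d P" using leib[of P P] P by simp
  ultimately have "tr (?d P * c) = 0"
    using tr_plus[of "?d P * P * c" "P * ?d P * c"] tr_commute[of P "?d P * c"]
    by (metis (no_types, lifting) add.right_neutral distrib_right mult.assoc mult_zero_right tr_zero)
  then show ?thesis
    by (simp add: arrow sum_negf c_def sum_distrib_left tr_sum)
qed

definition ultramat :: "('b set \<Rightarrow> ('i, complex) fmat) \<Rightarrow> ('i, 'b star) fmat" where
  "ultramat X = Fmat (\<lambda>i j. ultraclass (\<lambda>x. entry (X x) i j))"

text \<open>The common finite support \<open>B\<close> is what makes the classes of the entries a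
  finitely supported matrix again; without it \<open>Fmat\<close> might be applied outside its
  domain.\<close>

lemma entry_ultramat:
  assumes "finite B" "\<And>x. indices (X x) \<subseteq> B"
  shows "entry (ultramat X) i j = ultraclass (\<lambda>x. entry (X x) i j)"
proof -
  have "entry (ultramat X) = (\<lambda>i j. ultraclass (\<lambda>x. entry (X x) i j))"
    unfolding ultramat_def
  proof (rule Fmat_inverse'[OF assms(1)])
    fix i j assume n: "ultraclass (\<lambda>x. entry (X x) i j) \<noteq> 0"
    show "i \<in> B \<and> j \<in> B"
    proof (rule ccontr)
      assume "\<not> (i \<in> B \<and> j \<in> B)"
      then have "entry (X x) i j = 0" for x using entry_zero_outside_superset[OF assms(2)] by blast
      then show False using n by (simp add: ultraclass_hom)
    qed
  qed
  then show ?thesis by simp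
qed

lemma indices_times_subset:
  fixes X Y :: "('i, 'k::ring) fmat"
  assumes "indices X \<subseteq> B" "indices Y \<subseteq> B"
  shows "indices (X * Y) \<subseteq> B"
proof -
  have "rel (B \<times> B) (X * Y)"
    by (rule rel_times[of "B \<times> B" _ "B \<times> B"]) (use assms in \<open>auto simp: rel_def indices_subset_entry\<close>)
  then show ?thesis by (auto simp: rel_def indices_subset_entry)
qed

lemma indices_minus_subset:
  fixes X Y :: "('i, 'k::ring) fmat"
  assumes "indices X \<subseteq> B" "indices Y \<subseteq> B"
  shows "indices (X - Y) \<subseteq> B"
proof -
  have "rel (B \<times> B) (X - Y)"
    by (rule rel_minus) (use assms in \<open>auto simp: rel_def indices_subset_entry\<close>)
  then show ?thesis by (auto simp: rel_def indices_subset_entry)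
qed

lemma indices_sum_subset:
  fixes X :: "'c \<Rightarrow> ('i, 'k::ring) fmat"
  assumes "\<And>a. a \<in> A \<Longrightarrow> indices (X a) \<subseteq> B"
  shows "indices (sum X A) \<subseteq> B"
proof -
  have "rel (B \<times> B) (sum X A)"
    by (rule rel_sum) (use assms in \<open>auto simp: rel_def indices_subset_entry\<close>)
  then show ?thesis by (auto simp: rel_def indices_subset_entry)
qed

lemma ultramat_hom:
  assumes B: "finite B" "\<And>x. indices (X x) \<subseteq> B" "\<And>x. indices (Y x) \<subseteq> B"
  shows "ultramat X * ultramat Y = ultramat (\<lambda>x. X x * Y x)"
    and "ultramat X - ultramat Y = ultramat (\<lambda>x. X x - Y x)"
proof -
  note e = entry_ultramat[OF B(1,2)] entry_ultramat[OF B(1,3)]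
  note z = entry_zero_outside_superset[OF B(2)] entry_zero_outside_superset[OF B(3)]
  show "ultramat X - ultramat Y = ultramat (\<lambda>x. X x - Y x)"
    by (rule fmat_eqI, subst entry_ultramat[OF B(1)])
      (simp_all add: e ultraclass_hom indices_minus_subset B)
  show "ultramat X * ultramat Y = ultramat (\<lambda>x. X x * Y x)"
  proof (rule fmat_eqI)
    fix i k
    have "entry (ultramat X * ultramat Y) i k = (\<Sum>j\<in>B. entry (ultramat X) i j * entry (ultramat Y) j k)"
      by (rule entry_times[OF B(1)]) (simp add: e z ultraclass_hom)
    also have "\<dots> = ultraclass (\<lambda>x. \<Sum>j\<in>B. entry (X x) i j * entry (Y x) j k)"
      by (simp add: e ultraclass_hom ultraclass_sum)
    also have "(\<lambda>x. \<Sum>j\<in>B. entry (X x) i j * entry (Y x) j k) = (\<lambda>x. entry (X x * Y x) i k)"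
      by (rule ext, rule entry_times[OF B(1), symmetric]) (simp add: z)
    also have "ultraclass \<dots> = entry (ultramat (\<lambda>x. X x * Y x)) i k"
      by (rule entry_ultramat[OF B(1), symmetric]) (simp add: indices_times_subset B)
    finally show "entry (ultramat X * ultramat Y) i k = entry (ultramat (\<lambda>x. X x * Y x)) i k" .
  qed
qed

lemma ultramat_sum:
  assumes B: "finite B" "\<And>a x. a \<in> A \<Longrightarrow> indices (X a x) \<subseteq> B"
  shows "(\<Sum>a\<in>A. ultramat (X a)) = ultramat (\<lambda>x. \<Sum>a\<in>A. X a x)"
proof (rule fmat_eqI)
  fix i j
  have "entry (ultramat (\<lambda>x. \<Sum>a\<in>A. X a x)) i j = ultraclass (\<lambda>x. entry (\<Sum>a\<in>A. X a x) i j)"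
    by (rule entry_ultramat[OF B(1)]) (simp add: indices_sum_subset B(2))
  also have "\<dots> = (\<Sum>a\<in>A. ultraclass (\<lambda>x. entry (X a x) i j))"
    by (simp add: ultraclass_sum)
  also have "\<dots> = (\<Sum>a\<in>A. entry (ultramat (X a)) i j)"
    by (rule sum.cong) (simp_all add: entry_ultramat[OF B])
  finally show "entry (\<Sum>a\<in>A. ultramat (X a)) i j = entry (ultramat (\<lambda>x. \<Sum>a\<in>A. X a x)) i j" by simp
qed

lemma ultramat_zero: "ultramat (\<lambda>x. 0) = 0"
  by (rule fmat_eqI) (subst entry_ultramat[of "{}"], auto simp: indices_def ultraclass_hom)

abbreviation arrow_block :: "('v, 'a) pre_digraph \<Rightarrow> 'a \<Rightarrow> 'k::zero mat \<Rightarrow> (('v + 'a) \<times> nat, 'k) fmat" where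
  "arrow_block Q a \<equiv> block (Inl (head Q a)) (Inl (tail Q a))"

lemma (in fin_digraph) finite_vertex_slots: "finite (vertex_slots G d)"
  unfolding vertex_slots_def slots_def by auto

lemma indices_arrow_block:
  assumes "fin_digraph Q" "M \<in> rep_space Q d" "a \<in> arcs Q"
  shows "indices (arrow_block Q a (M a)) \<subseteq> vertex_slots Q d"
proof -
  interpret fin_digraph Q by fact
  have "head Q a \<in> verts Q" "tail Q a \<in> verts Q" using assms(3) by auto
  then show ?thesis
    using rep_space_carrier[OF assms(2,3)]
    by (auto simp: indices_subset_entry entry_block vertex_slots_def slots_def mem_Times_iff split: if_splits)
qed

theorem generic_unobstructed:
  fixes Q :: "('v, 'a) pre_digraph"
  assumes Q: "fin_digraph Q"
  shows "\<exists>f\<in>rep_poly_functions Q d. (\<exists>M\<in>rep_space Q d. f M \<noteq> 0) \<and>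
    (\<forall>M\<in>rep_space Q d. f M \<noteq> 0 \<longrightarrow> \<not> obstructed Q d (\<lambda>a. arrow_block Q a (M a)))"
proof (rule ccontr)
  interpret fin_digraph Q by fact
  define B where "B = (vertex_slots Q d :: (('v + 'a) \<times> nat) set)"
  define \<P> where "\<P> = rep_poly_functions Q d"
  define N where "N = {f \<in> \<P>. \<exists>M\<in>rep_space Q d. f M \<noteq> 0}"
  assume "\<not> ?thesis"
  then have neg: "\<exists>M\<in>rep_space Q d. f M \<noteq> 0 \<and> obstructed Q d (\<lambda>a. arrow_block Q a (M a))"
    if "f \<in> N" for f using that unfolding N_def \<P>_def by blast
  \<comment> \<open>If \<open>x \<inter> N\<close> is infinite, the product is 1 by convention and
    imposes nothing. The ultrafilter is concentrated on finite \<open>x\<close>, where a nonzero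
    product means that every member of \<open>x \<inter> N\<close> is nonzero.\<close>
  have "\<exists>M\<in>rep_space Q d. (\<Prod>f\<in>x \<inter> N. f M) \<noteq> 0 \<and> obstructed Q d (\<lambda>a. arrow_block Q a (M a))" for x
  proof -
    have N: "f \<in> rep_poly_functions Q d \<and> (\<exists>M\<in>rep_space Q d. f M \<noteq> 0)" if "f \<in> x \<inter> N" for f
      using that unfolding N_def \<P>_def by simp
    have "(\<lambda>M. \<Prod>f\<in>x \<inter> N. f M) \<in> rep_poly_functions Q d"
      by (rule rep_poly_functions_prod) (rule N[THEN conjunct1])
    moreover have "\<exists>M\<in>rep_space Q d. (\<Prod>f\<in>x \<inter> N. f M) \<noteq> 0"
      by (rule rep_poly_prod_nonzero) (rule N)
    ultimately have "(\<lambda>M. \<Prod>f\<in>x \<inter> N. f M) \<in> N" by (subst N_def) (simp add: \<P>_def)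
    then show ?thesis by (rule neg)
  qed
  then have "\<forall>x. \<exists>L. L \<in> rep_space Q d \<and> (\<Prod>f\<in>x \<inter> N. f L) \<noteq> 0 \<and>
      obstructed Q d (\<lambda>a. arrow_block Q a (L a))" by (simp only: Bex_def) simp
  from choice[OF this] obtain M where M: "M x \<in> rep_space Q d" "(\<Prod>f\<in>x \<inter> N. f (M x)) \<noteq> 0"
    and obs: "obstructed Q d (\<lambda>a. arrow_block Q a (M x a))" for x by auto
  define W where "W x P l \<longleftrightarrow> indices P \<subseteq> B \<and> P * P = P \<and>
     (\<forall>a\<in>arcs Q. arrow_block Q a (M x a) * P = P * arrow_block Q a (M x a) * P \<and> l a = P * l a \<and> l a * P = 0 \<and>
       rel (slots d (tail Q a) \<times> slots d (head Q a)) (l a)) \<and>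
     P * (\<Sum>a\<in>arcs Q. l a * arrow_block Q a (M x a) - arrow_block Q a (M x a) * l a) = 0 \<and> (\<exists>a\<in>arcs Q. l a \<noteq> 0)"
    for x P l
  have "\<exists>Pl. W x (fst Pl) (snd Pl)" for x
  proof -
    obtain P l where "W x P l" using obs[of x] unfolding obstructed_def W_def B_def by (elim exE)
    then show ?thesis by (intro exI[of _ "(P, l)"]) simp
  qed
  then have "\<exists>Pl. \<forall>x. W x (fst (Pl x)) (snd (Pl x))" by (intro choice allI)
  then obtain Pl where "\<forall>x. W x (fst (Pl x)) (snd (Pl x))" by (elim exE)
  then have W: "W x (fst (Pl x)) (snd (Pl x))" for x by (rule spec)
  define P where "P x = fst (Pl x)" for x
  define l where "l x = snd (Pl x)" for x
  note W = W[folded P_def l_def, unfolded W_def]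
  note W1 = W[THEN conjunct2, THEN conjunct2, THEN conjunct1, rule_format]
  have P: "indices (P x) \<subseteq> B" "P x * P x = P x" for x
    by (rule W[THEN conjunct1], rule W[THEN conjunct2, THEN conjunct1])
  have mP: "arrow_block Q a (M x a) * P x = P x * arrow_block Q a (M x a) * P x" if "a \<in> arcs Q" for x a
    by (rule W1[THEN conjunct1, OF that])
  have Pl: "l x a = P x * l x a" if "a \<in> arcs Q" for x a
    by (rule W1[THEN conjunct2, THEN conjunct1, OF that])
  have lP: "l x a * P x = 0" if "a \<in> arcs Q" for x a
    by (rule W1[THEN conjunct2, THEN conjunct2, THEN conjunct1, OF that])
  have lrel: "rel (slots d (tail Q a) \<times> slots d (head Q a)) (l x a)" if "a \<in> arcs Q" for x a
    by (rule W1[THEN conjunct2, THEN conjunct2, THEN conjunct2, OF that])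
  have PC: "P x * (\<Sum>a\<in>arcs Q. l x a * arrow_block Q a (M x a) - arrow_block Q a (M x a) * l x a) = 0" for x
    by (rule W[THEN conjunct2, THEN conjunct2, THEN conjunct2, THEN conjunct1])
  have lnz: "\<exists>a\<in>arcs Q. l x a \<noteq> 0" for x
    by (rule W[THEN conjunct2, THEN conjunct2, THEN conjunct2, THEN conjunct2])
  have finB: "finite B" unfolding B_def by (rule finite_vertex_slots)
  have lB: "indices (l x a) \<subseteq> B" if "a \<in> arcs Q" for x a
    using lrel[OF that, of x] tail_in_verts[OF that] head_in_verts[OF that]
    unfolding rel_def indices_subset_entry B_def vertex_slots_def by blast
  have mB: "indices (arrow_block Q a (M x a)) \<subseteq> B" if "a \<in> arcs Q" for x a
    unfolding B_def using Q M(1) that by (rule indices_arrow_block)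
  \<comment> \<open>The chosen representations form a generic point: a polynomial function that is
    nonzero somewhere belongs to almost every index \<open>x\<close>, so if it vanished at almost
    all \<open>M x\<close> then so would the product in \<open>M(2)\<close>.\<close>
  have vanish: "f L = 0"
    if f: "f \<in> \<P>" and ev: "\<forall>\<^sub>F x in ultra. f (M x) = 0" and L: "L \<in> rep_space Q d" for f L
  proof (rule ccontr)
    assume "f L \<noteq> 0"
    then have "f \<in> N" using f L unfolding N_def by blast
    have "\<forall>\<^sub>F x in finite_subsets_at_top UNIV. finite x \<and> {f} \<subseteq> x"
      by (simp add: eventually_finite_subsets_at_top) (rule exI[of _ "{f}"], auto)
    then have "\<forall>\<^sub>F x in ultra. finite x \<and> {f} \<subseteq> x" by (rule filter_leD[OF ultra_le])
    with ev have "\<forall>\<^sub>F x in (ultra :: (('a \<Rightarrow> complex mat) \<Rightarrow> complex) set filter). False"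
    proof eventually_elim
      case (elim x)
      then have "finite (x \<inter> N)" "f \<in> x \<inter> N" using \<open>f \<in> N\<close> by auto
      then have "(\<Prod>f\<in>x \<inter> N. f (M x)) = 0" using elim by (metis prod_zero)
      then show False using M(2) by blast
    qed
    then show False by (simp add: ultra_proper)
  qed
  \<comment> \<open>The values of the polynomial functions at the generic point. By
    \<open>vanish\<close> they form a faithful copy of the ring of polynomial functions on the
    representation space.\<close>
  define R where "R = (\<lambda>f. ultraclass (\<lambda>x. f (M x))) ` \<P>"
  define m where "m a = ultramat (\<lambda>x. arrow_block Q a (M x a))" for a
  define p where "p = ultramat P"
  define lam where "lam a = ultramat (\<lambda>x. l x a)" for a
  note hom = ultramat_hom[OF finB]
  have sub: "indices (P x * X) \<subseteq> B" if "indices X \<subseteq> B" for x X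
    using that P by (intro indices_times_subset)
  have pp: "p * p = p" unfolding p_def by (simp add: hom P)
  have mp: "m a * p = p * m a * p" if "a \<in> arcs Q" for a
    unfolding p_def m_def using that mP by (simp add: hom P mB sub)
  have pl: "lam a = p * lam a" if "a \<in> arcs Q" for a
    unfolding p_def lam_def using that Pl by (simp add: hom P lB)
  have lp: "lam a * p = 0" if "a \<in> arcs Q" for a
    unfolding p_def lam_def using that lP by (simp add: hom P lB ultramat_zero)
  have pC: "p * (\<Sum>a\<in>arcs Q. lam a * m a - m a * lam a) = 0"
  proof -
    have "lam a * m a - m a * lam a =
        ultramat (\<lambda>x. l x a * arrow_block Q a (M x a) - arrow_block Q a (M x a) * l x a)"
      if "a \<in> arcs Q" for a
      unfolding lam_def m_def using that by (simp add: hom mB lB indices_times_subset)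
    then have "(\<Sum>a\<in>arcs Q. lam a * m a - m a * lam a) =
        ultramat (\<lambda>x. \<Sum>a\<in>arcs Q. l x a * arrow_block Q a (M x a) - arrow_block Q a (M x a) * l x a)"
      by (simp add: ultramat_sum[OF finB] indices_minus_subset indices_times_subset lB mB)
    then show ?thesis
      unfolding p_def
      by (simp add: hom P indices_sum_subset indices_minus_subset indices_times_subset lB mB PC ultramat_zero)
  qed
  have zero: "entry (lam b) (Inl (tail Q b), j) (Inl (head Q b), i) = 0"
    if b: "b \<in> arcs Q" "i < d (head Q b)" "j < d (tail Q b)" for b i j
  proof -
    obtain pd where pd: "\<And>f. f \<in> \<P> \<Longrightarrow> pd f \<in> \<P>"
      "\<And>f L. f \<in> \<P> \<Longrightarrow> L \<in> rep_space Q d \<Longrightarrow> ((\<lambda>t. f (rep_shift L b i j t)) has_field_derivative pd f L) (at 0)"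
      using rep_poly_partial_derivative[OF _ b(1), of _ d i j] unfolding \<P>_def by metis
    have deriv: "ultraclass (\<lambda>x. pd f (M x)) = ultraclass (\<lambda>x. g' (M x))"
      if f: "f \<in> \<P>" "g \<in> \<P>" "ultraclass (\<lambda>x. f (M x)) = ultraclass (\<lambda>x. g (M x))"
        and g': "\<And>L. L \<in> rep_space Q d \<Longrightarrow> ((\<lambda>t. g (rep_shift L b i j t)) has_field_derivative g' L) (at 0)"
      for f g g'
    proof -
      have eq: "f L = g L" if "L \<in> rep_space Q d" for L
        using vanish[of "\<lambda>L. f L - g L" L] rep_poly_functions_diff[of f Q d g] f that
        unfolding \<P>_def ultraclass_eq_iff by simp
      have "pd f L = g' L" if L: "L \<in> rep_space Q d" for L
        using DERIV_unique[OF pd(2)[OF f(1) L]] g'[OF L]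
        by (simp add: eq[OF rep_shift_in_rep_space[OF L b(1)]])
      then show ?thesis using M(1) by simp
    qed
    \<comment> \<open>The partial derivative with respect to the entry \<open>(i, j)\<close> at
      \<open>b\<close>, transported to \<open>R\<close>; by \<open>deriv\<close> it does not depend
      on the function chosen to represent \<open>y\<close>.\<close>
    define D where "D y = ultraclass (\<lambda>x. pd (SOME f. f \<in> \<P> \<and> y = ultraclass (\<lambda>x. f (M x))) (M x))" for y
    have D: "D (ultraclass (\<lambda>x. g (M x))) = ultraclass (\<lambda>x. g' (M x))"
      if g: "g \<in> \<P>" "\<And>L. L \<in> rep_space Q d \<Longrightarrow> ((\<lambda>t. g (rep_shift L b i j t)) has_field_derivative g' L) (at 0)"
      for g g'
    proof -
      let ?f = "SOME f. f \<in> \<P> \<and> ultraclass (\<lambda>x. g (M x)) = ultraclass (\<lambda>x. f (M x))"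
      have "?f \<in> \<P> \<and> ultraclass (\<lambda>x. g (M x)) = ultraclass (\<lambda>x. ?f (M x))"
        by (rule someI[of _ g]) (simp add: g)
      then show ?thesis unfolding D_def by (intro deriv[OF _ g(1) _ g(2)]) auto
    qed
    have "derivation_on R D"
      unfolding derivation_on_def
    proof (intro conjI ballI)
      show "1 \<in> R" unfolding R_def \<P>_def ultraclass_hom
        by (rule image_eqI[OF _ rep_poly_functions.const[of 1]]) simp
      fix y z assume "y \<in> R" "z \<in> R"
      then obtain f g where f: "f \<in> \<P>" "y = ultraclass (\<lambda>x. f (M x))" and g: "g \<in> \<P>" "z = ultraclass (\<lambda>x. g (M x))"
        unfolding R_def by blast
      have fg: "(\<lambda>L. f L - g L) \<in> \<P>" "(\<lambda>L. f L * g L) \<in> \<P>"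
        using f g unfolding \<P>_def by (auto intro: rep_poly_functions_diff rep_poly_functions.mult)
      show "y - z \<in> R" "y * z \<in> R" unfolding R_def f g ultraclass_hom using fg by auto
      have Df: "D (ultraclass (\<lambda>x. h (M x))) = ultraclass (\<lambda>x. pd h (M x))" if "h \<in> \<P>" for h
        by (rule D[OF that]) (rule pd(2)[OF that])
      show "D (y - z) = D y - D z"
        unfolding f(2) g(2) ultraclass_hom Df[OF f(1)] Df[OF g(1)]
        by (rule D[OF fg(1)]) (auto intro!: DERIV_diff pd f g)
      show "D (y * z) = D y * z + y * D z"
        unfolding f(2) g(2) ultraclass_hom Df[OF f(1)] Df[OF g(1)]
        by (rule D[OF fg(2)])
          (auto intro!: DERIV_mult[THEN DERIV_cong] pd f g simp: rep_shift_0[OF _ b(1)])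
    qed
    \<comment> \<open>The entries of \<open>p\<close> and \<open>lam\<close> need not lie in
      \<open>R\<close>, hence the extension to the whole field.\<close>
    then obtain E where E: "derivation_on UNIV E" "\<And>y. y \<in> R \<Longrightarrow> E y = D y"
      using derivation_extends by blast
    \<comment> \<open>The entries of \<open>m a\<close> are values of coordinate functions, so
      differentiation leaves a single matrix unit, and the trace identity below reads off one entry
      of \<open>lam b\<close>.\<close>
    have Em: "map_fmat E (m a) = (if a = b then munit (Inl (head Q b), i) (Inl (tail Q b), j) 1 else 0)"
      if a: "a \<in> arcs Q" for a
    proof (rule fmat_eqI)
      fix y z
      have e: "entry (map_fmat E (m a)) y z = E (ultraclass (\<lambda>x. entry (arrow_block Q a (M x a)) y z))"
        unfolding m_def by (simp add: entry_map_fmat derivation_onD[OF E(1)] entry_ultramat[OF finB mB[OF a]])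
      show "entry (map_fmat E (m a)) y z =
          entry (if a = b then munit (Inl (head Q b), i) (Inl (tail Q b), j) 1 else 0) y z"
      proof (cases "fst y = Inl (head Q a) \<and> fst z = Inl (tail Q a) \<and> snd y < d (head Q a) \<and> snd z < d (tail Q a)")
        case True
        define g where "g = (\<lambda>L. L a $$ (snd y, snd z) :: complex)"
        have g: "g \<in> \<P>" unfolding g_def \<P>_def using a True by (intro rep_poly_functions.coord) auto
        have "entry (arrow_block Q a (M x a)) y z = g (M x)" for x
          using True by (simp add: carrier_matD[OF rep_space_carrier[OF M(1) a]] entry_block g_def)
        then have "entry (map_fmat E (m a)) y z = D (ultraclass (\<lambda>x. g (M x)))"
          unfolding e using E(2) g by (simp add: R_def)
        also have "\<dots> = ultraclass (\<lambda>x. if (a, snd y, snd z) = (b, i, j) then 1 else 0)"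
        proof (rule D[OF g])
          fix L assume L: "L \<in> rep_space Q d"
          have "g (rep_shift L b i j t) = g L + (if (a, snd y, snd z) = (b, i, j) then t else 0)" for t
            using a True rep_space_carrier[OF L a] by (auto simp: rep_shift_def g_def)
          then show "((\<lambda>t. g (rep_shift L b i j t)) has_field_derivative
              (if (a, snd y, snd z) = (b, i, j) then 1 else 0)) (at 0)"
            by (auto intro!: derivative_eq_intros)
        qed
        also have "\<dots> = entry (if a = b then munit (Inl (head Q b), i) (Inl (tail Q b), j) 1 else 0) y z"
          using True by (auto simp: ultraclass_hom prod_eq_iff)
        finally show ?thesis .
      next
        case False
        then have "entry (arrow_block Q a (M x a)) y z = 0" for x
          by (auto simp: carrier_matD[OF rep_space_carrier[OF M(1) a]] entry_block)
        then show ?thesis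
          unfolding e using False b derivation_onD(7)[OF E(1)] by (auto simp: ultraclass_hom)
      qed
    qed
    have "0 = (\<Sum>a\<in>arcs Q. tr (lam a * map_fmat E (m a)))"
      by (rule trace_derivation[OF E(1) pp mp pl lp pC, symmetric])
    also have "\<dots> = (\<Sum>a\<in>arcs Q. if a = b then tr (lam b * munit (Inl (head Q b), i) (Inl (tail Q b), j) 1) else 0)"
      by (rule sum.cong) (simp_all add: Em)
    also have "\<dots> = tr (lam b * munit (Inl (head Q b), i) (Inl (tail Q b), j) 1)" using b(1) by simp
    also have "\<dots> = entry (lam b) (Inl (tail Q b), j) (Inl (head Q b), i)"
    proof -
      have "entry (lam b * munit (Inl (head Q b), i) (Inl (tail Q b), j) 1) y z =
          (if z = (Inl (tail Q b), j) then entry (lam b) y (Inl (head Q b), i) else 0)" for y z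
        by (subst entry_times[of "{(Inl (head Q b), i)}"]) auto
      then show ?thesis by (subst tr_eq[of "{(Inl (tail Q b), j)}"]) auto
    qed
    finally show ?thesis by simp
  qed
  \<comment> \<open>Back to the factors: a vanishing class means vanishing for almost every
    \<open>x\<close>. Only finitely many entries and arrows are involved, so all of them vanish
    together for some \<open>x\<close>, against \<open>lnz\<close>.\<close>
  have "\<forall>\<^sub>F x in ultra. l x a = 0" if a: "a \<in> arcs Q" for a
  proof -
    have "\<forall>\<^sub>F x in ultra. \<forall>y\<in>B \<times> B. entry (l x a) (fst y) (snd y) = 0"
    proof (intro eventually_ball_finite ballI)
      fix y :: "(('v + 'a) \<times> nat) \<times> ('v + 'a) \<times> nat"
      show "\<forall>\<^sub>F x in ultra. entry (l x a) (fst y) (snd y) = 0"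
      proof (cases "y \<in> slots d (tail Q a) \<times> slots d (head Q a)")
        case True
        then obtain i j where y: "y = ((Inl (tail Q a), j), (Inl (head Q a), i))" "j < d (tail Q a)" "i < d (head Q a)"
          by (auto simp: slots_def)
        show ?thesis using zero[OF a y(3,2)]
          by (simp add: y(1) lam_def entry_ultramat[OF finB lB[OF a]] ultraclass_hom ultraclass_eq_iff)
      next
        case False
        then have "entry (l x a) (fst y) (snd y) = 0" for x
          using lrel[OF a, of x] prod.collapse[of y] unfolding rel_def by metis
        then show ?thesis by simp
      qed
    qed (use finB in auto)
    then show ?thesis
    proof (rule eventually_mono)
      fix x assume 0: "\<forall>y\<in>B \<times> B. entry (l x a) (fst y) (snd y) = 0"
      show "l x a = 0"
      proof (rule fmat_eqI)
        fix y z show "entry (l x a) y z = entry 0 y z"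
          using 0 entry_zero_outside_superset[OF lB[OF a], of y z x] by (cases "y \<in> B \<and> z \<in> B") auto
      qed
    qed
  qed
  then have "\<forall>\<^sub>F x in ultra. \<forall>a\<in>arcs Q. l x a = 0" by (intro eventually_ball_finite ballI) auto
  then have "\<forall>\<^sub>F x in (ultra :: (('a \<Rightarrow> complex mat) \<Rightarrow> complex) set filter). False"
    by (rule eventually_mono) (use lnz in blast)
  then show False by (simp add: ultra_proper)
qed

section \<open>Fixed points depending continuously on a parameter\<close>

text \<open>Banach iteration started at \<open>y0\<close>, for all parameters at once. The error
  after \<open>n\<close> steps is at most \<open>\<kappa> ^ n * D\<close> whatever \<open>p\<close>
  is, so the continuous iterates converge uniformly. The set \<open>V p\<close> varies because in
  the application the contraction estimate holds only on a linear space depending on the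
  parameter.\<close>

lemma continuous_fixed_point:
  fixes T :: "'p::topological_space \<Rightarrow> 'y::metric_space \<Rightarrow> 'y"
  assumes K: "complete K" "y0 \<in> K" "\<And>y. y \<in> K \<Longrightarrow> dist y0 y \<le> D"
    and V: "\<And>p. p \<in> S \<Longrightarrow> closed (V p)" "\<And>p. p \<in> S \<Longrightarrow> y0 \<in> V p"
    and T: "\<And>p y. p \<in> S \<Longrightarrow> y \<in> V p \<Longrightarrow> y \<in> K \<Longrightarrow> T p y \<in> V p \<inter> K"
    and contr: "\<And>p y y'. p \<in> S \<Longrightarrow> y \<in> V p \<inter> K \<Longrightarrow> y' \<in> V p \<inter> K \<Longrightarrow> dist (T p y) (T p y') \<le> \<kappa> * dist y y'"
    and \<kappa>: "0 \<le> \<kappa>" "\<kappa> < 1"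
    and cont: "continuous_on (S \<times> K) (\<lambda>q. T (fst q) (snd q))"
  obtains fx where "continuous_on S fx" "\<And>p. p \<in> S \<Longrightarrow> fx p \<in> V p \<inter> K \<and> T p (fx p) = fx p"
    "\<And>p. p \<in> S \<Longrightarrow> T p y0 = y0 \<Longrightarrow> fx p = y0"
proof -
  define Y where "Y n p = (T p ^^ n) y0" for n p
  have Y0: "Y 0 p = y0" and Ys: "Y (Suc n) p = T p (Y n p)" for n p by (simp_all add: Y_def)
  have YK: "Y n p \<in> V p \<inter> K" if "p \<in> S" for n p
    using V(2)[OF that] K(2) T[OF that] by (induction n) (auto simp: Y0 Ys)
  have cau: "dist (Y n p) (Y (n + k) p) \<le> \<kappa> ^ n * D" if p: "p \<in> S" for n k p
  proof (induction n)
    case 0 show ?case using YK[OF p, of k] K(3) by (simp add: Y0)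
  next
    case (Suc n)
    have "dist (Y (Suc n) p) (Y (Suc n + k) p) \<le> \<kappa> * dist (Y n p) (Y (n + k) p)"
      using contr[OF p YK[OF p] YK[OF p]] by (simp add: Ys)
    also have "\<dots> \<le> \<kappa> * (\<kappa> ^ n * D)" by (rule mult_left_mono[OF Suc \<kappa>(1)])
    finally show ?case by simp
  qed
  have lim0: "(\<lambda>n. \<kappa> ^ n * D) \<longlonglongrightarrow> 0"
    using \<kappa> by (intro tendsto_mult_left_zero LIMSEQ_power_zero) auto
  have conv: "\<exists>l\<in>K. (\<lambda>n. Y n p) \<longlonglongrightarrow> l" if p: "p \<in> S" for p
  proof -
    have "Cauchy (\<lambda>n. Y n p)"
    proof (rule metric_CauchyI)
      fix e :: real assume "e > 0"
      then obtain N where N: "\<And>n. n \<ge> N \<Longrightarrow> \<kappa> ^ n * D < e / 2"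
        using order_tendstoD(2)[OF lim0, of "e / 2"] unfolding eventually_sequentially by auto
      have "dist (Y m p) (Y n p) < e" if "m \<ge> N" "n \<ge> N" for m n
      proof -
        have "dist (Y N p) (Y m p) < e / 2" "dist (Y N p) (Y n p) < e / 2"
          using cau[OF p, of N "m - N"] cau[OF p, of N "n - N"] N[of N] that by auto
        then show ?thesis using dist_triangle3[of "Y m p" "Y n p" "Y N p"] by linarith
      qed
      then show "\<exists>M. \<forall>m\<ge>M. \<forall>n\<ge>M. dist (Y m p) (Y n p) < e" by blast
    qed
    then show ?thesis
      using K(1)[unfolded complete_def, THEN spec[of _ "\<lambda>n. Y n p"]] YK[OF p] by blast
  qed
  define fx where "fx p = lim (\<lambda>n. Y n p)" for p
  have fx: "(\<lambda>n. Y n p) \<longlonglongrightarrow> fx p" "fx p \<in> K" if "p \<in> S" for p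
    using conv[OF that] by (auto simp: fx_def limI)
  have fxV: "fx p \<in> V p" if "p \<in> S" for p
    using closed_sequentially[OF V(1)[OF that] _ fx(1)[OF that]] YK[OF that] by blast
  have rate: "dist (Y n p) (fx p) \<le> \<kappa> ^ n * D" if p: "p \<in> S" for n p
  proof (rule tendsto_upperbound)
    show "(\<lambda>k. dist (Y n p) (Y (k + n) p)) \<longlonglongrightarrow> dist (Y n p) (fx p)"
      by (intro tendsto_intros LIMSEQ_ignore_initial_segment fx p)
    show "\<forall>\<^sub>F k in sequentially. dist (Y n p) (Y (k + n) p) \<le> \<kappa> ^ n * D"
      using cau[OF p, of n] by (simp add: add.commute)
  qed simp
  have "uniform_limit S Y fx sequentially"
  proof (rule uniform_limitI)
    fix e :: real assume "e > 0"
    then have "\<forall>\<^sub>F n in sequentially. \<kappa> ^ n * D < e" using order_tendstoD(2)[OF lim0] by blast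
    then show "\<forall>\<^sub>F n in sequentially. \<forall>p\<in>S. dist (Y n p) (fx p) < e"
      by (rule eventually_mono) (use rate in \<open>auto intro: le_less_trans\<close>)
  qed
  moreover have "continuous_on S (Y n)" for n
  proof (induction n)
    case 0 show ?case by (simp add: Y0 continuous_on_const)
  next
    case (Suc n)
    have "continuous_on S (\<lambda>p. (\<lambda>q. T (fst q) (snd q)) (p, Y n p))"
      by (rule continuous_on_compose2[OF cont]) (use Suc YK in \<open>auto intro!: continuous_intros\<close>)
    then show ?case by (simp add: Ys[abs_def])
  qed
  ultimately have "continuous_on S fx" by (intro uniform_limit_theorem[where f = Y and F = sequentially]) auto
  moreover have "fx p \<in> V p \<inter> K \<and> T p (fx p) = fx p" if p: "p \<in> S" for p
  proof -
    have "(\<lambda>n. T p (Y n p)) \<longlonglongrightarrow> T p (fx p)"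
    proof (rule metric_tendsto_imp_tendsto)
      show "(\<lambda>n. Y n p) \<longlonglongrightarrow> fx p" by (rule fx[OF p])
      have "dist (T p (Y n p)) (T p (fx p)) \<le> dist (Y n p) (fx p)" for n
      proof -
        have "dist (T p (Y n p)) (T p (fx p)) \<le> \<kappa> * dist (Y n p) (fx p)"
          using contr p YK fx fxV by blast
        also have "\<dots> \<le> 1 * dist (Y n p) (fx p)" by (rule mult_right_mono) (use \<kappa> in auto)
        finally show ?thesis by simp
      qed
      then show "\<forall>\<^sub>F n in sequentially. dist (T p (Y n p)) (T p (fx p)) \<le> dist (Y n p) (fx p)" by simp
    qed
    moreover have "(\<lambda>n. T p (Y n p)) \<longlonglongrightarrow> fx p"
      using LIMSEQ_Suc[OF fx(1)[OF p]] by (simp add: Ys)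
    ultimately show ?thesis using LIMSEQ_unique fx fxV p by blast
  qed
  moreover have "fx p = y0" if p: "p \<in> S" "T p y0 = y0" for p
  proof -
    have "Y n p = y0" for n using p(2) by (induction n) (simp_all add: Y0 Ys)
    then show ?thesis using LIMSEQ_unique[OF fx(1)[OF p(1)], of y0] by simp
  qed
  ultimately show ?thesis using that by blast
qed

text \<open>Chord method: the equation \<open>\<Phi> g = 0\<close> is solved with \<open>g = A y\<close>, where \<open>A\<close> is the adjoint of
  the approximate derivative \<open>L\<close> of \<open>\<Phi>\<close>, so that \<open>y - \<eta> L (A y)\<close> is a contraction as soon as
  \<open>A\<close> is bounded below.\<close>

lemma chord_step_contraction:
  fixes A :: "'y::real_inner \<Rightarrow> 'g::real_inner" and L :: "'g \<Rightarrow> 'y"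
  assumes "inner (L (A w)) w = (norm (A w))\<^sup>2" "norm (L (A w)) \<le> C * norm (A w)"
    and "\<mu> * norm w \<le> norm (A w)" "\<mu> \<ge> 0" "0 < \<eta>" "\<eta> * C\<^sup>2 \<le> 1"
  shows "(norm (w - \<eta> *\<^sub>R L (A w)))\<^sup>2 \<le> (1 - \<eta> * \<mu>\<^sup>2) * (norm w)\<^sup>2"
proof -
  let ?u = "A w"
  have "(norm (w - \<eta> *\<^sub>R L ?u))\<^sup>2 = (norm w)\<^sup>2 - 2 * \<eta> * inner (L ?u) w + \<eta>\<^sup>2 * (norm (L ?u))\<^sup>2"
    unfolding power2_norm_eq_inner
    by (simp add: inner_diff_left inner_diff_right inner_commute power2_eq_square algebra_simps)
  also have "\<dots> \<le> (norm w)\<^sup>2 - 2 * \<eta> * (norm ?u)\<^sup>2 + \<eta>\<^sup>2 * (C * norm ?u)\<^sup>2"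
    using assms(1,2) by (simp add: mult_left_mono power_mono)
  also have "\<dots> = (norm w)\<^sup>2 - 2 * \<eta> * (norm ?u)\<^sup>2 + (\<eta> * C\<^sup>2) * (\<eta> * (norm ?u)\<^sup>2)"
    by (simp add: power2_eq_square algebra_simps)
  \<comment> \<open>The condition \<open>\<eta> * C\<^sup>2 \<le> 1\<close> lets the quadratic term
    cancel at most one of the two copies of the linear term.\<close>
  also have "\<dots> \<le> (norm w)\<^sup>2 - 2 * \<eta> * (norm ?u)\<^sup>2 + 1 * (\<eta> * (norm ?u)\<^sup>2)"
    using assms by (intro add_left_mono mult_right_mono) auto
  also have "\<dots> = (norm w)\<^sup>2 - \<eta> * (norm ?u)\<^sup>2" by simp
  also have "\<dots> \<le> (norm w)\<^sup>2 - \<eta> * (\<mu> * norm w)\<^sup>2"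
    using assms by (intro diff_left_mono mult_left_mono power_mono) auto
  finally show ?thesis by (simp add: power_mult_distrib algebra_simps)
qed

section \<open>Deforming subrepresentations\<close>

definition diag_slots :: "('v, 'a) pre_digraph \<Rightarrow> ('v \<Rightarrow> nat) \<Rightarrow> ((('v + 'a) \<times> nat) \<times> (('v + 'a) \<times> nat)) set" where
  "diag_slots Q d = (\<Union>i\<in>verts Q. slots d i \<times> slots d i)"

definition projections :: "('v, 'a) pre_digraph \<Rightarrow> ('v \<Rightarrow> nat) \<Rightarrow> (('v + 'a) \<times> nat, complex) fmat set" where
  "projections Q d = {P. rel (diag_slots Q d) P \<and> P * P = P \<and> adj P = P}"

definition stable :: "('v, 'a) pre_digraph \<Rightarrow> ('a \<Rightarrow> ('i, 'k::ring) fmat) \<Rightarrow> ('i, 'k) fmat \<Rightarrow> bool" where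
  "stable Q m P \<longleftrightarrow> (\<forall>a\<in>arcs Q. m a * P = P * m a * P)"

text \<open>A family of matrices indexed by the arrows is turned into a single matrix by moving the rows
  of the matrix at \<open>a\<close> to the slots with first component \<open>Inr a\<close>.\<close>

definition lift :: "('v, 'a) pre_digraph \<Rightarrow> ('v \<Rightarrow> nat) \<Rightarrow> 'a \<Rightarrow> (('v + 'a) \<times> nat, complex) fmat" where
  "lift Q d a = block (Inr a) (Inl (head Q a)) (1\<^sub>m (d (head Q a)))"

abbreviation arrow_slots :: "('v, 'a) pre_digraph \<Rightarrow> ('v \<Rightarrow> nat) \<Rightarrow> 'a \<Rightarrow> ((('v + 'a) \<times> nat) \<times> (('v + 'a) \<times> nat)) set" where
  "arrow_slots Q d a \<equiv> slots d (head Q a) \<times> slots d (tail Q a)"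

lemma entry_lift:
  "entry (lift Q d a) x y =
    (if fst x = Inr a \<and> fst y = Inl (head Q a) \<and> snd x = snd y \<and> snd x < d (head Q a) then 1 else 0)"
  unfolding lift_def entry_block by auto

lemma entry_lift_times:
  "entry (lift Q d a * X) x y =
    (if fst x = Inr a \<and> snd x < d (head Q a) then entry X (Inl (head Q a), snd x) y else 0)"
  by (subst entry_times[of "{(Inl (head Q a), snd x)}"]) (auto simp: entry_lift)

lemma entry_adj_lift_times:
  "entry (adj (lift Q d a) * X) x y =
    (if fst x = Inl (head Q a) \<and> snd x < d (head Q a) then entry X (Inr a, snd x) y else 0)"
  by (subst entry_times[of "{(Inr a, snd x)}"]) (auto simp: entry_lift)

text \<open>The lifts are partial isometries with pairwise orthogonal ranges, so a family can be
  recovered from the sum of its lifts.\<close>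

lemma adj_lift_lift:
  assumes "rel (arrow_slots Q d b) X"
  shows "adj (lift Q d a) * (lift Q d b * X) = (if a = b then X else 0)"
proof (rule fmat_eqI)
  fix x y
  have "entry X x y = 0" if "\<not> (fst x = Inl (head Q b) \<and> snd x < d (head Q b))"
  proof (rule ccontr)
    assume "entry X x y \<noteq> 0"
    then have "x \<in> slots d (head Q b)" using assms unfolding rel_def by blast
    then show False using that by (auto simp: slots_def)
  qed
  then show "entry (adj (lift Q d a) * (lift Q d b * X)) x y = entry (if a = b then X else 0) x y"
    by (auto simp: entry_adj_lift_times entry_lift_times) (metis prod.collapse)+
qed

lemma adj_lift_sum:
  assumes "finite (arcs Q)" "a \<in> arcs Q" "\<And>b. b \<in> arcs Q \<Longrightarrow> rel (arrow_slots Q d b) (F b)"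
  shows "adj (lift Q d a) * (\<Sum>b\<in>arcs Q. lift Q d b * F b) = F a"
proof -
  have "adj (lift Q d a) * (\<Sum>b\<in>arcs Q. lift Q d b * F b) = (\<Sum>b\<in>arcs Q. if a = b then F b else 0)"
    unfolding sum_distrib_left by (rule sum.cong) (simp_all add: adj_lift_lift assms)
  then show ?thesis using assms by simp
qed

section \<open>Compactness and closedness of the spaces of parameters\<close>

lemma closed_rel: "closed {X :: ('i, 'k::real_inner) fmat. rel R X}"
proof -
  have "{X :: ('i, 'k) fmat. rel R X} = (\<Inter>i. \<Inter>j. if (i, j) \<in> R then UNIV else {X. entry X i j = 0})"
    by (auto simp: rel_def split: if_splits)
  moreover have "closed {X :: ('i, 'k) fmat. entry X i j = 0}" for i j
    by (intro closed_Collect_eq continuous_intros bounded_linear.continuous_on[OF bounded_linear_entry])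
  ultimately show ?thesis by (simp only:) (intro closed_INT ballI, simp)
qed

lemma closed_rel_Collect:
  assumes "continuous_on UNIV f"
  shows "closed {q. rel R (f q :: ('i, 'k::real_inner) fmat)}"
  using closed_vimage[OF closed_rel assms, of R] by (simp add: vimage_def)

lemmas continuous_on_adj [continuous_intros] = bounded_linear.continuous_on[OF bounded_linear_adj]

text \<open>For a Hermitian idempotent the square of the norm is the trace, and the trace is at most
  the number of slots times the norm; this bounds the norm. The defining conditions are
  closed.\<close>

lemma compact_projections:
  assumes "fin_digraph Q"
  shows "compact (projections Q d)"
proof -
  let ?B = "vertex_slots Q d"
  have B: "finite ?B" by (rule fin_digraph.finite_vertex_slots[OF assms])
  have "norm P \<le> real (card ?B) \<and> indices P \<subseteq> ?B" if P: "P \<in> projections Q d" for P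
  proof
    show sub: "indices P \<subseteq> ?B"
      using P unfolding projections_def rel_def indices_subset_entry diag_slots_def vertex_slots_def by blast
    have "norm P * norm P = inner P P" by (simp add: norm_eq_sqrt_inner)
    also have "\<dots> = Re (tr P)" using P unfolding inner_eq_tr projections_def by simp
    also have "\<dots> \<le> norm (tr P)" by (rule complex_Re_le_cmod)
    also have "tr P = (\<Sum>i\<in>?B. entry P i i)"
      by (rule tr_eq[OF B]) (simp add: entry_zero_outside_superset[OF sub])
    also have "norm \<dots> \<le> (\<Sum>i\<in>?B. norm P)" by (rule sum_norm_le) (rule norm_entry_le)
    finally have "norm P * norm P \<le> real (card ?B) * norm P" by simp
    then show "norm P \<le> real (card ?B)"
      by (cases "norm P = 0") (auto simp: mult_le_cancel_right)
  qed
  then have "projections Q d = {P. indices P \<subseteq> ?B \<and> norm P \<le> real (card ?B)} \<inter>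
      {P. rel (diag_slots Q d) P \<and> P * P = P \<and> adj P = P}"
    unfolding projections_def by auto
  moreover have "closed {P. rel (diag_slots Q d) P \<and> P * P = P \<and> adj P = P}"
    by (intro closed_Collect_conj closed_rel closed_Collect_eq continuous_intros)
  ultimately show ?thesis using compact_Int_closed[OF compact_fmat_ball[OF B]] by simp
qed

text \<open>Families of maps from the range of \<open>P\<close> at the tail to its kernel at the
  head, packed into one matrix: the component of \<open>y\<close> at \<open>a\<close> is
  \<open>adj (lift Q d a) * y\<close>, and the first equation excludes further entries. For a
  subrepresentation N given by \<open>P\<close> these are the cochains of which Ext(N, M/N) is a
  quotient.\<close>

definition hom_families ::
    "('v, 'a) pre_digraph \<Rightarrow> ('v \<Rightarrow> nat) \<Rightarrow> (('v + 'a) \<times> nat, complex) fmat \<Rightarrow> (('v + 'a) \<times> nat, complex) fmat set" where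
  "hom_families Q d P = {y. y = (\<Sum>a\<in>arcs Q. lift Q d a * (adj (lift Q d a) * y)) \<and>
     (\<forall>a\<in>arcs Q. rel (arrow_slots Q d a) (adj (lift Q d a) * y) \<and>
       P * (adj (lift Q d a) * y) = 0 \<and> adj (lift Q d a) * y * P = adj (lift Q d a) * y)}"

text \<open>Closedness is needed jointly in \<open>P\<close> and \<open>y\<close>, because the lower
  bound for the adjoint is obtained as a minimum over both.\<close>

lemma closed_hom_families_pairs: "closed {q. snd q \<in> hom_families Q d (fst q)}"
  unfolding hom_families_def mem_Collect_eq Ball_def
  by (intro closed_Collect_conj closed_Collect_all closed_Collect_imp closed_rel_Collect
      closed_Collect_eq continuous_intros open_Collect_const)

lemma closed_hom_families: "closed (hom_families Q d P)"
proof -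
  have "closed ((\<lambda>y. (P, y)) -` {q. snd q \<in> hom_families Q d (fst q)})"
    by (intro closed_vimage closed_hom_families_pairs continuous_intros)
  then show ?thesis by (simp add: vimage_def)
qed

lemma hom_familiesI:
  assumes "finite (arcs Q)"
    and "\<And>a. a \<in> arcs Q \<Longrightarrow> rel (arrow_slots Q d a) (F a) \<and> P * F a = 0 \<and> F a * P = F a"
  shows "(\<Sum>a\<in>arcs Q. lift Q d a * F a) \<in> hom_families Q d P"
  unfolding hom_families_def using assms by (auto simp: adj_lift_sum)

lemma hom_families_zero: "0 \<in> hom_families Q d P"
  unfolding hom_families_def by simp

lemma hom_families_diff:
  assumes "y \<in> hom_families Q d P" "y' \<in> hom_families Q d P"
  shows "y - y' \<in> hom_families Q d P"
  using assms unfolding hom_families_def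
  by (auto simp: right_diff_distrib left_diff_distrib sum_subtractf intro: rel_minus)

lemma rel_scaleR: "rel R X \<Longrightarrow> rel R (c *\<^sub>R X)"
  unfolding rel_def by auto

lemma hom_families_scaleR:
  assumes "y \<in> hom_families Q d P"
  shows "c *\<^sub>R y \<in> hom_families Q d P"
  using assms unfolding hom_families_def
  by (auto simp: scaleR_sum_right[symmetric] intro: rel_scaleR)

definition all_slots :: "('v, 'a) pre_digraph \<Rightarrow> ('v \<Rightarrow> nat) \<Rightarrow> (('v + 'a) \<times> nat) set" where
  "all_slots Q d = vertex_slots Q d \<union> (\<Union>a\<in>arcs Q. {Inr a} \<times> {..<d (head Q a)})"

lemma finite_all_slots: "fin_digraph Q \<Longrightarrow> finite (all_slots Q d)"
  unfolding all_slots_def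
  by (simp add: fin_digraph.finite_vertex_slots fin_digraph.finite_arcs)

lemma indices_hom_families:
  assumes "fin_digraph Q" "y \<in> hom_families Q d P"
  shows "indices y \<subseteq> all_slots Q d"
proof -
  interpret fin_digraph Q by fact
  have "indices (lift Q d a * (adj (lift Q d a) * y)) \<subseteq> all_slots Q d" if a: "a \<in> arcs Q" for a
  proof -
    have "rel (arrow_slots Q d a) (adj (lift Q d a) * y)" using assms(2) a unfolding hom_families_def by blast
    then have "indices (adj (lift Q d a) * y) \<subseteq> all_slots Q d"
      using head_in_verts[OF a] tail_in_verts[OF a]
      unfolding rel_def indices_subset_entry all_slots_def vertex_slots_def by blast
    moreover have "indices (lift Q d a) \<subseteq> all_slots Q d"
      using a head_in_verts[OF a]
      by (auto simp: indices_subset_entry entry_lift all_slots_def vertex_slots_def slots_def mem_Times_iff split: if_splits)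
    ultimately show ?thesis by (rule indices_times_subset[rotated])
  qed
  then have "indices (\<Sum>a\<in>arcs Q. lift Q d a * (adj (lift Q d a) * y)) \<subseteq> all_slots Q d"
    by (rule indices_sum_subset)
  then show ?thesis using assms(2) unfolding hom_families_def by auto
qed

text \<open>For a subrepresentation given by \<open>P\<close>, \<open>coboundary_adjoint\<close> is the adjoint of the map
  \<open>linearized\<close> from the deformations of the subspaces to the obstruction space \<open>hom_families\<close>.\<close>

definition coboundary_adjoint where
  "coboundary_adjoint Q d m P y = (let c = (\<Sum>a\<in>arcs Q. adj (m a) * (adj (lift Q d a) * y)
      - adj (lift Q d a) * y * adj (m a)) in (c - P * c) * P)"

text \<open>The exact derivative of \<open>defect\<close> at \<open>g = 0\<close> in the direction
  \<open>u\<close>, whether or not \<open>P\<close> is stable.\<close>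

definition linearized where
  "linearized Q d m P u = (\<Sum>a\<in>arcs Q. lift Q d a * (m a * u - P * m a * u - u * m a * P))"

text \<open>If \<open>P * g = 0\<close> and \<open>g * P = g\<close>, then \<open>P + g\<close> is
  the idempotent that has the kernel of \<open>P\<close> and whose range is the graph of
  \<open>g\<close> over the range of \<open>P\<close>. Such \<open>g\<close> are the coordinates of
  the standard affine chart of the Grassmannian around \<open>P\<close>, and the defect measures the
  failure of this graph to be a subrepresentation.\<close>

definition defect where
  "defect Q d m P g = (\<Sum>a\<in>arcs Q. lift Q d a * (m a * (P + g) - (P + g) * m a * (P + g)))"

lemma coboundary_adjoint_diff:
  "coboundary_adjoint Q d m P (y - y') = coboundary_adjoint Q d m P y - coboundary_adjoint Q d m P y'"
proof -
  define c where "c y = (\<Sum>a\<in>arcs Q. adj (m a) * (adj (lift Q d a) * y) - adj (lift Q d a) * y * adj (m a))" for y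
  have "c (y - y') = c y - c y'" (is ?c)
    unfolding c_def sum_subtractf[symmetric] by (rule sum.cong) (simp_all add: algebra_simps)
  then show ?thesis
    unfolding coboundary_adjoint_def Let_def c_def[symmetric]
    by (simp only: \<open>?c\<close> right_diff_distrib left_diff_distrib) (simp add: algebra_simps)
qed

lemma coboundary_adjoint_scaleR:
  "coboundary_adjoint Q d m P (c *\<^sub>R y) = c *\<^sub>R coboundary_adjoint Q d m P y"
  unfolding coboundary_adjoint_def Let_def
  by (simp add: scaleR_right_diff_distrib[symmetric] scaleR_sum_right[symmetric])

lemma coboundary_adjoint_zero [simp]: "coboundary_adjoint Q d m P 0 = 0"
  unfolding coboundary_adjoint_def Let_def by simp

lemma mult_sandwich_idem:
  fixes P :: "'k::ring"
  assumes "P * P = P"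
  shows "P * ((c - P * c) * P) = 0" "(c - P * c) * P * P = (c - P * c) * P"
proof -
  have "P * (c - P * c) = 0" using assms by (simp add: right_diff_distrib flip: mult.assoc)
  then show "P * ((c - P * c) * P) = 0" by (metis mult.assoc mult_zero_left)
  show "(c - P * c) * P * P = (c - P * c) * P" using assms by (simp add: mult.assoc)
qed

text \<open>For Hermitian \<open>P\<close> the outer operations in \<open>coboundary_adjoint\<close>
  are the orthogonal projection onto matrices with these two properties; its values are thus
  admissible as \<open>g\<close>.\<close>

lemma coboundary_adjoint_P:
  assumes "P * P = P"
  shows "P * coboundary_adjoint Q d m P y = 0"
    "coboundary_adjoint Q d m P y * P = coboundary_adjoint Q d m P y"
  unfolding coboundary_adjoint_def Let_def by (rule mult_sandwich_idem[OF assms])+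

text \<open>Adjointness of the two maps, stated for every Hermitian idempotent since the iteration
  starts at projections that are only nearly stable. The term starting with \<open>P\<close> is
  orthogonal to \<open>w\<close>, and the compression from \<open>c\<close> to
  \<open>(c - P * c) * P\<close> is self-adjoint and fixes
  \<open>coboundary_adjoint Q d m P w\<close>.\<close>

lemma inner_linearized:
  assumes P: "P * P = P" "adj P = P" and w: "w \<in> hom_families Q d P"
  shows "inner (linearized Q d m P (coboundary_adjoint Q d m P w)) w
    = (norm (coboundary_adjoint Q d m P w))\<^sup>2"
proof -
  let ?u = "coboundary_adjoint Q d m P w"
  define W where "W a = adj (lift Q d a) * w" for a
  define c where "c = (\<Sum>a\<in>arcs Q. adj (m a) * W a - W a * adj (m a))"
  have W: "P * W a = 0" "W a * P = W a" if "a \<in> arcs Q" for a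
    using w that unfolding hom_families_def W_def by auto
  have u: "?u = (c - P * c) * P" unfolding coboundary_adjoint_def Let_def c_def W_def ..
  have uP: "P * ?u = 0" "?u * P = ?u" using coboundary_adjoint_P[OF P(1)] by blast+
  have "inner (linearized Q d m P ?u) w = (\<Sum>a\<in>arcs Q. inner (m a * ?u - P * m a * ?u - ?u * m a * P) (W a))"
    unfolding linearized_def inner_sum_left W_def by (simp add: inner_times_left)
  also have "\<dots> = (\<Sum>a\<in>arcs Q. inner ?u (adj (m a) * W a - W a * adj (m a)))"
  proof (rule sum.cong[OF refl])
    fix a assume a: "a \<in> arcs Q"
    have "inner (P * m a * ?u) (W a) = 0"
      using W(1)[OF a] P(2) by (simp add: inner_times_left mult.assoc)
    moreover have "inner (?u * m a * P) (W a) = inner ?u (W a * adj (m a))"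
      using W(2)[OF a] P(2) by (simp add: inner_times_right)
    moreover have "inner (m a * ?u) (W a) = inner ?u (adj (m a) * W a)" by (rule inner_times_left)
    ultimately show "inner (m a * ?u - P * m a * ?u - ?u * m a * P) (W a) =
        inner ?u (adj (m a) * W a - W a * adj (m a))"
      by (simp add: inner_diff_left inner_diff_right)
  qed
  also have "\<dots> = inner ?u c" unfolding c_def by (simp add: inner_sum_right)
  also have "\<dots> = inner ?u ?u"
  proof -
    have "inner ?u (P * c) = 0" using inner_times_left[of P ?u c] P(2) uP(1) inner_times_left[of P c ?u]
      by (simp add: inner_commute)
    then have "inner ?u c = inner (?u * P) (c - P * c)" using uP(2) by (simp add: inner_diff_right)
    also have "\<dots> = inner ?u ((c - P * c) * P)"
      using inner_times_right[of ?u P "c - P * c"] P(2) by simp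
    finally show ?thesis using u by simp
  qed
  finally show ?thesis by (simp add: power2_norm_eq_inner)
qed

lemma rel_coboundary_adjoint:
  assumes Q: "fin_digraph Q" and m: "\<And>a. a \<in> arcs Q \<Longrightarrow> rel (arrow_slots Q d a) (m a)"
    and P: "rel (diag_slots Q d) P" and y: "y \<in> hom_families Q d P"
  shows "rel (diag_slots Q d) (coboundary_adjoint Q d m P y)"
proof -
  interpret fin_digraph Q by (rule Q)
  have DD: "diag_slots Q d O diag_slots Q d \<subseteq> diag_slots Q d"
    unfolding diag_slots_def slots_def by auto
  define c where "c = (\<Sum>a\<in>arcs Q. adj (m a) * (adj (lift Q d a) * y) - adj (lift Q d a) * y * adj (m a))"
  have "rel (diag_slots Q d) c"
    unfolding c_def
  proof (intro rel_sum rel_minus)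
    fix a assume a: "a \<in> arcs Q"
    have y: "rel (arrow_slots Q d a) (adj (lift Q d a) * y)" using y a unfolding hom_families_def by blast
    have m': "rel (slots d (tail Q a) \<times> slots d (head Q a)) (adj (m a))"
      by (rule rel_adj[OF m[OF a]]) auto
    show "rel (diag_slots Q d) (adj (m a) * (adj (lift Q d a) * y))"
      by (rule rel_times[OF m' y]) (use tail_in_verts[OF a] in \<open>auto simp: diag_slots_def\<close>)
    show "rel (diag_slots Q d) (adj (lift Q d a) * y * adj (m a))"
      by (rule rel_times[OF y m']) (use head_in_verts[OF a] in \<open>auto simp: diag_slots_def\<close>)
  qed
  then show ?thesis
    unfolding coboundary_adjoint_def Let_def c_def[symmetric]
    by (intro rel_times[OF _ P DD] rel_minus rel_times[OF P _ DD])
qed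

text \<open>The identities \<open>P * (P + g) = P\<close> and \<open>(P + g) * P = P + g\<close> put
  the defect exactly into the linear space on which the adjoint will be bounded below, so the
  iteration never leaves it.\<close>

lemma defect_in_hom_families:
  assumes Q: "fin_digraph Q" and m: "\<And>a. a \<in> arcs Q \<Longrightarrow> rel (arrow_slots Q d a) (m a)"
    and P: "rel (diag_slots Q d) P" "P * P = P"
    and g: "rel (diag_slots Q d) g" "P * g = 0" "g * P = g"
  shows "defect Q d m P g \<in> hom_families Q d P"
  unfolding defect_def
proof (rule hom_familiesI)
  interpret fin_digraph Q by (rule Q)
  show "finite (arcs Q)" by (rule finite_arcs)
  fix a assume a: "a \<in> arcs Q"
  have AD: "arrow_slots Q d a O diag_slots Q d \<subseteq> arrow_slots Q d a"
    "diag_slots Q d O arrow_slots Q d a \<subseteq> arrow_slots Q d a"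
    unfolding diag_slots_def slots_def by auto
  have r: "rel (arrow_slots Q d a) (m a * (P + g) - (P + g) * m a * (P + g))"
    by (intro rel_minus rel_times[OF _ _ AD(1)] rel_times[OF _ _ AD(2)] m[OF a] rel_plus P g)
  have PG: "P * (P + g) = P" "(P + g) * P = P + g" using P(2) g by (simp_all add: distrib_left distrib_right)
  have "P * (m a * (P + g) - (P + g) * m a * (P + g)) = P * m a * (P + g) - P * (P + g) * m a * (P + g)"
    by (simp add: right_diff_distrib mult.assoc)
  then have "P * (m a * (P + g) - (P + g) * m a * (P + g)) = 0" unfolding PG by simp
  moreover have "(m a * (P + g) - (P + g) * m a * (P + g)) * P = m a * (P + g) - (P + g) * m a * (P + g)"
    by (simp only: left_diff_distrib mult.assoc PG)
  ultimately show "rel (arrow_slots Q d a) (m a * (P + g) - (P + g) * m a * (P + g)) \<and>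
      P * (m a * (P + g) - (P + g) * m a * (P + g)) = 0 \<and>
      (m a * (P + g) - (P + g) * m a * (P + g)) * P = m a * (P + g) - (P + g) * m a * (P + g)"
    using r by blast
qed

lemma defect_eq_0_iff:
  assumes Q: "fin_digraph Q" and m: "\<And>a. a \<in> arcs Q \<Longrightarrow> rel (arrow_slots Q d a) (m a)"
    and "rel (diag_slots Q d) P" "rel (diag_slots Q d) g"
  shows "defect Q d m P g = 0 \<longleftrightarrow> stable Q m (P + g)"
proof
  interpret fin_digraph Q by (rule Q)
  have r: "rel (arrow_slots Q d a) (m a * (P + g) - (P + g) * m a * (P + g))" if a: "a \<in> arcs Q" for a
  proof -
    have AD: "arrow_slots Q d a O diag_slots Q d \<subseteq> arrow_slots Q d a"
      "diag_slots Q d O arrow_slots Q d a \<subseteq> arrow_slots Q d a"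
      unfolding diag_slots_def slots_def by auto
    show ?thesis
      by (intro rel_minus rel_times[OF _ _ AD(1)] rel_times[OF _ _ AD(2)] m[OF a] rel_plus assms)
  qed
  show "stable Q m (P + g)" if "defect Q d m P g = 0"
    unfolding stable_def
  proof
    fix a assume a: "a \<in> arcs Q"
    have "m a * (P + g) - (P + g) * m a * (P + g) = adj (lift Q d a) * defect Q d m P g"
      unfolding defect_def by (rule adj_lift_sum[symmetric]) (use r a in auto)
    then show "m a * (P + g) = (P + g) * m a * (P + g)" using that by simp
  qed
  show "defect Q d m P g = 0" if "stable Q m (P + g)"
    using that unfolding stable_def defect_def by simp
qed

text \<open>Up to conjugate transposition, an element of the kernel of the adjoint is a family
  pairing to zero with all coboundaries, that is, an element of the dual of the extension space; it
  serves as the \<open>l\<close> of \<open>obstructed\<close>.\<close>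

lemma coboundary_adjoint_injective:
  assumes Q: "fin_digraph Q" and m: "\<And>a. a \<in> arcs Q \<Longrightarrow> rel (arrow_slots Q d a) (m a)"
    and unobs: "\<not> obstructed Q d m" and P: "P \<in> projections Q d" "stable Q m P"
    and y: "y \<in> hom_families Q d P" and 0: "coboundary_adjoint Q d m P y = 0"
  shows "y = 0"
proof -
  define l where "l a = adj (adj (lift Q d a) * y)" for a
  define c where "c = (\<Sum>a\<in>arcs Q. adj (m a) * (adj (lift Q d a) * y) - adj (lift Q d a) * y * adj (m a))"
  have P': "P * P = P" "adj P = P" "rel (diag_slots Q d) P" using P(1) unfolding projections_def by auto
  have y': "rel (arrow_slots Q d a) (adj (lift Q d a) * y)" "P * (adj (lift Q d a) * y) = 0"
    "adj (lift Q d a) * y * P = adj (lift Q d a) * y" if "a \<in> arcs Q" for a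
    using y that unfolding hom_families_def by auto
  have l: "l a * P = 0" "P * l a = l a" "rel (slots d (tail Q a) \<times> slots d (head Q a)) (l a)"
    if a: "a \<in> arcs Q" for a
  proof -
    show "l a * P = 0" using arg_cong[OF y'(2)[OF a], of adj] P'(2) by (simp add: adj_times[of P] l_def)
    show "P * l a = l a" using arg_cong[OF y'(3)[OF a], of adj] P'(2) by (simp add: adj_times[of _ P] l_def)
    show "rel (slots d (tail Q a) \<times> slots d (head Q a)) (l a)"
      unfolding l_def by (rule rel_adj[OF y'(1)[OF a]]) auto
  qed
  have C: "(\<Sum>a\<in>arcs Q. l a * m a - m a * l a) = adj c"
    unfolding c_def l_def by (simp add: adj_sum adj_minus adj_times mult.assoc)
  \<comment> \<open>Stability of \<open>P\<close> makes the correction \<open>P * c\<close> vanish,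
    so the hypothesis on \<open>y\<close> becomes \<open>c * P = 0\<close>, the conjugate transpose
    of the commutator condition in \<open>obstructed\<close>.\<close>
  have "adj c * P = (\<Sum>a\<in>arcs Q. l a * m a * P - m a * (l a * P))"
    unfolding C[symmetric] by (simp add: sum_distrib_right left_diff_distrib mult.assoc)
  also have "\<dots> = 0"
  proof (rule sum.neutral, rule ballI)
    fix a assume a: "a \<in> arcs Q"
    have "l a * m a * P = l a * P * m a * P" using P(2) a unfolding stable_def by (simp add: mult.assoc)
    then show "l a * m a * P - m a * (l a * P) = 0" using l(1)[OF a] by simp
  qed
  finally have "adj (adj c * P) = adj 0" by (rule arg_cong)
  then have "P * c = 0" using P'(2) by (simp add: adj_times)
  then have "c * P = 0" using 0 unfolding coboundary_adjoint_def Let_def c_def[symmetric] by simp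
  then have "adj (c * P) = adj 0" by (rule arg_cong)
  then have "P * adj c = 0" using P'(2) by (simp add: adj_times)
  then have PC: "P * (\<Sum>a\<in>arcs Q. l a * m a - m a * l a) = 0" using C by simp
  have "indices P \<subseteq> vertex_slots Q d"
    using P'(3) unfolding rel_def indices_subset_entry diag_slots_def vertex_slots_def by blast
  then have "obstructed Q d m" if "\<exists>a\<in>arcs Q. l a \<noteq> 0"
    unfolding obstructed_def
    by (intro exI[of _ P] exI[of _ l] conjI ballI P'(1) PC that P(2)[unfolded stable_def, rule_format]
        l(2)[symmetric] l(1,3))
  then have "\<forall>a\<in>arcs Q. l a = 0" using unobs by blast
  then have "\<forall>a\<in>arcs Q. adj (lift Q d a) * y = 0" unfolding l_def by (metis adj_adj adj_zero)
  then have "(\<Sum>a\<in>arcs Q. lift Q d a * (adj (lift Q d a) * y)) = 0" by simp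
  then show ?thesis using y unfolding hom_families_def by simp
qed

text \<open>Compactness of the set of unit vectors over all projections turns injectivity into a
  bound. Injectivity is known at stable \<open>P\<close> only; minimizing the sum with the norm of
  the defect covers almost stable \<open>P\<close>, where at least half of the minimum is left for
  the adjoint.\<close>

lemma coboundary_adjoint_lower_bound:
  assumes Q: "fin_digraph Q" and m: "\<And>a. a \<in> arcs Q \<Longrightarrow> rel (arrow_slots Q d a) (m a)"
    and unobs: "\<not> obstructed Q d m"
  obtains \<nu> where "\<nu> > 0" "\<And>P y. P \<in> projections Q d \<Longrightarrow> norm (defect Q d m P 0) \<le> \<nu> \<Longrightarrow>
    y \<in> hom_families Q d P \<Longrightarrow> \<nu> * norm y \<le> norm (coboundary_adjoint Q d m P y)"
proof -
  define K where "K = (projections Q d \<times> {y. indices y \<subseteq> all_slots Q d \<and> norm y \<le> 1}) \<inter>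
    ({q. snd q \<in> hom_families Q d (fst q)} \<inter> {q. norm (snd q) = 1})"
  define h where "h q = norm (defect Q d m (fst q) 0) + norm (coboundary_adjoint Q d m (fst q) (snd q))" for q
  have "compact K" unfolding K_def
    by (intro compact_Int_closed compact_Times compact_projections[OF Q] compact_fmat_ball[OF finite_all_slots[OF Q]]
        closed_Int closed_hom_families_pairs closed_Collect_eq continuous_intros)
  have unit: "(P, y) \<in> K" if "P \<in> projections Q d" "y \<in> hom_families Q d P" "norm y = 1" for P y
    using that indices_hom_families[OF Q that(2)] unfolding K_def by auto
  have pos: "h q > 0" if "q \<in> K" for q
  proof (rule ccontr)
    assume "\<not> h q > 0"
    then have 0: "defect Q d m (fst q) 0 = 0" "coboundary_adjoint Q d m (fst q) (snd q) = 0"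
      unfolding h_def by (smt (verit) norm_ge_zero norm_eq_zero)+
    have q: "fst q \<in> projections Q d" "snd q \<in> hom_families Q d (fst q)" "norm (snd q) = 1"
      using that unfolding K_def by auto
    have "stable Q m (fst q)"
      using defect_eq_0_iff[OF Q m, of "fst q" 0] 0(1) q(1) unfolding projections_def by simp
    then show False using coboundary_adjoint_injective[OF Q m unobs q(1) _ q(2) 0(2)] q(3) by simp
  qed
  obtain \<mu> where \<mu>: "\<mu> > 0" "\<And>q. q \<in> K \<Longrightarrow> \<mu> \<le> h q"
  proof (cases "K = {}")
    case True then show ?thesis using that[of 1] by simp
  next
    case False
    have "continuous_on K h"
      unfolding h_def defect_def coboundary_adjoint_def Let_def by (intro continuous_intros)
    then obtain q where "q \<in> K" "\<forall>q'\<in>K. h q \<le> h q'"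
      using continuous_attains_inf[OF \<open>compact K\<close> False] by blast
    then show ?thesis using that[of "h q"] pos by blast
  qed
  show ?thesis
  proof (rule that[of "\<mu> / 2"])
    show "\<mu> / 2 > 0" using \<mu>(1) by simp
    fix P y assume P: "P \<in> projections Q d" "norm (defect Q d m P 0) \<le> \<mu> / 2" and y: "y \<in> hom_families Q d P"
    show "\<mu> / 2 * norm y \<le> norm (coboundary_adjoint Q d m P y)"
    proof (cases "y = 0")
      case False
      define y1 where "y1 = (1 / norm y) *\<^sub>R y"
      have "(P, y1) \<in> K"
        unfolding y1_def by (rule unit) (use P y False in \<open>auto intro: hom_families_scaleR\<close>)
      then have "\<mu> / 2 \<le> norm (coboundary_adjoint Q d m P y1)" using \<mu>(2) P(2) unfolding h_def by fastforce
      also have "\<dots> = norm (coboundary_adjoint Q d m P y) / norm y"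
        unfolding y1_def coboundary_adjoint_scaleR by simp
      finally show ?thesis using False by (simp add: pos_le_divide_eq)
    qed simp
  qed
qed

section \<open>Norm estimates for the iteration\<close>

lemma norm_times_le: "norm X \<le> a \<Longrightarrow> norm Y \<le> b \<Longrightarrow> norm (X * Y) \<le> a * b"
  for X Y :: "'x::real_normed_algebra"
  using mult_mono[of "norm X" a "norm Y" b] norm_mult_ineq[of X Y] order_trans[OF norm_ge_zero, of X a]
  by simp

lemma norm_coboundary_adjoint_le:
  assumes "norm P \<le> \<beta>"
  shows "norm (coboundary_adjoint Q d m P y) \<le>
    (1 + \<beta>) * \<beta> * (\<Sum>a\<in>arcs Q. 2 * norm (m a) * norm (lift Q d a)) * norm y"
proof -
  define c where "c = (\<Sum>a\<in>arcs Q. adj (m a) * (adj (lift Q d a) * y) - adj (lift Q d a) * y * adj (m a))"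
  define s where "s = (\<Sum>a\<in>arcs Q. 2 * norm (m a) * norm (lift Q d a)) * norm y"
  have c: "norm c \<le> s"
    unfolding c_def s_def sum_distrib_right
  proof (rule sum_norm_le)
    fix a
    have "norm (adj (m a) * (adj (lift Q d a) * y)) \<le> norm (m a) * (norm (lift Q d a) * norm y)"
      "norm (adj (lift Q d a) * y * adj (m a)) \<le> norm (lift Q d a) * norm y * norm (m a)"
      by (intro norm_times_le; simp)+
    then show "norm (adj (m a) * (adj (lift Q d a) * y) - adj (lift Q d a) * y * adj (m a)) \<le>
        2 * norm (m a) * norm (lift Q d a) * norm y"
      by (intro order_trans[OF norm_triangle_ineq4]) (simp add: algebra_simps)
  qed
  have "norm (c - P * c) \<le> s + \<beta> * s"
    by (intro order_trans[OF norm_triangle_ineq4] add_mono norm_times_le c assms)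
  then have "norm ((c - P * c) * P) \<le> (s + \<beta> * s) * \<beta>" by (rule norm_times_le[OF _ assms])
  then show ?thesis
    unfolding coboundary_adjoint_def Let_def c_def[symmetric] by (simp add: s_def algebra_simps)
qed

lemma norm_linearized_le:
  assumes "norm P \<le> \<beta>"
  shows "norm (linearized Q d m P u) \<le>
    (\<Sum>a\<in>arcs Q. norm (lift Q d a) * ((1 + 2 * \<beta>) * norm (m a))) * norm u"
  unfolding linearized_def sum_distrib_right
proof (rule sum_norm_le)
  fix a
  have "norm (m a * u - P * m a * u - u * m a * P) \<le>
      norm (m a) * norm u + \<beta> * norm (m a) * norm u + norm u * norm (m a) * \<beta>"
    by (intro order_trans[OF norm_triangle_ineq4] add_mono norm_times_le assms order_refl)
  then have "norm (lift Q d a * (m a * u - P * m a * u - u * m a * P)) \<le>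
      norm (lift Q d a) * (norm (m a) * norm u + \<beta> * norm (m a) * norm u + norm u * norm (m a) * \<beta>)"
    by (intro norm_times_le order_refl)
  then show "norm (lift Q d a * (m a * u - P * m a * u - u * m a * P)) \<le>
      norm (lift Q d a) * ((1 + 2 * \<beta>) * norm (m a)) * norm u"
    by (simp add: algebra_simps)
qed

text \<open>The error of using the derivative at \<open>g = 0\<close> and at \<open>m0\<close>
  throughout. Besides \<open>g - g'\<close>, every term on the right contains one of the small
  factors \<open>m - m0\<close>, \<open>g\<close> and \<open>g'\<close>.\<close>

lemma chord_identity:
  fixes P :: "'x::ring"
  shows "m * (P + g) - (P + g) * m * (P + g) - (m * (P + g') - (P + g') * m * (P + g')) -
      (m0 * (g - g') - P * m0 * (g - g') - (g - g') * m0 * P) =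
    (m - m0) * (g - g') - P * (m - m0) * (g - g') - (g - g') * (m - m0) * P
      - (g * m * (g - g') + (g - g') * m * g')"
  by (simp add: distrib_left distrib_right left_diff_distrib right_diff_distrib mult.assoc)

lemma sum_scale_both: "(\<Sum>a\<in>A. c * f a * r) = c * (\<Sum>a\<in>A. f a) * (r::real)"
  by (simp only: sum_distrib_left[symmetric] sum_distrib_right[symmetric])

lemma defect_linearization_error:
  assumes P: "norm P \<le> \<beta>" and dm: "\<And>a. a \<in> arcs Q \<Longrightarrow> norm (m a - m0 a) \<le> \<tau>" and \<tau>: "\<tau> \<le> 1"
    and g: "norm g \<le> \<tau>" "norm g' \<le> \<tau>"
  shows "norm (defect Q d m P g - defect Q d m P g' - linearized Q d m0 P (g - g')) \<le>
    \<tau> * (\<Sum>a\<in>arcs Q. norm (lift Q d a) * ((1 + 2 * \<beta>) + 2 * (norm (m0 a) + 1))) * norm (g - g')"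
proof -
  define u where "u = g - g'"
  have eq: "defect Q d m P g - defect Q d m P g' - linearized Q d m0 P u = (\<Sum>a\<in>arcs Q. lift Q d a *
      ((m a - m0 a) * u - P * (m a - m0 a) * u - u * (m a - m0 a) * P - (g * m a * u + u * m a * g')))"
    unfolding defect_def linearized_def sum_subtractf[symmetric] right_diff_distrib[symmetric] u_def
    by (intro sum.cong[OF refl] arg_cong[of _ _ "(*) _"] chord_identity)
  have "norm (defect Q d m P g - defect Q d m P g' - linearized Q d m0 P u) \<le>
      (\<Sum>a\<in>arcs Q. \<tau> * (norm (lift Q d a) * ((1 + 2 * \<beta>) + 2 * (norm (m0 a) + 1))) * norm u)"
    unfolding eq
  proof (rule sum_norm_le)
    fix a assume a: "a \<in> arcs Q"
    define D where "D = m a - m0 a"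
    have D: "norm D \<le> \<tau>" unfolding D_def by (rule dm[OF a])
    have "norm (m a) \<le> norm (m0 a) + norm D" unfolding D_def by (rule norm_triangle_sub)
    then have ma: "norm (m a) \<le> norm (m0 a) + 1" using D \<tau> by linarith
    have "norm (D * u - P * D * u - u * D * P - (g * m a * u + u * m a * g')) \<le>
        \<tau> * norm u + \<beta> * \<tau> * norm u + norm u * \<tau> * \<beta> +
        (\<tau> * (norm (m0 a) + 1) * norm u + norm u * (norm (m0 a) + 1) * \<tau>)"
      by (intro order_trans[OF norm_triangle_ineq4] order_trans[OF norm_triangle_ineq] add_mono
          norm_times_le P D g ma order_refl)
    also have "\<dots> = \<tau> * ((1 + 2 * \<beta>) + 2 * (norm (m0 a) + 1)) * norm u"
      by (simp add: algebra_simps)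
    finally have "norm (lift Q d a * (D * u - P * D * u - u * D * P - (g * m a * u + u * m a * g'))) \<le>
        norm (lift Q d a) * (\<tau> * ((1 + 2 * \<beta>) + 2 * (norm (m0 a) + 1)) * norm u)"
      by (intro norm_times_le order_refl)
    also have "\<dots> = \<tau> * (norm (lift Q d a) * ((1 + 2 * \<beta>) + 2 * (norm (m0 a) + 1))) * norm u"
      by (simp only: ac_simps)
    finally show "norm (lift Q d a * ((m a - m0 a) * u - P * (m a - m0 a) * u - u * (m a - m0 a) * P
          - (g * m a * u + u * m a * g'))) \<le>
        \<tau> * (norm (lift Q d a) * ((1 + 2 * \<beta>) + 2 * (norm (m0 a) + 1))) * norm u"
      unfolding D_def .
  qed
  then show ?thesis unfolding u_def sum_scale_both .
qed

lemma norm_defect_diff_le: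
  assumes P: "norm P \<le> \<beta>" and dm: "\<And>a. a \<in> arcs Q \<Longrightarrow> norm (m a - m0 a) \<le> \<tau>"
  shows "norm (defect Q d m P 0 - defect Q d m0 P 0) \<le>
    \<tau> * (\<Sum>a\<in>arcs Q. norm (lift Q d a) * (\<beta> + \<beta> * \<beta>))"
proof -
  have eq: "defect Q d m P 0 - defect Q d m0 P 0 =
      (\<Sum>a\<in>arcs Q. lift Q d a * ((m a - m0 a) * P - P * (m a - m0 a) * P))"
    unfolding defect_def sum_subtractf[symmetric] right_diff_distrib[symmetric]
    by (intro sum.cong[OF refl] arg_cong[of _ _ "(*) _"])
      (simp add: left_diff_distrib right_diff_distrib mult.assoc)
  have "norm (defect Q d m P 0 - defect Q d m0 P 0) \<le> (\<Sum>a\<in>arcs Q. \<tau> * (norm (lift Q d a) * (\<beta> + \<beta> * \<beta>)) * 1)"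
    unfolding eq
  proof (rule sum_norm_le)
    fix a assume a: "a \<in> arcs Q"
    have "norm ((m a - m0 a) * P) \<le> \<tau> * \<beta>" "norm (P * (m a - m0 a) * P) \<le> \<beta> * \<tau> * \<beta>"
      by (rule norm_times_le dm[OF a] P)+
    then have "norm ((m a - m0 a) * P - P * (m a - m0 a) * P) \<le> \<tau> * \<beta> + \<beta> * \<tau> * \<beta>"
      by (intro order_trans[OF norm_triangle_ineq4] add_mono)
    then have "norm (lift Q d a * ((m a - m0 a) * P - P * (m a - m0 a) * P)) \<le>
        norm (lift Q d a) * (\<tau> * \<beta> + \<beta> * \<tau> * \<beta>)"
      by (rule norm_times_le[OF order_refl])
    moreover have "norm (lift Q d a) * (\<tau> * \<beta> + \<beta> * \<tau> * \<beta>) = \<tau> * (norm (lift Q d a) * (\<beta> + \<beta> * \<beta>)) * 1"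
      by (simp add: algebra_simps)
    ultimately show "norm (lift Q d a * ((m a - m0 a) * P - P * (m a - m0 a) * P)) \<le>
        \<tau> * (norm (lift Q d a) * (\<beta> + \<beta> * \<beta>)) * 1" by (simp only:)
  qed
  then show ?thesis unfolding mult_1_right sum_distrib_left .
qed

text \<open>For each almost stable \<open>P\<close> and each \<open>z\<close> near \<open>z0\<close>
  the defect equation is solved by \<open>g = A P y\<close>, where \<open>y\<close> is the fixed
  point of a contraction started at 0. If \<open>P\<close> is already stable for \<open>m z\<close>,
  then 0 is the fixed point and \<open>g\<close> vanishes.\<close>

lemma local_deformation:
  fixes m :: "'z::metric_space \<Rightarrow> 'a \<Rightarrow> (('v + 'a) \<times> nat, complex) fmat" and Q :: "('v, 'a) pre_digraph"
  assumes Q: "fin_digraph Q"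
    and cont: "\<And>a. a \<in> arcs Q \<Longrightarrow> continuous_on UNIV (\<lambda>z. m z a)"
    and m: "\<And>z a. a \<in> arcs Q \<Longrightarrow> rel (arrow_slots Q d a) (m z a)"
    and unobs: "\<not> obstructed Q d (m z0)"
  obtains r N g where "r > 0" "N \<subseteq> projections Q d"
    "\<And>z P. z \<in> ball z0 r \<Longrightarrow> P \<in> projections Q d \<Longrightarrow> stable Q (m z) P \<Longrightarrow> P \<in> N"
    "continuous_on (ball z0 r \<times> N) (\<lambda>q. g (fst q) (snd q))"
    "\<And>z P. z \<in> ball z0 r \<Longrightarrow> P \<in> N \<Longrightarrow> rel (diag_slots Q d) (g z P) \<and> P * g z P = 0 \<and> g z P * P = g z P \<and>
      stable Q (m z) (P + g z P)"
    "\<And>z P. z \<in> ball z0 r \<Longrightarrow> P \<in> N \<Longrightarrow> stable Q (m z) P \<Longrightarrow> g z P = 0"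
proof -
  interpret fin_digraph Q by (rule Q)
  define A where "A = coboundary_adjoint Q d (m z0)"
  define L where "L = linearized Q d (m z0)"
  define \<Phi> where "\<Phi> z = defect Q d (m z)" for z
  have proj: "P * P = P" "adj P = P" "rel (diag_slots Q d) P" if "P \<in> projections Q d" for P
    using that unfolding projections_def by auto
  have relA: "rel (diag_slots Q d) (A P y)" if "P \<in> projections Q d" "y \<in> hom_families Q d P" for P y
    unfolding A_def by (rule rel_coboundary_adjoint[OF Q m proj(3)[OF that(1)] that(2)])
  obtain b where b: "\<And>P. P \<in> projections Q d \<Longrightarrow> norm P \<le> b"
    using compact_imp_bounded[OF compact_projections[OF Q, of d]] unfolding bounded_iff by blast
  define \<beta> where "\<beta> = max b 0"
  have \<beta>: "norm P \<le> \<beta>" if "P \<in> projections Q d" for P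
    using b[OF that] unfolding \<beta>_def by auto
  have \<beta>0: "\<beta> \<ge> 0" unfolding \<beta>_def by simp
  obtain \<nu> where \<nu>: "\<nu> > 0" "\<And>P y. P \<in> projections Q d \<Longrightarrow> norm (\<Phi> z0 P 0) \<le> \<nu> \<Longrightarrow>
    y \<in> hom_families Q d P \<Longrightarrow> \<nu> * norm y \<le> norm (A P y)"
  proof (rule coboundary_adjoint_lower_bound[OF Q m unobs])
    fix \<nu> assume "\<nu> > 0" "\<And>P y. P \<in> projections Q d \<Longrightarrow> norm (defect Q d (m z0) P 0) \<le> \<nu> \<Longrightarrow>
      y \<in> hom_families Q d P \<Longrightarrow> \<nu> * norm y \<le> norm (coboundary_adjoint Q d (m z0) P y)"
    from that[OF this(1), unfolded A_def \<Phi>_def, OF this(2)] show thesis .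
  qed
  define C1 where "C1 = (1 + \<beta>) * \<beta> * (\<Sum>a\<in>arcs Q. 2 * norm (m z0 a) * norm (lift Q d a))"
  define C2 where "C2 = (\<Sum>a\<in>arcs Q. norm (lift Q d a) * ((1 + 2 * \<beta>) * norm (m z0 a)))"
  \<comment> \<open>A common bound for the norms of \<open>A P\<close> and \<open>L P\<close>; being
    larger than \<open>\<nu>\<close>, it makes the radicand in \<open>\<kappa>0\<close> below
    positive.\<close>
  define C where "C = C1 + C2 + \<nu> + 1"
  have C12: "C1 \<ge> 0" "C2 \<ge> 0" unfolding C1_def C2_def using \<beta>0 by (auto intro!: mult_nonneg_nonneg sum_nonneg)
  have C: "C \<ge> 1" "C1 \<le> C" "C2 \<le> C" "\<nu> < C" using C12 \<nu>(1) unfolding C_def by auto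
  have A_le: "norm (A P y) \<le> C * norm y" if "P \<in> projections Q d" for P y
    using norm_coboundary_adjoint_le[OF \<beta>[OF that], of Q d "m z0" y] mult_right_mono[OF C(2), of "norm y"]
    unfolding A_def C1_def by simp
  have L_le: "norm (L P u) \<le> C * norm u" if "P \<in> projections Q d" for P u
    using norm_linearized_le[OF \<beta>[OF that], of Q d "m z0" u] mult_right_mono[OF C(3), of "norm u"]
    unfolding L_def C2_def by simp
  define \<eta> where "\<eta> = 1 / C\<^sup>2"
  have \<eta>: "\<eta> > 0" "\<eta> * C\<^sup>2 \<le> 1" using C(1) unfolding \<eta>_def by auto
  define \<kappa>0 where "\<kappa>0 = sqrt (1 - \<eta> * \<nu>\<^sup>2)"
  have "\<eta> * \<nu>\<^sup>2 < 1"
    using C \<nu>(1) power_strict_mono[OF C(4), of 2] unfolding \<eta>_def by (simp add: divide_simps)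
  then have \<kappa>0: "0 \<le> \<kappa>0" "\<kappa>0 < 1" "\<kappa>0\<^sup>2 = 1 - \<eta> * \<nu>\<^sup>2"
    using \<eta>(1) \<nu>(1) unfolding \<kappa>0_def by (auto simp: real_sqrt_lt_1_iff)
  \<comment> \<open>Half of the gap between the factor \<open>\<kappa>0\<close> of the linear part
    and 1 is granted to the linearization error.\<close>
  define \<kappa> where "\<kappa> = (1 + \<kappa>0) / 2"
  have \<kappa>: "0 \<le> \<kappa>" "\<kappa> < 1" using \<kappa>0 unfolding \<kappa>_def by auto
  define E where "E = (\<Sum>a\<in>arcs Q. norm (lift Q d a) * ((1 + 2 * \<beta>) + 2 * (norm (m z0 a) + 1)))"
  have E: "E \<ge> 0" unfolding E_def using \<beta>0 by (auto intro!: sum_nonneg mult_nonneg_nonneg add_nonneg_nonneg)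
  \<comment> \<open>This will bound both \<open>m z - m z0\<close> and \<open>g\<close>, so that the
    linearization error, which has Lipschitz constant \<open>\<eta> * (\<tau> * E * C)\<close> in
    \<open>y\<close>, fits into that half. The summand 1 keeps the denominator positive.\<close>
  define \<tau> where "\<tau> = min 1 ((1 - \<kappa>0) / 2 / (\<eta> * C * E + 1))"
  have den: "\<eta> * C * E + 1 > 0" using \<eta> C E by (intro add_nonneg_pos mult_nonneg_nonneg) auto
  have \<tau>: "\<tau> > 0" "\<tau> \<le> 1" "\<eta> * (\<tau> * E * C) \<le> (1 - \<kappa>0) / 2"
  proof -
    show "\<tau> > 0" "\<tau> \<le> 1" using \<kappa>0 den unfolding \<tau>_def by auto
    have "\<tau> \<le> (1 - \<kappa>0) / 2 / (\<eta> * C * E + 1)" unfolding \<tau>_def by simp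
    then have "\<tau> * (\<eta> * C * E + 1) \<le> (1 - \<kappa>0) / 2" unfolding pos_le_divide_eq[OF den] .
    then show "\<eta> * (\<tau> * E * C) \<le> (1 - \<kappa>0) / 2" using \<open>\<tau> > 0\<close> by (simp add: algebra_simps)
  qed
  \<comment> \<open>The radius for \<open>y\<close> that keeps \<open>A P y\<close> within
    \<open>\<tau>\<close>.\<close>
  define \<delta> where "\<delta> = \<tau> / C"
  have \<delta>: "\<delta> > 0" "C * \<delta> = \<tau>" using \<tau>(1) C(1) unfolding \<delta>_def by auto
  \<comment> \<open>Bound for the initial defect. The first argument makes the lower bound with
    \<open>\<nu>\<close> available; the second keeps the first step within
    \<open>(1 - \<kappa>) * \<delta>\<close>, so that the ball of radius \<open>\<delta>\<close> is
    mapped into itself. The 2 accounts for the defect at \<open>z0\<close> and its change from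
    \<open>z0\<close> to \<open>z\<close>.\<close>
  define \<theta> where "\<theta> = min \<nu> ((1 - \<kappa>) * \<delta> / (2 * \<eta>))"
  have \<theta>: "\<theta> > 0" "\<theta> \<le> \<nu>" "\<eta> * (2 * \<theta>) \<le> (1 - \<kappa>) * \<delta>"
  proof -
    show "\<theta> > 0" "\<theta> \<le> \<nu>" using \<nu>(1) \<kappa>(2) \<delta>(1) \<eta>(1) unfolding \<theta>_def by auto
    have "\<theta> \<le> (1 - \<kappa>) * \<delta> / (2 * \<eta>)" unfolding \<theta>_def by simp
    then show "\<eta> * (2 * \<theta>) \<le> (1 - \<kappa>) * \<delta>" using \<eta>(1) by (simp add: pos_le_divide_eq algebra_simps)
  qed
  define F where "F = (\<Sum>a\<in>arcs Q. norm (lift Q d a) * (\<beta> + \<beta> * \<beta>))"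
  have F: "F \<ge> 0" unfolding F_def using \<beta>0 by (auto intro!: sum_nonneg mult_nonneg_nonneg add_nonneg_nonneg)
  define h where "h z = (\<Sum>a\<in>arcs Q. norm (m z a - m z0 a))" for z
  have "continuous_on UNIV h" unfolding h_def by (intro continuous_intros cont)
  then have "isCont h z0" by (simp add: continuous_on_eq_continuous_at)
  moreover have "h z0 = 0" by (simp add: h_def)
  ultimately have "(h \<longlongrightarrow> 0) (at z0)" by (simp add: isCont_def)
  moreover have pos: "min \<tau> (\<theta> / (F + 1)) > 0" using \<tau>(1) \<theta>(1) F by simp
  ultimately have "\<forall>\<^sub>F z in at z0. h z < min \<tau> (\<theta> / (F + 1))" by (rule order_tendstoD(2))
  then obtain r where r0: "r > 0" "\<And>z. z \<noteq> z0 \<Longrightarrow> dist z z0 < r \<Longrightarrow> h z < min \<tau> (\<theta> / (F + 1))"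
    unfolding eventually_at by auto
  have r: "r > 0" "h z < min \<tau> (\<theta> / (F + 1))" if "z \<in> ball z0 r" for z
    using r0 that pos \<open>h z0 = 0\<close> by (cases "z = z0", auto simp: dist_commute)+
  have dm: "norm (m z a - m z0 a) \<le> h z" if "a \<in> arcs Q" for z a
    unfolding h_def by (rule member_le_sum) (use that in auto)
  have near: "norm (m z a - m z0 a) \<le> \<tau>" if "z \<in> ball z0 r" "a \<in> arcs Q" for z a
    using dm[OF that(2), of z] r(2)[OF that(1)] by linarith
  have d0: "norm (\<Phi> z P 0 - \<Phi> z0 P 0) \<le> \<theta>" if "z \<in> ball z0 r" "P \<in> projections Q d" for z P
  proof -
    have "norm (\<Phi> z P 0 - \<Phi> z0 P 0) \<le> h z * F"
      unfolding \<Phi>_def F_def by (rule norm_defect_diff_le[OF \<beta>[OF that(2)] dm])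
    also have "\<dots> \<le> \<theta> / (F + 1) * F" using r(2)[OF that(1)] F by (intro mult_right_mono) auto
    also have "\<dots> \<le> \<theta>" using F \<theta>(1) by (simp add: divide_simps)
    finally show ?thesis .
  qed
  \<comment> \<open>Almost stable for \<open>z0\<close>, a condition independent of
    \<open>z\<close>; by \<open>d0\<close> every projection stable for some \<open>z\<close> in the
    ball satisfies it. This common domain later permits \<open>z\<close> to vary along a
    path.\<close>
  define N where "N = {P \<in> projections Q d. norm (\<Phi> z0 P 0) \<le> \<theta>}"
  define S where "S = ball z0 r \<times> N"
  define K where "K = {y :: (('v + 'a) \<times> nat, complex) fmat. indices y \<subseteq> all_slots Q d \<and> norm y \<le> \<delta>}"
  define T where "T q y = y - \<eta> *\<^sub>R \<Phi> (fst q) (snd q) (A (snd q) y)" for q y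
  have contr: "norm (T q y - T q y') \<le> \<kappa> * norm (y - y')"
    if q: "q \<in> S" and y: "y \<in> hom_families Q d (snd q)" "norm y \<le> \<delta>"
      and y': "y' \<in> hom_families Q d (snd q)" "norm y' \<le> \<delta>" for q y y'
  proof -
    obtain z P where zP: "q = (z, P)" "z \<in> ball z0 r" "P \<in> projections Q d" "norm (\<Phi> z0 P 0) \<le> \<nu>"
    proof (cases q)
      case (Pair z P)
      then have "z \<in> ball z0 r" "P \<in> projections Q d" "norm (\<Phi> z0 P 0) \<le> \<theta>"
        using q by (simp_all add: S_def N_def)
      then show ?thesis using that[OF Pair] \<theta>(2) by (meson order_trans)
    qed
    define w where "w = y - y'"
    have w: "w \<in> hom_families Q d P" unfolding w_def
      by (rule hom_families_diff) (use y(1) y'(1) zP(1) in simp_all)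
    have Aw: "A P w = A P y - A P y'" unfolding A_def w_def by (rule coboundary_adjoint_diff)
    have "(norm (w - \<eta> *\<^sub>R L P (A P w)))\<^sup>2 \<le> (1 - \<eta> * \<nu>\<^sup>2) * (norm w)\<^sup>2"
    proof (rule chord_step_contraction[where A = "A P" and L = "L P" and C = C])
      show "inner (L P (A P w)) w = (norm (A P w))\<^sup>2"
        unfolding L_def A_def using proj[OF zP(3)] w by (intro inner_linearized)
    qed (rule L_le[OF zP(3)] \<nu>(2)[OF zP(3,4) w] less_imp_le[OF \<nu>(1)] \<eta>)+
    then have "(norm (w - \<eta> *\<^sub>R L P (A P w)))\<^sup>2 \<le> (\<kappa>0 * norm w)\<^sup>2"
      unfolding power_mult_distrib \<kappa>0(3) .
    then have 1: "norm (w - \<eta> *\<^sub>R L P (A P w)) \<le> \<kappa>0 * norm w"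
      by (rule power2_le_imp_le) (rule mult_nonneg_nonneg[OF \<kappa>0(1) norm_ge_zero])
    have Ay: "norm (A P y) \<le> \<tau>" if "norm y \<le> \<delta>" for y
      using order_trans[OF A_le[OF zP(3)] mult_left_mono[OF that]] C(1) \<delta>(2) by simp
    define e where "e = \<Phi> z P (A P y) - \<Phi> z P (A P y') - L P (A P w)"
    have e: "norm e \<le> \<tau> * E * norm (A P w)"
      unfolding e_def \<Phi>_def L_def E_def Aw
      by (rule defect_linearization_error[OF \<beta>[OF zP(3)] near[OF zP(2)] \<tau>(2) Ay[OF y(2)] Ay[OF y'(2)]])
    have "\<tau> * E * norm (A P w) \<le> \<tau> * E * (C * norm w)" using A_le[OF zP(3)] \<tau>(1) E by (intro mult_left_mono) auto
    with e have "norm e \<le> \<tau> * E * C * norm w" by simp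
    then have "\<eta> * norm e \<le> \<eta> * (\<tau> * E * C * norm w)" using \<eta>(1) by (intro mult_left_mono) auto
    also have "\<eta> * (\<tau> * E * C * norm w) \<le> (1 - \<kappa>0) / 2 * norm w"
      using mult_right_mono[OF \<tau>(3), of "norm w"] by (simp only: mult.assoc norm_ge_zero)
    finally have 2: "norm (\<eta> *\<^sub>R e) \<le> (1 - \<kappa>0) / 2 * norm w"
      unfolding norm_scaleR abs_of_pos[OF \<eta>(1)] .
    \<comment> \<open>The linear part contracts by \<open>\<kappa>0\<close>; the remainder
      \<open>e\<close> is the linearization error.\<close>
    have eq: "T q y - T q y' = (w - \<eta> *\<^sub>R L P (A P w)) - \<eta> *\<^sub>R e"
      unfolding T_def zP(1) w_def e_def fst_conv snd_conv scaleR_diff_right by simp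
    have "norm (T q y - T q y') \<le> \<kappa>0 * norm w + (1 - \<kappa>0) / 2 * norm w"
      unfolding eq by (intro order_trans[OF norm_triangle_ineq4] add_mono 1 2)
    moreover have "\<kappa>0 * norm w + (1 - \<kappa>0) / 2 * norm w = \<kappa> * norm w"
      unfolding \<kappa>_def by (simp add: field_simps)
    ultimately show ?thesis unfolding w_def by (simp only:)
  qed
  have "0 \<in> K" using \<delta>(1) unfolding K_def by (auto simp: indices_subset_entry)
  have TV: "T q y \<in> hom_families Q d (snd q)" if q: "q \<in> S" and y: "y \<in> hom_families Q d (snd q)" for q y
  proof -
    have P: "snd q \<in> projections Q d" using q unfolding S_def N_def by auto
    show ?thesis unfolding T_def \<Phi>_def
      by (intro hom_families_diff hom_families_scaleR y defect_in_hom_families[OF Q m] proj(1,3)[OF P]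
          relA[OF P y] coboundary_adjoint_P[OF proj(1)[OF P], of Q d "m z0" y, folded A_def])
  qed
  have A0: "A P 0 = 0" for P unfolding A_def by simp
  have T0: "norm (T q 0) \<le> (1 - \<kappa>) * \<delta>" if q: "q \<in> S" for q
  proof -
    have "norm (\<Phi> (fst q) (snd q) 0) \<le> norm (\<Phi> z0 (snd q) 0) + norm (\<Phi> (fst q) (snd q) 0 - \<Phi> z0 (snd q) 0)"
      by (rule norm_triangle_sub)
    moreover have "norm (\<Phi> z0 (snd q) 0) \<le> \<theta>" using q unfolding S_def N_def by auto
    moreover have "norm (\<Phi> (fst q) (snd q) 0 - \<Phi> z0 (snd q) 0) \<le> \<theta>"
      by (rule d0) (use q in \<open>auto simp: S_def N_def\<close>)
    ultimately have "norm (\<Phi> (fst q) (snd q) 0) \<le> 2 * \<theta>" by linarith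
    then have "\<eta> * norm (\<Phi> (fst q) (snd q) 0) \<le> \<eta> * (2 * \<theta>)" using \<eta>(1) by (intro mult_left_mono) auto
    then have "\<eta> * norm (\<Phi> (fst q) (snd q) 0) \<le> (1 - \<kappa>) * \<delta>" using \<theta>(3) by (rule order_trans)
    then show ?thesis
      unfolding T_def A0 diff_0 norm_minus_cancel norm_scaleR abs_of_pos[OF \<eta>(1)] .
  qed
  obtain fx where fx: "continuous_on S fx"
    "\<And>q. q \<in> S \<Longrightarrow> fx q \<in> hom_families Q d (snd q) \<inter> K \<and> T q (fx q) = fx q"
    "\<And>q. q \<in> S \<Longrightarrow> T q 0 = 0 \<Longrightarrow> fx q = 0"
  proof (rule continuous_fixed_point[where K = K and V = "\<lambda>q. hom_families Q d (snd q)" and S = S and T = T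
        and \<kappa> = \<kappa> and D = \<delta> and ?y0.0 = 0])
    show "complete K" unfolding K_def by (intro compact_imp_complete compact_fmat_ball finite_all_slots Q)
    show "continuous_on (S \<times> K) (\<lambda>q. T (fst q) (snd q))"
    proof -
      have c: "continuous_on (S \<times> K) (\<lambda>q. m (fst (fst q)) a)" if "a \<in> arcs Q" for a
        by (rule continuous_on_compose2[OF cont[OF that]]) (auto intro!: continuous_intros)
      show ?thesis
        unfolding T_def \<Phi>_def A_def defect_def coboundary_adjoint_def Let_def
        by (intro continuous_intros c)
    qed
    show "T q y \<in> hom_families Q d (snd q) \<inter> K" if q: "q \<in> S" and y: "y \<in> hom_families Q d (snd q)" "y \<in> K" for q y
    proof -
      have "norm (T q y) \<le> norm (T q 0) + norm (T q y - T q 0)" by (rule norm_triangle_sub)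
      also have "\<dots> \<le> (1 - \<kappa>) * \<delta> + \<kappa> * norm (y - 0)"
        by (intro add_mono T0[OF q] contr[OF q]) (use y \<delta>(1) in \<open>auto simp: K_def hom_families_zero\<close>)
      also have "\<dots> \<le> (1 - \<kappa>) * \<delta> + \<kappa> * \<delta>" using y(2) \<kappa>(1) by (simp add: K_def mult_left_mono)
      also have "\<dots> = \<delta>" by (simp add: algebra_simps)
      finally show ?thesis using TV[OF q y(1)] indices_hom_families[OF Q TV[OF q y(1)]] unfolding K_def by blast
    qed
    show "dist (T q y) (T q y') \<le> \<kappa> * dist y y'"
      if "q \<in> S" "y \<in> hom_families Q d (snd q) \<inter> K" "y' \<in> hom_families Q d (snd q) \<inter> K" for q y y'
      unfolding dist_norm using that by (intro contr) (auto simp: K_def)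
  qed (use \<open>0 \<in> K\<close> \<kappa> closed_hom_families hom_families_zero in \<open>auto simp: K_def\<close>)
  define g where "g z P = A P (fx (z, P))" for z P
  show ?thesis
  proof (rule that[of r N g])
    show "r > 0" by (rule r0(1))
    show "N \<subseteq> projections Q d" unfolding N_def by blast
    have \<Phi>0: "\<Phi> z P 0 = 0" if "P \<in> projections Q d" "stable Q (m z) P" for z P
      using defect_eq_0_iff[where m = "m z" and g = 0, OF Q m proj(3)[OF that(1)]] that(2) unfolding \<Phi>_def by simp
    show "P \<in> N" if "z \<in> ball z0 r" "P \<in> projections Q d" "stable Q (m z) P" for z P
      using d0[OF that(1,2)] \<Phi>0[OF that(2,3)] that(2) unfolding N_def by simp
    show "continuous_on (ball z0 r \<times> N) (\<lambda>q. g (fst q) (snd q))"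
      using fx(1) unfolding g_def S_def A_def coboundary_adjoint_def Let_def by (auto intro!: continuous_intros)
    fix z P assume zP: "z \<in> ball z0 r" "P \<in> N"
    then have S: "(z, P) \<in> S" and P: "P \<in> projections Q d" unfolding S_def N_def by auto
    have y: "fx (z, P) \<in> hom_families Q d P" "T (z, P) (fx (z, P)) = fx (z, P)" using fx(2)[OF S] by auto
    have "\<Phi> z P (g z P) = 0" using y(2) \<eta>(1) unfolding T_def g_def by simp
    then have "stable Q (m z) (P + g z P)"
      using defect_eq_0_iff[where m = "m z", OF Q m proj(3)[OF P] relA[OF P y(1)]] unfolding \<Phi>_def g_def by blast
    then show "rel (diag_slots Q d) (g z P) \<and> P * g z P = 0 \<and> g z P * P = g z P \<and> stable Q (m z) (P + g z P)"
      using relA[OF P y(1)] coboundary_adjoint_P[OF proj(1)[OF P], of Q d "m z0" "fx (z, P)"]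
      unfolding g_def A_def by blast
    show "g z P = 0" if "stable Q (m z) P"
    proof -
      have "T (z, P) 0 = 0" using \<Phi>0[OF P that] by (simp add: T_def A0)
      then show ?thesis using fx(3)[OF S] by (simp add: g_def A0)
    qed
  qed
qed

section \<open>Frames\<close>

abbreviation full_rank :: "nat \<Rightarrow> nat \<Rightarrow> complex mat \<Rightarrow> bool" where
  "full_rank n r A \<equiv> A \<in> carrier_mat n r \<and> vec_space.rank n A = r"

definition ctr :: "complex mat \<Rightarrow> complex mat" where
  "ctr A = Matrix.mat (dim_col A) (dim_row A) (\<lambda>(i, j). cnj (A $$ (j, i)))"

lemma ctr_carrier [simp]: "A \<in> carrier_mat n r \<Longrightarrow> ctr A \<in> carrier_mat r n"
  unfolding ctr_def by auto

lemma ctr_index [simp]: "A \<in> carrier_mat n r \<Longrightarrow> i < r \<Longrightarrow> j < n \<Longrightarrow> ctr A $$ (i, j) = cnj (A $$ (j, i))"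
  unfolding ctr_def by auto

lemma ctr_ctr [simp]: "ctr (ctr A) = A"
  unfolding ctr_def by (rule eq_matI) auto

lemma times_mat_index:
  assumes "A \<in> carrier_mat n k" "B \<in> carrier_mat k m" "i < n" "j < m"
  shows "(A * B) $$ (i, j) = (\<Sum>l<k. A $$ (i, l) * B $$ (l, j))"
  using assms by (simp add: scalar_prod_def atLeast0LessThan)

lemma ctr_times:
  assumes "A \<in> carrier_mat n k" "B \<in> carrier_mat k m"
  shows "ctr (A * B) = ctr B * ctr A"
proof (rule eq_matI)
  have c: "A * B \<in> carrier_mat n m" "ctr (A * B) \<in> carrier_mat m n" "ctr B * ctr A \<in> carrier_mat m n"
    using assms by (auto intro: mult_carrier_mat ctr_carrier)
  then show "dim_row (ctr (A * B)) = dim_row (ctr B * ctr A)" "dim_col (ctr (A * B)) = dim_col (ctr B * ctr A)"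
    by (metis carrier_matD)+
  fix i j assume "i < dim_row (ctr B * ctr A)" "j < dim_col (ctr B * ctr A)"
  then have ij: "i < m" "j < n" using c(3) by auto
  have "ctr (A * B) $$ (i, j) = cnj ((A * B) $$ (j, i))" by (rule ctr_index[OF c(1) ij])
  also have "\<dots> = (\<Sum>l<k. cnj (B $$ (l, i)) * cnj (A $$ (j, l)))"
    unfolding times_mat_index[OF assms ij(2,1)] by (simp add: mult.commute)
  also have "\<dots> = (\<Sum>l<k. ctr B $$ (i, l) * ctr A $$ (l, j))"
    by (rule sum.cong) (simp_all add: ctr_index[OF assms(1)] ctr_index[OF assms(2)] ij)
  also have "\<dots> = (ctr B * ctr A) $$ (i, j)"
    by (rule times_mat_index[symmetric]) (use assms ij in auto)
  finally show "ctr (A * B) $$ (i, j) = (ctr B * ctr A) $$ (i, j)" .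
qed

text \<open>The rank is the size of a maximal independent subset of the set of columns, and this set
  has fewer than \<open>r\<close> elements if a column is repeated.\<close>

lemma full_rank_distinct:
  assumes "full_rank n r A"
  shows "distinct (cols A)"
proof (rule ccontr)
  interpret vec_space "TYPE(complex)" n .
  assume "\<not> distinct (cols A)"
  have "A \<in> carrier_mat n r" "rank A = r" using assms by auto
  obtain S where S: "maximal S (\<lambda>T. T \<subseteq> set (cols A) \<and> lin_indpt T)"
    using maximal_exists[of "\<lambda>T. T \<subseteq> set (cols A) \<and> lin_indpt T" "card (set (cols A))" "{}"]
    by (meson List.finite_set card_mono empty_iff empty_subsetI finite_lin_indpt2 rev_finite_subset)
  then have "card S \<le> card (set (cols A))" by (simp add: card_mono maximal_def)
  also have "\<dots> < length (cols A)"
    using card_length[of "cols A"] card_distinct[of "cols A"] \<open>\<not> distinct (cols A)\<close> by linarith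
  also have "\<dots> = r" using \<open>A \<in> carrier_mat n r\<close> by simp
  finally show False using rank_card_indpt[OF \<open>A \<in> carrier_mat n r\<close> S] \<open>rank A = r\<close> by simp
qed

lemma full_rank_kernel:
  assumes "full_rank n r A" "v \<in> carrier_vec r" "A *\<^sub>v v = 0\<^sub>v n"
  shows "v = 0\<^sub>v r"
proof (rule ccontr)
  interpret vec_space "TYPE(complex)" n .
  have A: "A \<in> carrier_mat n r" "rank A = r" using assms by auto
  assume "v \<noteq> 0\<^sub>v r"
  then have "lin_dep (set (cols A))"
    using lin_depI[OF A(1) assms(2) _ assms(3) full_rank_distinct[OF assms(1)]] by blast
  then show False using full_rank_lin_indpt[OF A full_rank_distinct[OF assms(1)]] by blast
qed

lemma full_rankI:
  assumes A: "A \<in> carrier_mat n r" and L: "L \<in> carrier_mat r n" "L * A = 1\<^sub>m r"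
  shows "full_rank n r A"
proof -
  interpret vec_space "TYPE(complex)" n .
  have inj: "v = w" if "v \<in> carrier_vec r" "w \<in> carrier_vec r" "A *\<^sub>v v = A *\<^sub>v w" for v w
  proof -
    have "L *\<^sub>v (A *\<^sub>v v) = L *\<^sub>v (A *\<^sub>v w)" using that by simp
    then show ?thesis using that(1,2) A L by (simp flip: assoc_mult_mat_vec)
  qed
  have "distinct (cols A)"
    unfolding distinct_conv_nth
  proof (intro allI impI)
    fix i j assume "i < length (cols A)" "j < length (cols A)" "i \<noteq> j"
    then have ij: "i < r" "j < r" "i \<noteq> j" using A by auto
    have "A *\<^sub>v unit_vec r i = col A i" "A *\<^sub>v unit_vec r j = col A j"
      using A ij by (auto intro!: eq_vecI simp: scalar_prod_right_unit)
    moreover have "unit_vec r i \<noteq> (unit_vec r j :: complex Matrix.vec)"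
      using ij unit_vec_eq by blast
    ultimately show "cols A ! i \<noteq> cols A ! j"
      using inj[of "unit_vec r i" "unit_vec r j"] A ij by auto
  qed
  moreover have "lin_indpt (set (cols A))"
  proof
    assume "lin_dep (set (cols A))"
    then obtain v where v: "v \<in> carrier_vec r" "v \<noteq> 0\<^sub>v r" "A *\<^sub>v v = 0\<^sub>v n"
      using lin_depE[OF A _ \<open>distinct (cols A)\<close>] by blast
    moreover have "A *\<^sub>v 0\<^sub>v r = 0\<^sub>v n" using A by (intro eq_vecI) auto
    ultimately show False using inj[of v "0\<^sub>v r"] by auto
  qed
  ultimately show ?thesis using lin_indpt_full_rank[OF A] A by blast
qed

text \<open>If the Gram matrix kills \<open>v\<close>, then the squared length of
  \<open>A *\<^sub>v v\<close> is zero, so \<open>A\<close> kills \<open>v\<close>, which full rank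
  forbids for nonzero \<open>v\<close>.\<close>

lemma gram_det_nonzero:
  assumes "full_rank n r A"
  shows "det (ctr A * A) \<noteq> 0"
proof
  have A: "A \<in> carrier_mat n r" using assms by simp
  have G: "ctr A * A \<in> carrier_mat r r" by (rule mult_carrier_mat[OF ctr_carrier[OF A] A])
  assume "det (ctr A * A) = 0"
  then obtain v where v: "v \<in> carrier_vec r" "v \<noteq> 0\<^sub>v r" "ctr A * A *\<^sub>v v = 0\<^sub>v r"
    using det_0_iff_vec_prod_zero[OF G] by blast
  define w where "w = A *\<^sub>v v"
  have w: "w \<in> carrier_vec n" using A v(1) unfolding w_def by simp
  have wi: "w $ i = (\<Sum>j<r. A $$ (i, j) * v $ j)" if "i < n" for i
    using that A v(1) unfolding w_def by (simp add: scalar_prod_def atLeast0LessThan)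
  have "ctr A *\<^sub>v w = 0\<^sub>v r" using v assoc_mult_mat_vec[OF ctr_carrier[OF A] A v(1)] unfolding w_def by simp
  moreover have "(ctr A *\<^sub>v w) $ j = (\<Sum>i<n. cnj (A $$ (i, j)) * w $ i)" if "j < r" for j
  proof -
    have "(ctr A *\<^sub>v w) $ j = (\<Sum>i<n. ctr A $$ (j, i) * w $ i)"
      using that ctr_carrier[OF A] w by (simp add: scalar_prod_def atLeast0LessThan del: ctr_carrier)
    also have "\<dots> = (\<Sum>i<n. cnj (A $$ (i, j)) * w $ i)"
      by (rule sum.cong) (simp_all add: ctr_index[OF A that])
    finally show ?thesis .
  qed
  ultimately have z: "(\<Sum>i<n. cnj (A $$ (i, j)) * w $ i) = 0" if "j < r" for j
    using that by (metis index_zero_vec(1))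
  have "(\<Sum>i<n. of_real ((cmod (w $ i))\<^sup>2)) = (\<Sum>i<n. cnj (w $ i) * w $ i)"
    by (rule sum.cong) (simp_all add: complex_norm_square mult.commute del: of_real_power)
  also have "\<dots> = (\<Sum>i<n. \<Sum>j<r. cnj (v $ j) * (cnj (A $$ (i, j)) * w $ i))"
    by (rule sum.cong) (simp_all add: wi sum_distrib_right sum_distrib_left algebra_simps)
  also have "\<dots> = (\<Sum>j<r. \<Sum>i<n. cnj (v $ j) * (cnj (A $$ (i, j)) * w $ i))" by (rule sum.swap)
  also have "\<dots> = (\<Sum>j<r. cnj (v $ j) * (\<Sum>i<n. cnj (A $$ (i, j)) * w $ i))" by (simp add: sum_distrib_left)
  also have "\<dots> = 0" using z by simp
  finally have "of_real (\<Sum>i<n. (cmod (w $ i))\<^sup>2) = (0 :: complex)" by simp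
  then have "(\<Sum>i<n. (cmod (w $ i))\<^sup>2) = 0" by (simp only: of_real_eq_0_iff)
  then have "\<forall>i<n. w $ i = 0" by (simp add: sum_nonneg_eq_0_iff)
  then have "w = 0\<^sub>v n" using w by (intro eq_vecI) auto
  then show False using full_rank_kernel[OF assms v(1)] v(2) unfolding w_def by blast
qed

text \<open>The orthogonal projection onto the column space: \<open>A\<close> times the inverse of
  its Gram matrix times \<open>ctr A\<close>. Writing the inverse with adjugate and determinant
  makes continuity in the entries evident.\<close>

definition frame_projection :: "complex mat \<Rightarrow> complex mat" where
  "frame_projection A = inverse (det (ctr A * A)) \<cdot>\<^sub>m (A * adj_mat (ctr A * A) * ctr A)"

lemma frame_projection:
  assumes "full_rank n r A"
  shows frame_projection_carrier: "frame_projection A \<in> carrier_mat n n"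
    and frame_projection_frame: "frame_projection A * A = A"
    and frame_projection_factor: "\<exists>K\<in>carrier_mat r n. frame_projection A = A * K \<and> K * A = 1\<^sub>m r"
    and frame_projection_idem: "frame_projection A * frame_projection A = frame_projection A"
    and frame_projection_hermitian: "ctr (frame_projection A) = frame_projection A"
proof -
  have A: "A \<in> carrier_mat n r" using assms by simp
  define G where "G = ctr A * A"
  have G: "G \<in> carrier_mat r r" unfolding G_def by (rule mult_carrier_mat[OF ctr_carrier[OF A] A])
  note aG = adj_mat[OF G]
  have dG: "det G \<noteq> 0" unfolding G_def by (rule gram_det_nonzero[OF assms])
  define H where "H = inverse (det G) \<cdot>\<^sub>m adj_mat G"
  have H: "H \<in> carrier_mat r r" unfolding H_def using aG by simp
  have cancel: "inverse (det G) \<cdot>\<^sub>m (det G \<cdot>\<^sub>m 1\<^sub>m r) = 1\<^sub>m r"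
    using dG by (intro eq_matI) auto
  have HG: "H * G = 1\<^sub>m r"
    unfolding H_def using aG cancel by (simp add: mult_smult_assoc_mat[OF aG(1) G])
  have GH: "G * H = 1\<^sub>m r"
    unfolding H_def using aG cancel by (simp add: mult_smult_distrib[OF G aG(1)])
  define K where "K = H * ctr A"
  have K: "K \<in> carrier_mat r n" unfolding K_def using H A by (auto intro: mult_carrier_mat)
  have KA: "K * A = 1\<^sub>m r"
    unfolding K_def using HG unfolding G_def
    by (subst assoc_mult_mat[OF H ctr_carrier[OF A] A])
  have PK: "frame_projection A = A * K"
  proof -
    have "frame_projection A = inverse (det G) \<cdot>\<^sub>m (A * adj_mat G * ctr A)"
      unfolding frame_projection_def G_def ..
    also have "\<dots> = A * H * ctr A"
      unfolding H_def
      by (subst mult_smult_distrib[OF A aG(1)], subst mult_smult_assoc_mat[OF mult_carrier_mat[OF A aG(1)] ctr_carrier[OF A]]) simp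
    finally show ?thesis unfolding K_def using assoc_mult_mat[OF A H ctr_carrier[OF A]] by simp
  qed
  show "frame_projection A \<in> carrier_mat n n" unfolding PK using A K by (rule mult_carrier_mat)
  show PA: "frame_projection A * A = A"
    unfolding PK using assoc_mult_mat[OF A K A] KA A by simp
  show "\<exists>K\<in>carrier_mat r n. frame_projection A = A * K \<and> K * A = 1\<^sub>m r" using K PK KA by blast
  show "frame_projection A * frame_projection A = frame_projection A"
    using assoc_mult_mat[OF \<open>frame_projection A \<in> carrier_mat n n\<close> A K] PA unfolding PK by simp
  have cG: "ctr G = G" unfolding G_def using A by (simp add: ctr_times[of _ r n _ r])
  have cH: "ctr H = H"
  proof -
    have "ctr H * G = 1\<^sub>m r"
    proof -
      have "ctr (G * H) = ctr H * G" using ctr_times[OF G H] cG by simp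
      moreover have "ctr (1\<^sub>m r) = (1\<^sub>m r :: complex mat)" unfolding ctr_def by (rule eq_matI) auto
      ultimately show ?thesis using GH by simp
    qed
    then have "ctr H * G * H = H" using H by simp
    then show ?thesis using assoc_mult_mat[OF ctr_carrier[OF H] G H] GH ctr_carrier[OF H] by simp
  qed
  have "ctr (A * K) = ctr K * ctr A" by (rule ctr_times[OF A K])
  also have "ctr K = A * H" unfolding K_def using ctr_times[OF H ctr_carrier[OF A]] cH by simp
  also have "A * H * ctr A = A * K" unfolding K_def by (rule assoc_mult_mat[OF A H ctr_carrier[OF A]])
  finally show "ctr (frame_projection A) = frame_projection A" unfolding PK .
qed

section \<open>Column spaces and their Hermitian projections\<close>

lemma col_space_image:
  assumes "A \<in> carrier_mat n r"
  shows "vec_space.col_space n A = (\<lambda>v. A *\<^sub>v v) ` carrier_vec r"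
  using vec_space.col_space_eq[OF assms] assms by auto

lemma col_space_frame_projection:
  assumes "full_rank n r A"
  shows "vec_space.col_space n A = {v \<in> carrier_vec n. frame_projection A *\<^sub>v v = v}"
proof -
  have A: "A \<in> carrier_mat n r" using assms by simp
  obtain K where K: "K \<in> carrier_mat r n" "frame_projection A = A * K"
    using frame_projection_factor[OF assms] by blast
  have "A *\<^sub>v v \<in> carrier_vec n \<and> frame_projection A *\<^sub>v (A *\<^sub>v v) = A *\<^sub>v v" if "v \<in> carrier_vec r" for v
    using assoc_mult_mat_vec[OF frame_projection_carrier[OF assms] A that] frame_projection_frame[OF assms] A that
    by simp
  moreover have "v \<in> (\<lambda>v. A *\<^sub>v v) ` carrier_vec r" if "v \<in> carrier_vec n" "frame_projection A *\<^sub>v v = v" for v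
    using that assoc_mult_mat_vec[OF A K(1) that(1)] K by (intro image_eqI[of _ _ "K *\<^sub>v v"]) auto
  ultimately show ?thesis unfolding col_space_image[OF A] by auto
qed

lemma mat_eqI_mult_vec:
  assumes "A \<in> carrier_mat n m" "B \<in> carrier_mat n m"
    and "\<And>v. v \<in> carrier_vec m \<Longrightarrow> A *\<^sub>v v = (B *\<^sub>v v :: complex Matrix.vec)"
  shows "A = B"
proof (rule eq_matI)
  fix i j assume "i < dim_row B" "j < dim_col B"
  then have ij: "i < n" "j < m" using assms by auto
  have "(A *\<^sub>v unit_vec m j) $ i = (B *\<^sub>v unit_vec m j) $ i" using assms(3) by simp
  then show "A $$ (i, j) = B $$ (i, j)" using assms(1,2) ij by (simp add: scalar_prod_right_unit)
qed (use assms in auto)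

text \<open>A Hermitian idempotent is determined by its range.\<close>

lemma frame_projection_cong:
  assumes A: "full_rank n r A" and B: "full_rank n s B"
    and eq: "vec_space.col_space n A = vec_space.col_space n B"
  shows "frame_projection A = frame_projection B"
proof -
  let ?P = "frame_projection A" and ?R = "frame_projection B"
  note P = frame_projection_carrier[OF A] frame_projection_idem[OF A] frame_projection_hermitian[OF A]
  note R = frame_projection_carrier[OF B] frame_projection_idem[OF B] frame_projection_hermitian[OF B]
  have fix_iff: "?P *\<^sub>v v = v \<longleftrightarrow> ?R *\<^sub>v v = v" if "v \<in> carrier_vec n" for v
    using eq that unfolding col_space_frame_projection[OF A] col_space_frame_projection[OF B] by blast
  have "?P * ?R = ?R"
  proof (rule mat_eqI_mult_vec)
    fix v :: "complex Matrix.vec" assume v: "v \<in> carrier_vec n"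
    have "?R *\<^sub>v (?R *\<^sub>v v) = ?R *\<^sub>v v" using assoc_mult_mat_vec[OF R(1) R(1) v] R(2) by simp
    then have "?P *\<^sub>v (?R *\<^sub>v v) = ?R *\<^sub>v v" using fix_iff[of "?R *\<^sub>v v"] R(1) v by auto
    then show "?P * ?R *\<^sub>v v = ?R *\<^sub>v v" using assoc_mult_mat_vec[OF P(1) R(1) v] by simp
  qed (use P R in auto)
  then have "ctr (?P * ?R) = ctr ?R" by simp
  then have RP: "?R * ?P = ?R" using ctr_times[OF P(1) R(1)] P(3) R(3) by simp
  have "?R * ?P = ?P"
  proof (rule mat_eqI_mult_vec)
    fix v :: "complex Matrix.vec" assume v: "v \<in> carrier_vec n"
    have "?P *\<^sub>v (?P *\<^sub>v v) = ?P *\<^sub>v v" using assoc_mult_mat_vec[OF P(1) P(1) v] P(2) by simp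
    then have "?R *\<^sub>v (?P *\<^sub>v v) = ?P *\<^sub>v v" using fix_iff[of "?P *\<^sub>v v"] P(1) v by auto
    then show "?R * ?P *\<^sub>v v = ?P *\<^sub>v v" using assoc_mult_mat_vec[OF R(1) P(1) v] by simp
  qed (use P R in auto)
  then show ?thesis using RP by simp
qed

section \<open>Continuity of matrix operations\<close>

lemma continuous_map_complex_mult:
  fixes f g :: "'x \<Rightarrow> complex"
  assumes "continuous_map T euclidean f" "continuous_map T euclidean g"
  shows "continuous_map T euclidean (\<lambda>x. f x * g x)"
  using assms by (simp add: continuous_map_atin tendsto_mult)

lemma continuous_map_complex_prod:
  fixes f :: "'x \<Rightarrow> 'y \<Rightarrow> complex"
  shows "(\<And>i. i \<in> I \<Longrightarrow> continuous_map T euclidean (\<lambda>x. f x i)) \<Longrightarrow>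
    continuous_map T euclidean (\<lambda>x. \<Prod>i\<in>I. f x i)"
  by (simp add: continuous_map_atin tendsto_prod)

lemma continuous_map_comp_continuous:
  assumes "continuous_map T euclidean f" "continuous_on UNIV g"
  shows "continuous_map T euclidean (\<lambda>x. g (f x))"
  using continuous_map_compose[OF assms(1), of euclidean g] assms(2) by (simp add: o_def)

lemma continuous_map_mat_topology:
  "continuous_map T (mat_topology n m) A \<longleftrightarrow> (\<forall>x\<in>topspace T. A x \<in> carrier_mat n m) \<and>
    (\<forall>i<n. \<forall>j<m. continuous_map T euclidean (\<lambda>x. A x $$ (i, j)))"
proof
  assume A: "continuous_map T (mat_topology n m) A"
  have "\<forall>x\<in>topspace T. A x \<in> carrier_mat n m"
    using continuous_map_image_subset_topspace[OF A] by (auto simp: topspace_mat_topology)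
  moreover have "continuous_map T euclidean (\<lambda>x. A x $$ (i, j))" if "i < n" "j < m" for i j
  proof -
    have "continuous_map (mat_topology n m) euclidean
        ((\<lambda>f. f (i, j)) \<circ> (\<lambda>A. \<lambda>ij\<in>{..<n} \<times> {..<m}. A $$ ij :: complex))"
      unfolding mat_topology_def
      by (intro continuous_map_pullback continuous_map_product_projection) (use that in auto)
    from continuous_map_compose[OF A this] show ?thesis using that by (simp add: o_def)
  qed
  ultimately show "(\<forall>x\<in>topspace T. A x \<in> carrier_mat n m) \<and>
    (\<forall>i<n. \<forall>j<m. continuous_map T euclidean (\<lambda>x. A x $$ (i, j)))" by blast
next
  assume A: "(\<forall>x\<in>topspace T. A x \<in> carrier_mat n m) \<and>
    (\<forall>i<n. \<forall>j<m. continuous_map T euclidean (\<lambda>x. A x $$ (i, j)))"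
  show "continuous_map T (mat_topology n m) A"
    unfolding mat_topology_def
  proof (rule continuous_map_pullback')
    show "continuous_map T (product_topology (\<lambda>_. euclidean) ({..<n} \<times> {..<m}))
        ((\<lambda>A. \<lambda>ij\<in>{..<n} \<times> {..<m}. A $$ ij) \<circ> A)"
      unfolding continuous_map_componentwise using A by auto
  qed (use A in auto)
qed

lemma continuous_map_mat_times:
  assumes "continuous_map T (mat_topology n k) A" "continuous_map T (mat_topology k m) B"
  shows "continuous_map T (mat_topology n m) (\<lambda>x. A x * B x)"
proof -
  note A = assms[unfolded continuous_map_mat_topology]
  have "continuous_map T euclidean (\<lambda>x. (A x * B x) $$ (i, j))" if "i < n" "j < m" for i j
  proof (rule continuous_map_eq[of T euclidean "\<lambda>x. \<Sum>l<k. A x $$ (i, l) * B x $$ (l, j)"])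
    show "continuous_map T euclidean (\<lambda>x. \<Sum>l<k. A x $$ (i, l) * B x $$ (l, j))"
      by (intro continuous_map_sum continuous_map_complex_mult) (use A that in auto)
    show "(\<Sum>l<k. A x $$ (i, l) * B x $$ (l, j)) = (A x * B x) $$ (i, j)" if "x \<in> topspace T" for x
      by (rule times_mat_index[symmetric]) (use A that \<open>i < n\<close> \<open>j < m\<close> in auto)
  qed
  then show ?thesis unfolding continuous_map_mat_topology using A by (auto intro: mult_carrier_mat)
qed

lemma continuous_map_det:
  assumes "continuous_map T (mat_topology n n) A"
  shows "continuous_map T euclidean (\<lambda>x. det (A x))"
proof (rule continuous_map_eq)
  note A = assms[unfolded continuous_map_mat_topology]
  show "continuous_map T euclidean (\<lambda>x. \<Sum>p\<in>{p. p permutes {0..<n}}. signof p * (\<Prod>i=0..<n. A x $$ (i, p i)))"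
  proof (intro continuous_map_sum continuous_map_complex_mult continuous_map_complex_prod continuous_map_canonical_const)
    show "finite {p. p permutes {0..<n}}" by (simp add: finite_permutations)
    fix p i assume "p \<in> {p. p permutes {0..<n}}" "i \<in> {0..<n}"
    then have "i < n" "p i < n" using permutes_in_image[of p "{0..<n}" i] by auto
    then show "continuous_map T euclidean (\<lambda>x. A x $$ (i, p i))" using A by blast
  qed
  show "(\<Sum>p\<in>{p. p permutes {0..<n}}. signof p * (\<Prod>i=0..<n. A x $$ (i, p i))) = det (A x)"
    if "x \<in> topspace T" for x
    using det_def'[of "A x" n] A that by auto
qed

lemma continuous_map_adj_mat:
  assumes "continuous_map T (mat_topology n n) A"
  shows "continuous_map T (mat_topology n n) (\<lambda>x. adj_mat (A x))"
proof -
  note A = assms[unfolded continuous_map_mat_topology]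
  have "continuous_map T euclidean (\<lambda>x. adj_mat (A x) $$ (i, j))" if ij: "i < n" "j < n" for i j
  proof (rule continuous_map_eq)
    have "continuous_map T (mat_topology (n - 1) (n - 1)) (\<lambda>x. mat_delete (A x) j i)"
      unfolding continuous_map_mat_topology
    proof (intro conjI ballI allI impI)
      show "mat_delete (A x) j i \<in> carrier_mat (n - 1) (n - 1)" if "x \<in> topspace T" for x
        using A that mat_delete_dim[of "A x" j i] by (metis carrier_matD carrier_matI)
      fix k l assume kl: "k < n - 1" "l < n - 1"
      show "continuous_map T euclidean (\<lambda>x. mat_delete (A x) j i $$ (k, l))"
      proof (rule continuous_map_eq)
        show "continuous_map T euclidean (\<lambda>x. A x $$ (if k < j then k else Suc k, if l < i then l else Suc l))"
          using A kl by auto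
        show "A x $$ (if k < j then k else Suc k, if l < i then l else Suc l) = mat_delete (A x) j i $$ (k, l)"
          if "x \<in> topspace T" for x
        proof -
          have "dim_row (A x) = n" "dim_col (A x) = n" using A that by auto
          then show ?thesis using kl unfolding mat_delete_def by simp
        qed
      qed
    qed
    then show "continuous_map T euclidean (\<lambda>x. (-1) ^ (j + i) * det (mat_delete (A x) j i))"
      by (intro continuous_map_complex_mult continuous_map_det continuous_map_canonical_const)
    show "(-1) ^ (j + i) * det (mat_delete (A x) j i) = adj_mat (A x) $$ (i, j)" if "x \<in> topspace T" for x
      using A that ij unfolding adj_mat_def cofactor_def by auto
  qed
  then show ?thesis unfolding continuous_map_mat_topology using A adj_mat(1) by blast
qed

lemma continuous_map_ctr:
  assumes "continuous_map T (mat_topology n m) A"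
  shows "continuous_map T (mat_topology m n) (\<lambda>x. ctr (A x))"
proof -
  note A = assms[unfolded continuous_map_mat_topology]
  have "continuous_map T euclidean (\<lambda>x. ctr (A x) $$ (i, j))" if "i < m" "j < n" for i j
  proof (rule continuous_map_eq)
    show "continuous_map T euclidean (\<lambda>x. cnj (A x $$ (j, i)))"
      by (intro continuous_map_comp_continuous[of T _ cnj] continuous_intros) (use A that in auto)
  qed (use A that in auto)
  then show ?thesis unfolding continuous_map_mat_topology using A by auto
qed

lemma continuous_map_mat_smult:
  assumes "continuous_map T euclidean c" "continuous_map T (mat_topology n m) A"
  shows "continuous_map T (mat_topology n m) (\<lambda>x. c x \<cdot>\<^sub>m A x)"
proof -
  note A = assms(2)[unfolded continuous_map_mat_topology]
  have "continuous_map T euclidean (\<lambda>x. (c x \<cdot>\<^sub>m A x) $$ (i, j))" if "i < n" "j < m" for i j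
  proof (rule continuous_map_eq)
    show "continuous_map T euclidean (\<lambda>x. c x * A x $$ (i, j))"
      by (intro continuous_map_complex_mult assms(1)) (use A that in auto)
  qed (use A that in auto)
  then show ?thesis unfolding continuous_map_mat_topology using A by auto
qed

lemma continuous_map_complex_inverse:
  fixes f :: "'x \<Rightarrow> complex"
  assumes "continuous_map T euclidean f" "\<And>x. x \<in> topspace T \<Longrightarrow> f x \<noteq> 0"
  shows "continuous_map T euclidean (\<lambda>x. inverse (f x))"
  using assms by (simp add: continuous_map_atin tendsto_inverse)

abbreviation frames :: "nat \<Rightarrow> nat \<Rightarrow> complex mat topology" where
  "frames n r \<equiv> subtopology (mat_topology n r) {A. vec_space.rank n A = r}"

lemma topspace_frames: "topspace (frames n r) = {A. full_rank n r A}"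
  by (auto simp: topspace_mat_topology)

lemma continuous_map_frame_projection:
  "continuous_map (frames n r) (mat_topology n n) frame_projection"
proof -
  let ?F = "frames n r"
  have A: "continuous_map ?F (mat_topology n r) (\<lambda>A. A)"
    by (rule continuous_map_from_subtopology) (rule continuous_map_id[unfolded id_def])
  note G = continuous_map_mat_times[OF continuous_map_ctr[OF A] A]
  have inv: "continuous_map ?F euclidean (\<lambda>A. inverse (det (ctr A * A)))"
    by (rule continuous_map_complex_inverse[OF continuous_map_det[OF G]])
      (use gram_det_nonzero in \<open>unfold topspace_frames, blast\<close>)
  show ?thesis
    unfolding frame_projection_def
    by (rule continuous_map_mat_smult[OF inv continuous_map_mat_times[OF
          continuous_map_mat_times[OF A continuous_map_adj_mat[OF G]] continuous_map_ctr[OF A]]])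
qed

section \<open>Projections and Grassmannians\<close>

text \<open>The fixed vectors, which form the image when \<open>E\<close> is idempotent; in this
  form membership is an equation.\<close>

definition range_of :: "nat \<Rightarrow> complex mat \<Rightarrow> complex Matrix.vec set" where
  "range_of n E = {v \<in> carrier_vec n. E *\<^sub>v v = v}"

text \<open>By \<open>frame_projection_cong\<close> the result does not depend on the frame
  chosen.\<close>

definition grass_projection :: "nat \<Rightarrow> complex Matrix.vec set \<Rightarrow> complex mat" where
  "grass_projection n W = frame_projection (SOME A. \<exists>r. full_rank n r A \<and> vec_space.col_space n A = W)"

lemma grass_projection_col_space:
  assumes "full_rank n r A"
  shows "grass_projection n (vec_space.col_space n A) = frame_projection A"
proof -
  let ?B = "SOME B. \<exists>r. full_rank n r B \<and> vec_space.col_space n B = vec_space.col_space n A"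
  have "\<exists>r. full_rank n r ?B \<and> vec_space.col_space n ?B = vec_space.col_space n A"
    by (rule someI[of _ A]) (use assms in blast)
  then show ?thesis unfolding grass_projection_def using frame_projection_cong assms by blast
qed

lemma grassmannian_frame:
  assumes "W \<in> grassmannian n r"
  obtains A where "full_rank n r A" "vec_space.col_space n A = W"
proof -
  have "W \<in> vec_space.col_space n ` topspace (frames n r)"
    using assms unfolding topspace_grassmannian_topology[symmetric] grassmannian_topology_def
      topspace_quotient_topology .
  then show ?thesis using that unfolding topspace_frames by blast
qed

lemma col_space_in_grassmannian: "full_rank n r A \<Longrightarrow> vec_space.col_space n A \<in> grassmannian n r"
  unfolding topspace_grassmannian_topology[symmetric] grassmannian_topology_def
    topspace_quotient_topology topspace_frames by blast

lemma range_of_frame_projection: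
  "full_rank n r A \<Longrightarrow> range_of n (frame_projection A) = vec_space.col_space n A"
  unfolding range_of_def by (rule col_space_frame_projection[symmetric])

lemma grass_projection:
  assumes "W \<in> grassmannian n r"
  shows grass_projection_carrier: "grass_projection n W \<in> carrier_mat n n"
    and grass_projection_idem: "grass_projection n W * grass_projection n W = grass_projection n W"
    and grass_projection_hermitian: "ctr (grass_projection n W) = grass_projection n W"
    and range_of_grass_projection: "range_of n (grass_projection n W) = W"
proof -
  obtain A where A: "full_rank n r A" "vec_space.col_space n A = W" using grassmannian_frame[OF assms] .
  then have P: "grass_projection n W = frame_projection A" using grass_projection_col_space[OF A(1)] by simp
  show "grass_projection n W \<in> carrier_mat n n" "grass_projection n W * grass_projection n W = grass_projection n W"
    "ctr (grass_projection n W) = grass_projection n W" "range_of n (grass_projection n W) = W"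
    unfolding P using frame_projection[OF A(1)] range_of_frame_projection[OF A(1)] A(2) by blast+
qed

text \<open>The topology of the Grassmannian is a quotient of the space of frames, so continuity is
  tested after composition with \<open>vec_space.col_space n\<close>, where the map becomes the
  explicit \<open>frame_projection\<close>.\<close>

lemma continuous_map_grass_projection:
  "continuous_map (grassmannian_topology n r) (mat_topology n n) (grass_projection n)"
  unfolding grassmannian_topology_def
proof (rule continuous_compose_quotient_map[OF quotient_map_quotient_topology])
  show "continuous_map (frames n r) (mat_topology n n) (grass_projection n \<circ> vec_space.col_space n)"
    by (rule continuous_map_eq[OF continuous_map_frame_projection])
      (auto simp: grass_projection_col_space topspace_mat_topology)
qed

text \<open>The coordinate matrix \<open>K * F\<close> of one frame in terms of the other is square
  with left inverse \<open>L * C\<close>, hence invertible.\<close>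

lemma col_space_eq_if_subset:
  assumes F: "full_rank n r F" and C: "full_rank n r C"
    and sub: "vec_space.col_space n F \<subseteq> vec_space.col_space n C"
  shows "vec_space.col_space n F = vec_space.col_space n C"
proof
  have F': "F \<in> carrier_mat n r" and C': "C \<in> carrier_mat n r" using F C by auto
  obtain K where K: "K \<in> carrier_mat r n" "frame_projection C = C * K" using frame_projection_factor[OF C] by blast
  obtain L where L: "L \<in> carrier_mat r n" "L * F = 1\<^sub>m r" using frame_projection_factor[OF F] by blast
  have "frame_projection C * F = F"
  proof (rule mat_eqI_mult_vec)
    fix v :: "complex Matrix.vec" assume v: "v \<in> carrier_vec r"
    then have "F *\<^sub>v v \<in> vec_space.col_space n C" using sub unfolding col_space_image[OF F'] by auto
    then show "frame_projection C * F *\<^sub>v v = F *\<^sub>v v"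
      using assoc_mult_mat_vec[OF frame_projection_carrier[OF C] F' v]
      unfolding col_space_frame_projection[OF C] by simp
  qed (use F' frame_projection_carrier[OF C] in auto)
  then have CM: "F = C * (K * F)" using K assoc_mult_mat[OF C' K(1) F'] by simp
  have M: "K * F \<in> carrier_mat r r" "L * C \<in> carrier_mat r r" using K L F' C' by auto
  have "L * C * (K * F) = 1\<^sub>m r" using assoc_mult_mat[OF L(1) C' M(1)] CM L(2) by simp
  then have inv: "K * F * (L * C) = 1\<^sub>m r" using mat_mult_left_right_inverse[OF M(2,1)] by simp
  show "vec_space.col_space n C \<subseteq> vec_space.col_space n F"
  proof
    fix w assume "w \<in> vec_space.col_space n C"
    then obtain v where v: "v \<in> carrier_vec r" "w = C *\<^sub>v v" unfolding col_space_image[OF C'] by auto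
    have "F *\<^sub>v (L * C *\<^sub>v v) = C * (K * F) *\<^sub>v (L * C *\<^sub>v v)" using CM by simp
    also have "\<dots> = C *\<^sub>v (K * F *\<^sub>v (L * C *\<^sub>v v))" by (rule assoc_mult_mat_vec[OF C' M(1)]) (use M v in auto)
    also have "K * F *\<^sub>v (L * C *\<^sub>v v) = v" using assoc_mult_mat_vec[OF M v(1)] inv v(1) by simp
    finally show "w \<in> vec_space.col_space n F"
      unfolding v(2) col_space_image[OF F'] using M v by (intro image_eqI[of _ _ "L * C *\<^sub>v v"]) auto
  qed
qed (rule sub)

text \<open>It suffices to lift the map locally to frames. Near \<open>y\<close> a lift is
  \<open>E x * B\<close> with a fixed frame \<open>B\<close> of the range at \<open>y\<close>: its
  columns lie in the range of \<open>E x\<close>, and they stay independent on the open set where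
  \<open>det (D x)\<close> is nonzero. The constant dimension given by \<open>gr\<close> turns the
  inclusion of spans into equality.\<close>

lemma continuous_map_range_of:
  assumes E: "continuous_map T (mat_topology n n) E"
    and idem: "\<And>x. x \<in> topspace T \<Longrightarrow> E x * E x = E x"
    and gr: "\<And>x. x \<in> topspace T \<Longrightarrow> range_of n (E x) \<in> grassmannian n r"
  shows "continuous_map T (grassmannian_topology n r) (\<lambda>x. range_of n (E x))"
  unfolding continuous_map_def
proof (intro conjI allI impI)
  show "(\<lambda>x. range_of n (E x)) \<in> topspace T \<rightarrow> topspace (grassmannian_topology n r)"
    using gr by (simp add: topspace_grassmannian_topology)
  have Ec: "E x \<in> carrier_mat n n" if "x \<in> topspace T" for x
    using E that unfolding continuous_map_mat_topology by blast
  fix V assume V: "openin (grassmannian_topology n r) V"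
  show "openin T {x \<in> topspace T. range_of n (E x) \<in> V}"
  proof (subst openin_subopen, rule ballI)
    fix y assume "y \<in> {x \<in> topspace T. range_of n (E x) \<in> V}"
    then have y: "y \<in> topspace T" "range_of n (E y) \<in> V" by auto
    obtain B where B: "full_rank n r B" "vec_space.col_space n B = range_of n (E y)"
      using grassmannian_frame[OF gr[OF y(1)]] .
    have B': "B \<in> carrier_mat n r" using B by simp
    define D where "D x = ctr B * (E x * B)" for x
    have const: "continuous_map T (mat_topology n' m) (\<lambda>x. X)" if "X \<in> carrier_mat n' m" for X n' m
      using that by (simp add: topspace_mat_topology)
    have EB: "continuous_map T (mat_topology n r) (\<lambda>x. E x * B)"
      by (intro continuous_map_mat_times[OF E] const B')
    have D: "continuous_map T (mat_topology r r) D"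
      unfolding D_def by (intro continuous_map_mat_times[OF _ EB] const ctr_carrier B')
    define U where "U = {x \<in> topspace T. det (D x) \<in> - {0}}"
    have U: "openin T U" unfolding U_def
      by (rule openin_continuous_map_preimage[OF continuous_map_det[OF D]]) (simp add: open_Compl)
    \<comment> \<open>Hence \<open>D y\<close> is the Gram matrix of \<open>B\<close>, and
      \<open>y\<close> belongs to \<open>U\<close>.\<close>
    have "E y * B = B"
    proof (rule mat_eqI_mult_vec)
      fix v :: "complex Matrix.vec" assume v: "v \<in> carrier_vec r"
      then have "B *\<^sub>v v \<in> range_of n (E y)" using B(2) unfolding col_space_image[OF B'] by auto
      then show "E y * B *\<^sub>v v = B *\<^sub>v v"
        using assoc_mult_mat_vec[OF Ec[OF y(1)] B' v] unfolding range_of_def by simp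
    qed (use B' Ec[OF y(1)] in auto)
    then have "y \<in> U" using gram_det_nonzero[OF B(1)] y(1) unfolding U_def D_def by simp
    have fr: "full_rank n r (E x * B)" and col: "vec_space.col_space n (E x * B) = range_of n (E x)" if x: "x \<in> U" for x
    proof -
      have xT: "x \<in> topspace T" and dD: "det (D x) \<noteq> 0" using x unfolding U_def by auto
      have Dc: "D x \<in> carrier_mat r r" using D xT unfolding continuous_map_mat_topology by blast
      have EBc: "E x * B \<in> carrier_mat n r" using Ec[OF xT] B' by (rule mult_carrier_mat)
      note a = adj_mat[OF Dc]
      have L: "inverse (det (D x)) \<cdot>\<^sub>m adj_mat (D x) * ctr B \<in> carrier_mat r n"
        by (rule mult_carrier_mat[of _ r r]) (use a B' in auto)
      have "inverse (det (D x)) \<cdot>\<^sub>m adj_mat (D x) * ctr B * (E x * B) =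
          inverse (det (D x)) \<cdot>\<^sub>m adj_mat (D x) * D x"
        unfolding D_def[of x] by (rule assoc_mult_mat[of _ r r _ n _ r]) (use a B' EBc in \<open>auto simp: D_def\<close>)
      also have "\<dots> = inverse (det (D x)) \<cdot>\<^sub>m (det (D x) \<cdot>\<^sub>m 1\<^sub>m r)"
        using a mult_smult_assoc_mat[OF a(1) Dc] by simp
      also have "\<dots> = 1\<^sub>m r" using dD by (intro eq_matI) auto
      finally show fr: "full_rank n r (E x * B)" by (rule full_rankI[OF EBc L])
      obtain C where C: "full_rank n r C" "vec_space.col_space n C = range_of n (E x)"
        using grassmannian_frame[OF gr[OF xT]] .
      have "vec_space.col_space n (E x * B) \<subseteq> vec_space.col_space n C"
        unfolding C(2) col_space_image[OF EBc]
      proof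
        fix w assume "w \<in> (\<lambda>v. E x * B *\<^sub>v v) ` carrier_vec r"
        then obtain v where v: "v \<in> carrier_vec r" "w = E x * B *\<^sub>v v" by auto
        have "E x *\<^sub>v w = E x * (E x * B) *\<^sub>v v"
          unfolding v(2) by (rule assoc_mult_mat_vec[OF Ec[OF xT] EBc v(1), symmetric])
        also have "E x * (E x * B) = E x * B"
          using assoc_mult_mat[OF Ec[OF xT] Ec[OF xT] B'] idem[OF xT] by simp
        finally show "w \<in> range_of n (E x)" using v EBc unfolding range_of_def by simp
      qed
      from col_space_eq_if_subset[OF fr C(1) this] show "vec_space.col_space n (E x * B) = range_of n (E x)"
        unfolding C(2) .
    qed
    have "continuous_map (subtopology T U) (frames n r) (\<lambda>x. E x * B)"
      by (rule continuous_map_into_subtopology[OF continuous_map_from_subtopology[OF EB]]) (use fr in auto)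
    moreover have "continuous_map (frames n r) (grassmannian_topology n r) (vec_space.col_space n)"
      unfolding grassmannian_topology_def by (intro quotient_imp_continuous_map quotient_map_quotient_topology)
    ultimately have "continuous_map (subtopology T U) (grassmannian_topology n r)
        (vec_space.col_space n \<circ> (\<lambda>x. E x * B))" by (rule continuous_map_compose)
    from openin_continuous_map_preimage[OF this V]
    have "openin T {x \<in> topspace (subtopology T U). (vec_space.col_space n \<circ> (\<lambda>x. E x * B)) x \<in> V}"
      using U by (simp add: openin_open_subtopology)
    moreover have "{x \<in> topspace (subtopology T U). (vec_space.col_space n \<circ> (\<lambda>x. E x * B)) x \<in> V} =
        {x \<in> U. range_of n (E x) \<in> V}"
      using col openin_subset[OF U] by auto
    ultimately show "\<exists>S. openin T S \<and> y \<in> S \<and> S \<subseteq> {x \<in> topspace T. range_of n (E x) \<in> V}"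
      using \<open>y \<in> U\<close> y openin_subset[OF U] by (intro exI[of _ "{x \<in> U. range_of n (E x) \<in> V}"]) auto
  qed
qed

section \<open>Subrepresentations as projections\<close>

lemma block_times:
  assumes "A \<in> carrier_mat n k" "B \<in> carrier_mat k m"
  shows "block i j A * block j' l B = (if j = j' then block i l (A * B) else (0 :: ('i \<times> nat, complex) fmat))"
proof (rule fmat_eqI)
  fix x y :: "'i \<times> nat"
  have "entry (block i j A * block j' l B) x y =
      (\<Sum>z\<in>{j} \<times> {..<k}. entry (block i j A) x z * entry (block j' l B) z y)"
    by (rule entry_times) (use assms in \<open>auto simp: entry_block mem_Times_iff\<close>)
  also have "\<dots> = (\<Sum>z\<in>Pair j ` {..<k}. entry (block i j A) x z * entry (block j' l B) z y)"
    by (rule sum.cong) auto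
  also have "\<dots> = (\<Sum>p<k. entry (block i j A) x (j, p) * entry (block j' l B) (j, p) y)"
    by (subst sum.reindex) (auto simp: inj_on_def)
  also have "\<dots> = entry (if j = j' then block i l (A * B) else 0) x y"
    using assms by (auto simp: entry_block times_mat_index[OF assms] simp del: index_mult_mat(1))
  finally show "entry (block i j A * block j' l B) x y = entry (if j = j' then block i l (A * B) else 0) x y" .
qed

lemma block_inject:
  assumes "block i j A = (block i j B :: ('i \<times> nat, complex) fmat)" "A \<in> carrier_mat n m" "B \<in> carrier_mat n m"
  shows "A = B"
proof (rule eq_matI)
  fix p q assume "p < dim_row B" "q < dim_col B"
  then show "A $$ (p, q) = B $$ (p, q)"
    using arg_cong[OF assms(1), of "\<lambda>X. entry X (i, p) (j, q)"] assms(2,3) by (simp add: entry_block)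
qed (use assms in auto)

lemma adj_block: "adj (block i j A) = block j i (ctr A)"
  by (rule fmat_eqI) (auto simp: entry_block ctr_def)

definition block_diag :: "('v, 'a) pre_digraph \<Rightarrow> ('v \<Rightarrow> complex mat) \<Rightarrow> (('v + 'a) \<times> nat, complex) fmat" where
  "block_diag Q P = (\<Sum>i\<in>verts Q. block (Inl i) (Inl i) (P i))"

definition diag_block :: "nat \<Rightarrow> 'v \<Rightarrow> (('v + 'a) \<times> nat, complex) fmat \<Rightarrow> complex mat" where
  "diag_block n i X = Matrix.mat n n (\<lambda>(p, q). entry X (Inl i, p) (Inl i, q))"

lemma diag_block_carrier [simp]: "diag_block n i X \<in> carrier_mat n n"
  unfolding diag_block_def by simp

locale block_families =
  fixes Q :: "('v, 'a) pre_digraph" and d :: "'v \<Rightarrow> nat"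
  assumes Q: "fin_digraph Q"
begin

sublocale fin_digraph Q by (rule Q)

abbreviation family :: "('v \<Rightarrow> complex mat) \<Rightarrow> bool" where
  "family P \<equiv> \<forall>i\<in>verts Q. P i \<in> carrier_mat (d i) (d i)"

lemma entry_block_diag:
  "entry (block_diag Q P) x y = (\<Sum>i\<in>verts Q. entry (block (Inl i) (Inl i) (P i)) x y)"
  unfolding block_diag_def by simp

lemma block_diag_block:
  assumes "family P" "B \<in> carrier_mat (d t) m" "t \<in> verts Q"
  shows "block_diag Q P * block (Inl t) l B = block (Inl t) l (P t * B)"
proof -
  have "block_diag Q P * block (Inl t) l B = (\<Sum>i\<in>verts Q. if i = t then block (Inl t) l (P t * B) else 0)"
    unfolding block_diag_def sum_distrib_right
  proof (rule sum.cong[OF refl])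
    fix i assume i: "i \<in> verts Q"
    show "block (Inl i) (Inl i) (P i) * block (Inl t) l B = (if i = t then block (Inl t) l (P t * B) else 0)"
    proof (cases "i = t")
      case True
      then show ?thesis using block_times[of "P t" "d t" "d t" B m "Inl t" "Inl t" "Inl t" l] assms by auto
    next
      case False
      have "entry (block (Inl i) (Inl i) (P i) * block (Inl t) l B) x y = 0" for x y
        by (subst entry_times[of "{}"]) (use False in \<open>auto simp: entry_block\<close>)
      then show ?thesis using False by (simp add: fmat_eqI)
    qed
  qed
  then show ?thesis using assms by simp
qed

lemma block_block_diag:
  assumes "family P" "B \<in> carrier_mat m (d t)" "t \<in> verts Q"
  shows "block l (Inl t) B * block_diag Q P = block l (Inl t) (B * P t)"
proof -
  have "block l (Inl t) B * block_diag Q P = (\<Sum>i\<in>verts Q. if i = t then block l (Inl t) (B * P t) else 0)"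
    unfolding block_diag_def sum_distrib_left
  proof (rule sum.cong[OF refl])
    fix i assume i: "i \<in> verts Q"
    show "block l (Inl t) B * block (Inl i) (Inl i) (P i) = (if i = t then block l (Inl t) (B * P t) else 0)"
    proof (cases "i = t")
      case True
      then show ?thesis using block_times[of B m "d t" "P t" "d t" l "Inl t" "Inl t" "Inl t"] assms by auto
    next
      case False
      have "entry (block l (Inl t) B * block (Inl i) (Inl i) (P i)) x y = 0" for x y
        by (subst entry_times[of "{}"]) (use False in \<open>auto simp: entry_block\<close>)
      then show ?thesis using False by (simp add: fmat_eqI)
    qed
  qed
  then show ?thesis using assms by simp
qed

lemma block_diag_times:
  assumes "family P" "family R"
  shows "block_diag Q P * block_diag Q R = block_diag Q (\<lambda>i. P i * R i)"
  unfolding block_diag_def[of Q R] sum_distrib_left block_diag_def[of Q "\<lambda>i. P i * R i"]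
  by (rule sum.cong[OF refl], rule block_diag_block) (use assms in auto)

lemma adj_block_diag: "adj (block_diag Q P) = block_diag Q (\<lambda>i. ctr (P i))"
  unfolding block_diag_def adj_sum adj_block ..

lemma rel_block_diag:
  assumes "family P"
  shows "rel (diag_slots Q d) (block_diag Q P)"
  unfolding block_diag_def
proof (rule rel_sum)
  fix i assume i: "i \<in> verts Q"
  then have "P i \<in> carrier_mat (d i) (d i)" using assms by blast
  then show "rel (diag_slots Q d) (block (Inl i) (Inl i) (P i))"
    using i by (auto simp: rel_def entry_block diag_slots_def slots_def mem_Times_iff split: if_splits)
qed

lemma diag_block_block_diag:
  assumes "family P" "i \<in> verts Q"
  shows "diag_block (d i) i (block_diag Q P) = P i"
proof (rule eq_matI)
  have c: "P i \<in> carrier_mat (d i) (d i)" using assms by blast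
  then show "dim_row (diag_block (d i) i (block_diag Q P)) = dim_row (P i)"
    "dim_col (diag_block (d i) i (block_diag Q P)) = dim_col (P i)" by (auto simp: diag_block_def)
  fix p q assume "p < dim_row (P i)" "q < dim_col (P i)"
  then have pq: "p < d i" "q < d i" using c by auto
  have "entry (block_diag Q P) (Inl i, p) (Inl i, q) = (\<Sum>j\<in>verts Q. if j = i then P i $$ (p, q) else 0)"
    unfolding entry_block_diag by (rule sum.cong) (use c pq in \<open>auto simp: entry_block\<close>)
  then show "diag_block (d i) i (block_diag Q P) $$ (p, q) = P i $$ (p, q)"
    using pq assms by (simp add: diag_block_def)
qed

lemma block_diag_diag_block:
  assumes "rel (diag_slots Q d) X"
  shows "block_diag Q (\<lambda>i. diag_block (d i) i X) = X"
proof (rule fmat_eqI)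
  fix x y :: "('v + 'a) \<times> nat"
  have e: "entry (block (Inl i) (Inl i) (diag_block (d i) i X)) x y =
      (if x \<in> slots d i \<and> y \<in> slots d i then entry X x y else 0)" for i
    by (cases x; cases y) (auto simp: entry_block diag_block_def slots_def)
  show "entry (block_diag Q (\<lambda>i. diag_block (d i) i X)) x y = entry X x y"
  proof (cases "entry X x y = 0")
    case True then show ?thesis unfolding entry_block_diag e by simp
  next
    case False
    then obtain i where i: "i \<in> verts Q" "x \<in> slots d i" "y \<in> slots d i"
      using assms unfolding rel_def diag_slots_def by blast
    then have "(\<Sum>j\<in>verts Q. if x \<in> slots d j \<and> y \<in> slots d j then entry X x y else 0) =
        (\<Sum>j\<in>verts Q. if j = i then entry X x y else 0)"
      by (intro sum.cong) (auto simp: slots_def)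
    then show ?thesis unfolding entry_block_diag e using i by simp
  qed
qed

lemma diag_block_times:
  assumes "rel (diag_slots Q d) X" "rel (diag_slots Q d) Y" "i \<in> verts Q"
  shows "diag_block (d i) i (X * Y) = diag_block (d i) i X * diag_block (d i) i Y"
proof -
  have "X * Y = block_diag Q (\<lambda>i. diag_block (d i) i X) * block_diag Q (\<lambda>i. diag_block (d i) i Y)"
    using assms by (simp add: block_diag_diag_block)
  also have "\<dots> = block_diag Q (\<lambda>i. diag_block (d i) i X * diag_block (d i) i Y)"
    by (rule block_diag_times) auto
  finally have "diag_block (d i) i (X * Y) =
      diag_block (d i) i (block_diag Q (\<lambda>i. diag_block (d i) i X * diag_block (d i) i Y))" by simp
  also have "\<dots> = diag_block (d i) i X * diag_block (d i) i Y"
    by (rule diag_block_block_diag[OF _ assms(3)]) (auto intro!: mult_carrier_mat[OF diag_block_carrier diag_block_carrier])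
  finally show ?thesis .
qed

lemma stable_block_diag_iff:
  assumes M: "M \<in> rep_space Q d" and P: "family P"
  shows "stable Q (\<lambda>a. arrow_block Q a (M a)) (block_diag Q P) \<longleftrightarrow>
    (\<forall>a\<in>arcs Q. M a * P (tail Q a) = P (head Q a) * (M a * P (tail Q a)))"
  unfolding stable_def
proof (rule ball_cong[OF refl])
  fix a assume a: "a \<in> arcs Q"
  note c = rep_space_carrier[OF M a]
  have t: "tail Q a \<in> verts Q" "head Q a \<in> verts Q" using a by auto
  then have P': "P (tail Q a) \<in> carrier_mat (d (tail Q a)) (d (tail Q a))"
    "P (head Q a) \<in> carrier_mat (d (head Q a)) (d (head Q a))" using P by blast+
  have MP: "M a * P (tail Q a) \<in> carrier_mat (d (head Q a)) (d (tail Q a))" using c P'(1) by (rule mult_carrier_mat)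
  have 1: "arrow_block Q a (M a) * block_diag Q P = arrow_block Q a (M a * P (tail Q a))"
    by (rule block_block_diag[OF P c t(1)])
  have 2: "block_diag Q P * arrow_block Q a (M a) * block_diag Q P = arrow_block Q a (P (head Q a) * (M a * P (tail Q a)))"
    unfolding mult.assoc 1 by (rule block_diag_block[OF P MP t(2)])
  show "arrow_block Q a (M a) * block_diag Q P = block_diag Q P * arrow_block Q a (M a) * block_diag Q P \<longleftrightarrow>
      M a * P (tail Q a) = P (head Q a) * (M a * P (tail Q a))"
    unfolding 1 2 using block_inject[OF _ MP mult_carrier_mat[OF P'(2) MP]] by metis
qed

end

lemma range_of_preserved_iff:
  assumes M: "M \<in> carrier_mat n m" and E: "E \<in> carrier_mat m m" "E * E = E" and F: "F \<in> carrier_mat n n"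
  shows "(\<forall>v\<in>range_of m E. M *\<^sub>v v \<in> range_of n F) \<longleftrightarrow> M * E = F * (M * E)"
proof
  have ME: "M * E \<in> carrier_mat n m" using M E(1) by (rule mult_carrier_mat)
  show "M * E = F * (M * E)" if *: "\<forall>v\<in>range_of m E. M *\<^sub>v v \<in> range_of n F"
  proof (rule mat_eqI_mult_vec[OF ME mult_carrier_mat[OF F ME]])
    fix v :: "complex Matrix.vec" assume v: "v \<in> carrier_vec m"
    have "E *\<^sub>v v \<in> range_of m E"
      using assoc_mult_mat_vec[OF E(1) E(1) v] E v unfolding range_of_def by auto
    then have "F *\<^sub>v (M *\<^sub>v (E *\<^sub>v v)) = M *\<^sub>v (E *\<^sub>v v)" using * unfolding range_of_def by blast
    then show "M * E *\<^sub>v v = F * (M * E) *\<^sub>v v"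
      using assoc_mult_mat_vec[OF M E(1) v] assoc_mult_mat_vec[OF F ME v] by simp
  qed
  show "\<forall>v\<in>range_of m E. M *\<^sub>v v \<in> range_of n F" if *: "M * E = F * (M * E)"
  proof
    fix v assume "v \<in> range_of m E"
    then have v: "v \<in> carrier_vec m" "E *\<^sub>v v = v" unfolding range_of_def by auto
    have "M *\<^sub>v v = M * E *\<^sub>v v" using assoc_mult_mat_vec[OF M E(1) v(1)] v(2) by simp
    moreover have "F *\<^sub>v (M * E *\<^sub>v v) = F * (M * E) *\<^sub>v v" using assoc_mult_mat_vec[OF F ME v(1)] by simp
    moreover have "M *\<^sub>v v \<in> carrier_vec n" using M v(1) by simp
    ultimately show "M *\<^sub>v v \<in> range_of n F" using * unfolding range_of_def by simp
  qed
qed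

text \<open>The two equations say that \<open>E\<close> has the same kernel as the Hermitian
  projection onto \<open>W\<close>. So \<open>E\<close> is injective on \<open>W\<close> and carries
  a frame \<open>A\<close> of \<open>W\<close> to a frame of its own range; the left inverse
  \<open>K\<close> of \<open>A\<close> is also one of \<open>E * A\<close>.\<close>

lemma range_of_in_grassmannian:
  assumes W: "W \<in> grassmannian n r" and E: "E \<in> carrier_mat n n"
    and PE: "grass_projection n W * E = grass_projection n W" and EP: "E * grass_projection n W = E"
  shows "range_of n E \<in> grassmannian n r"
proof -
  let ?P = "grass_projection n W"
  obtain A where A: "full_rank n r A" "vec_space.col_space n A = W" using grassmannian_frame[OF W] .
  have A': "A \<in> carrier_mat n r" using A by simp
  have P: "?P = frame_projection A" using grass_projection_col_space[OF A(1)] A(2) by simp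
  have Pc: "?P \<in> carrier_mat n n" unfolding P by (rule frame_projection_carrier[OF A(1)])
  obtain K where K: "K \<in> carrier_mat r n" "?P = A * K" "K * A = 1\<^sub>m r"
    using frame_projection_factor[OF A(1)] unfolding P by blast
  have EA: "E * A \<in> carrier_mat n r" using E A' by (rule mult_carrier_mat)
  have KP: "K * ?P = K"
    unfolding K(2) using assoc_mult_mat[OF K(1) A' K(1)] K(1,3) by simp
  have "K * (E * A) = K * ?P * (E * A)" using KP by simp
  also have "\<dots> = K * (?P * (E * A))" by (rule assoc_mult_mat[OF K(1) Pc EA])
  also have "?P * (E * A) = A"
    using assoc_mult_mat[OF Pc E A'] PE frame_projection_frame[OF A(1)] P by simp
  finally have fr: "full_rank n r (E * A)" using full_rankI[OF EA K(1)] K(3) by simp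
  have "vec_space.col_space n (E * A) = range_of n E"
    unfolding col_space_image[OF EA]
  proof (intro equalityI subsetI)
    fix w assume "w \<in> (\<lambda>v. E * A *\<^sub>v v) ` carrier_vec r"
    then obtain v where v: "v \<in> carrier_vec r" "w = E * A *\<^sub>v v" by auto
    have "E * (E * A) = E * A"
    proof -
      have "E * E = E * ?P * E" using EP by simp
      also have "\<dots> = E * (?P * E)" by (rule assoc_mult_mat[OF E Pc E])
      also have "\<dots> = E" using PE EP by simp
      finally show ?thesis using assoc_mult_mat[OF E E A'] by simp
    qed
    then show "w \<in> range_of n E"
      using assoc_mult_mat_vec[OF E EA v(1)] v EA unfolding range_of_def by auto
  next
    fix w assume "w \<in> range_of n E"
    then have w: "w \<in> carrier_vec n" "E *\<^sub>v w = w" unfolding range_of_def by auto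
    have Kw: "K *\<^sub>v w \<in> carrier_vec r" using K(1) w(1) by auto
    have "E * A *\<^sub>v (K *\<^sub>v w) = E *\<^sub>v (A *\<^sub>v (K *\<^sub>v w))" by (rule assoc_mult_mat_vec[OF E A' Kw])
    also have "A *\<^sub>v (K *\<^sub>v w) = ?P *\<^sub>v w" unfolding K(2) by (rule assoc_mult_mat_vec[OF A' K(1) w(1), symmetric])
    also have "E *\<^sub>v (?P *\<^sub>v w) = w" using assoc_mult_mat_vec[OF E Pc w(1)] EP w(2) by simp
    finally show "w \<in> (\<lambda>v. E * A *\<^sub>v v) ` carrier_vec r"
      using Kw by (intro image_eqI[of _ _ "K *\<^sub>v w"]) auto
  qed
  then show ?thesis using col_space_in_grassmannian[OF fr] by simp
qed

section \<open>Homotopy equivalence of nearby quiver Grassmannians\<close>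

lemma block_eq_sum_munit:
  assumes "A \<in> carrier_mat n m"
  shows "block i j A = (\<Sum>p<n. \<Sum>q<m. munit (i, p) (j, q) (A $$ (p, q)))"
proof (rule fmat_eqI)
  fix x y
  have "(\<Sum>p<n. \<Sum>q<m. if x = (i, p) \<and> y = (j, q) then A $$ (p, q) else 0) =
      (if fst x = i \<and> fst y = j then \<Sum>p<n. if p = snd x then \<Sum>q<m. if q = snd y then A $$ (p, q) else 0 else 0 else 0)"
  proof (cases "fst x = i \<and> fst y = j")
    case True
    have "(if x = (i, p) \<and> y = (j, q) then A $$ (p, q) else 0) =
        (if p = snd x then if q = snd y then A $$ (p, q) else 0 else 0)" for p q
      using True by (cases x; cases y) auto
    moreover have "(\<Sum>q<m. if p = snd x then if q = snd y then A $$ (p, q) else 0 else 0) =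
        (if p = snd x then \<Sum>q<m. if q = snd y then A $$ (p, q) else 0 else 0)" for p
      by simp
    ultimately show ?thesis using True by (simp only: simp_thms if_True)
  next
    case False
    then show ?thesis by (cases x; cases y) (auto intro!: sum.neutral)
  qed
  also have "\<dots> = entry (block i j A) x y"
    using assms by (auto simp: entry_block)
  finally show "entry (block i j A) x y = entry (\<Sum>p<n. \<Sum>q<m. munit (i, p) (j, q) (A $$ (p, q))) x y"
    by simp
qed

lemma continuous_map_block:
  fixes A :: "'x \<Rightarrow> complex mat"
  assumes "continuous_map T (mat_topology n m) A"
  shows "continuous_map T euclidean (\<lambda>x. block i j (A x) :: ('i \<times> nat, complex) fmat)"
proof (rule continuous_map_eq)
  note A = assms[unfolded continuous_map_mat_topology]
  show "continuous_map T euclidean (\<lambda>x. \<Sum>p<n. \<Sum>q<m. munit (i, p) (j, q) (A x $$ (p, q)) :: ('i \<times> nat, complex) fmat)"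
  proof (intro continuous_map_sum)
    fix p q assume "p \<in> {..<n}" "q \<in> {..<m}"
    then show "continuous_map T euclidean (\<lambda>x. munit (i, p) (j, q) (A x $$ (p, q)) :: ('i \<times> nat, complex) fmat)"
      by (intro continuous_map_comp_continuous[of T _ "munit (i, p) (j, q)"]
          bounded_linear.continuous_on[OF bounded_linear_munit] continuous_intros) (use A in auto)
  qed auto
  show "(\<Sum>p<n. \<Sum>q<m. munit (i, p) (j, q) (A x $$ (p, q))) = block i j (A x)" if "x \<in> topspace T" for x
    using A that by (intro block_eq_sum_munit[symmetric]) auto
qed

lemma continuous_map_diag_block:
  assumes "continuous_map T euclidean X"
  shows "continuous_map T (mat_topology n n) (\<lambda>x. diag_block n i (X x))"
  unfolding continuous_map_mat_topology
proof (intro conjI ballI allI impI)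
  fix p q assume "p < n" "q < n"
  then have "(\<lambda>x. diag_block n i (X x) $$ (p, q)) = (\<lambda>x. entry (X x) (Inl i, p) (Inl i, q))"
    by (simp add: diag_block_def fun_eq_iff)
  moreover have "continuous_map T euclidean (\<lambda>x. entry (X x) (Inl i, p) (Inl i, q))"
    by (rule continuous_map_comp_continuous[OF assms bounded_linear.continuous_on[OF bounded_linear_entry]])
      (rule continuous_on_id)
  ultimately show "continuous_map T euclidean (\<lambda>x. diag_block n i (X x) $$ (p, q))" by simp
qed simp

lemma continuous_map_euclidean_Pair:
  assumes "continuous_map T euclidean f" "continuous_map T euclidean g"
  shows "continuous_map T euclidean (\<lambda>x. (f x, g x))"
  using continuous_map_pairedI[OF assms] by simp

context block_families
begin

definition subspace_projection :: "('v \<Rightarrow> complex Matrix.vec set) \<Rightarrow> (('v + 'a) \<times> nat, complex) fmat" where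
  "subspace_projection W = block_diag Q (\<lambda>i. grass_projection (d i) (W i))"

definition subspaces_of :: "(('v + 'a) \<times> nat, complex) fmat \<Rightarrow> 'v \<Rightarrow> complex Matrix.vec set" where
  "subspaces_of E = (\<lambda>i\<in>verts Q. range_of (d i) (diag_block (d i) i E))"

definition rep_matrices :: "('a \<Rightarrow> complex mat) \<Rightarrow> 'a \<Rightarrow> (('v + 'a) \<times> nat, complex) fmat" where
  "rep_matrices M = (\<lambda>a. arrow_block Q a (M a))"

definition subspace_space :: "('v \<Rightarrow> nat) \<Rightarrow> ('v \<Rightarrow> complex Matrix.vec set) topology" where
  "subspace_space e = product_topology (\<lambda>i. grassmannian_topology (d i) (e i)) (verts Q)"

lemma topspace_subspace_space: "topspace (subspace_space e) = (\<Pi>\<^sub>E i\<in>verts Q. grassmannian (d i) (e i))"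
  unfolding subspace_space_def by (simp add: topspace_grassmannian_topology)

context
  fixes e :: "'v \<Rightarrow> nat" and W :: "'v \<Rightarrow> complex Matrix.vec set"
  assumes W: "W \<in> topspace (subspace_space e)"
begin

lemma W_grassmannian: "i \<in> verts Q \<Longrightarrow> W i \<in> grassmannian (d i) (e i)"
  using W unfolding topspace_subspace_space by auto

lemma family_grass_projection: "family (\<lambda>i. grass_projection (d i) (W i))"
  using W_grassmannian grass_projection_carrier by blast

lemma diag_block_subspace_projection:
  "i \<in> verts Q \<Longrightarrow> diag_block (d i) i (subspace_projection W) = grass_projection (d i) (W i)"
  unfolding subspace_projection_def by (rule diag_block_block_diag[OF family_grass_projection])

lemma block_diag_cong: "(\<And>i. i \<in> verts Q \<Longrightarrow> P i = R i) \<Longrightarrow> block_diag Q P = block_diag Q R"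
  unfolding block_diag_def by simp

lemma subspace_projection_in_projections: "subspace_projection W \<in> projections Q d"
  unfolding projections_def
proof (intro CollectI conjI)
  show "rel (diag_slots Q d) (subspace_projection W)"
    unfolding subspace_projection_def by (rule rel_block_diag[OF family_grass_projection])
  show "subspace_projection W * subspace_projection W = subspace_projection W"
    unfolding subspace_projection_def block_diag_times[OF family_grass_projection family_grass_projection]
    by (rule block_diag_cong) (rule grass_projection_idem[OF W_grassmannian])
  show "adj (subspace_projection W) = subspace_projection W"
    unfolding subspace_projection_def adj_block_diag
    by (rule block_diag_cong) (rule grass_projection_hermitian[OF W_grassmannian])
qed

lemma subspaces_of_subspace_projection: "subspaces_of (subspace_projection W) = W"
proof (rule extensionalityI[of _ "verts Q"])
  show "subspaces_of (subspace_projection W) \<in> extensional (verts Q)" unfolding subspaces_of_def by simp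
  show "W \<in> extensional (verts Q)" using W unfolding topspace_subspace_space by (auto simp: PiE_def)
  show "subspaces_of (subspace_projection W) i = W i" if "i \<in> verts Q" for i
    using that range_of_grass_projection[OF W_grassmannian[OF that]]
    by (simp add: subspaces_of_def diag_block_subspace_projection)
qed

lemma subreps_iff_stable:
  assumes M: "M \<in> rep_space Q d"
  shows "W \<in> subreps Q d M e \<longleftrightarrow> stable Q (rep_matrices M) (subspace_projection W)"
proof -
  have "(\<forall>v\<in>W (tail Q a). M a *\<^sub>v v \<in> W (head Q a)) \<longleftrightarrow>
      M a * grass_projection (d (tail Q a)) (W (tail Q a)) =
      grass_projection (d (head Q a)) (W (head Q a)) * (M a * grass_projection (d (tail Q a)) (W (tail Q a)))"
    if a: "a \<in> arcs Q" for a
  proof -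
    note t = W_grassmannian[OF tail_in_verts[OF a]] and h = W_grassmannian[OF head_in_verts[OF a]]
    show ?thesis
      using range_of_preserved_iff[OF rep_space_carrier[OF M a] grass_projection_carrier[OF t]
          grass_projection_idem[OF t] grass_projection_carrier[OF h]]
      unfolding range_of_grass_projection[OF t] range_of_grass_projection[OF h] .
  qed
  then show ?thesis
    using W unfolding topspace_subspace_space subreps_def rep_matrices_def subspace_projection_def
      stable_block_diag_iff[OF M family_grass_projection] by auto
qed

text \<open>Vertex by vertex, \<open>E\<close> is an idempotent with the same kernel as the
  projection onto \<open>W\<close>, so its ranges keep the dimension vector \<open>e\<close>. It
  need not be Hermitian, which is why \<open>continuous_map_range_of\<close> treats all
  idempotents.\<close>

lemma deformed_idempotent:
  assumes g: "rel (diag_slots Q d) g" "subspace_projection W * g = 0" "g * subspace_projection W = g"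
  defines "E \<equiv> subspace_projection W + g"
  shows "\<And>i. i \<in> verts Q \<Longrightarrow> diag_block (d i) i E * diag_block (d i) i E = diag_block (d i) i E"
    and "\<And>i. i \<in> verts Q \<Longrightarrow> range_of (d i) (diag_block (d i) i E) \<in> grassmannian (d i) (e i)"
    and "\<And>M. M \<in> rep_space Q d \<Longrightarrow> stable Q (rep_matrices M) E \<Longrightarrow> subspaces_of E \<in> subreps Q d M e"
proof -
  let ?P = "subspace_projection W"
  have P: "rel (diag_slots Q d) ?P" "?P * ?P = ?P" using subspace_projection_in_projections unfolding projections_def by auto
  have E: "rel (diag_slots Q d) E" unfolding E_def by (rule rel_plus[OF P(1) g(1)])
  have PE: "?P * E = ?P" and EP: "E * ?P = E"
    unfolding E_def using P g by (simp_all add: distrib_left distrib_right)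
  have EE: "E * E = E"
  proof -
    have "E * E = E * (?P * E)" using EP by (metis mult.assoc)
    then show ?thesis using PE EP by simp
  qed
  show idem: "diag_block (d i) i E * diag_block (d i) i E = diag_block (d i) i E" if "i \<in> verts Q" for i
    using diag_block_times[OF E E that] EE by simp
  show gr: "range_of (d i) (diag_block (d i) i E) \<in> grassmannian (d i) (e i)" if i: "i \<in> verts Q" for i
    by (rule range_of_in_grassmannian[OF W_grassmannian[OF i] diag_block_carrier])
      (use diag_block_times[OF P(1) E i] diag_block_times[OF E P(1) i] PE EP
        diag_block_subspace_projection[OF i] in simp_all)
  show "subspaces_of E \<in> subreps Q d M e" if M: "M \<in> rep_space Q d" and st: "stable Q (rep_matrices M) E" for M
    unfolding subreps_def
  proof (intro CollectI conjI ballI)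
    show "subspaces_of E \<in> (\<Pi>\<^sub>E i\<in>verts Q. grassmannian (d i) (e i))"
      using gr unfolding subspaces_of_def by auto
    fix a v assume a: "a \<in> arcs Q" and v: "v \<in> subspaces_of E (tail Q a)"
    have "stable Q (\<lambda>a. arrow_block Q a (M a)) (block_diag Q (\<lambda>i. diag_block (d i) i E))"
      using st unfolding rep_matrices_def block_diag_diag_block[OF E] .
    then have "M a * diag_block (d (tail Q a)) (tail Q a) E =
        diag_block (d (head Q a)) (head Q a) E * (M a * diag_block (d (tail Q a)) (tail Q a) E)"
      using stable_block_diag_iff[OF M, of "\<lambda>i. diag_block (d i) i E"] a by auto
    then show "M a *\<^sub>v v \<in> subspaces_of E (head Q a)"
      using range_of_preserved_iff[OF rep_space_carrier[OF M a] diag_block_carrier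
          idem[OF tail_in_verts[OF a]] diag_block_carrier, of "head Q a" E] v a
      unfolding subspaces_of_def by auto
  qed
qed

end

lemma continuous_map_subspace_projection:
  assumes "continuous_map T (subspace_space e) w"
  shows "continuous_map T euclidean (\<lambda>x. subspace_projection (w x))"
  unfolding subspace_projection_def block_diag_def
proof (rule continuous_map_sum)
  fix i assume i: "i \<in> verts Q"
  then have "continuous_map T (grassmannian_topology (d i) (e i)) (\<lambda>x. w x i)"
    using assms unfolding subspace_space_def continuous_map_componentwise by blast
  from continuous_map_compose[OF this continuous_map_grass_projection]
  show "continuous_map T euclidean (\<lambda>x. block (Inl i) (Inl i) (grass_projection (d i) (w x i)) :: (('v + 'a) \<times> nat, complex) fmat)"
    by (intro continuous_map_block) (simp add: o_def)
qed simp

lemma continuous_rep_matrices_line: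
  assumes "M \<in> rep_space Q d" "N \<in> rep_space Q d" "a \<in> arcs Q"
  shows "continuous_on UNIV (\<lambda>z. rep_matrices (rep_line Q M N z) a)"
proof -
  have "continuous_map euclidean (mat_topology (d (head Q a)) (d (tail Q a))) (\<lambda>z. rep_line Q M N z a)"
    unfolding continuous_map_mat_topology
  proof (intro conjI ballI allI impI)
    show "rep_line Q M N z a \<in> carrier_mat (d (head Q a)) (d (tail Q a))" for z
      using rep_space_carrier[OF rep_line_in_rep_space[OF assms(1,2)] assms(3)] .
    fix i j assume "i < d (head Q a)" "j < d (tail Q a)"
    then show "continuous_map euclidean euclidean (\<lambda>z. rep_line Q M N z a $$ (i, j))"
      by (simp add: rep_line_index[OF assms]) (intro continuous_intros)
  qed
  from continuous_map_block[OF this] show ?thesis unfolding rep_matrices_def by simp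
qed

lemma rel_rep_matrices:
  assumes "M \<in> rep_space Q d" "a \<in> arcs Q"
  shows "rel (arrow_slots Q d a) (rep_matrices M a)"
  using rep_space_carrier[OF assms]
  by (auto simp: rel_def rep_matrices_def entry_block slots_def mem_Times_iff split: if_splits)

text \<open>The map \<open>\<rho> z\<close> moves every family of subspaces with projection in
  \<open>\<N>\<close> to a subrepresentation of \<open>rep_line Q M N z\<close> and fixes those that
  are subrepresentations of it already. Between any two points of the ball these maps are mutually
  inverse up to homotopy.\<close>

lemma nearby_quiver_grassmannians:
  assumes M: "M \<in> rep_space Q d" and N: "N \<in> rep_space Q d"
    and unobs: "\<not> obstructed Q d (rep_matrices (rep_line Q M N z0))"
  shows "\<exists>r>0. \<forall>z\<in>ball z0 r. \<forall>e. quiver_grassmannian Q d (rep_line Q M N z0) e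
    homotopy_equivalent_space quiver_grassmannian Q d (rep_line Q M N z) e"
proof -
  let ?L = "rep_line Q M N"
  have L: "?L z \<in> rep_space Q d" for z by (rule rep_line_in_rep_space[OF M N])
  obtain r \<N> g where r: "r > 0" and sub: "\<N> \<subseteq> projections Q d"
    and near: "\<And>z P. z \<in> ball z0 r \<Longrightarrow> P \<in> projections Q d \<Longrightarrow> stable Q (rep_matrices (?L z)) P \<Longrightarrow> P \<in> \<N>"
    and cont: "continuous_on (ball z0 r \<times> \<N>) (\<lambda>q. g (fst q) (snd q))"
    and g: "\<And>z P. z \<in> ball z0 r \<Longrightarrow> P \<in> \<N> \<Longrightarrow> rel (diag_slots Q d) (g z P) \<and> P * g z P = 0 \<and>
      g z P * P = g z P \<and> stable Q (rep_matrices (?L z)) (P + g z P)"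
    and g0: "\<And>z P. z \<in> ball z0 r \<Longrightarrow> P \<in> \<N> \<Longrightarrow> stable Q (rep_matrices (?L z)) P \<Longrightarrow> g z P = 0"
    by (rule local_deformation[OF Q continuous_rep_matrices_line[OF M N] rel_rep_matrices[OF L] unobs]) blast+
  define \<rho> where "\<rho> z W = subspaces_of (subspace_projection W + g z (subspace_projection W))" for z W
  have "quiver_grassmannian Q d (?L z0) e homotopy_equivalent_space quiver_grassmannian Q d (?L z1) e"
    if z1: "z1 \<in> ball z0 r" for z1 e
  proof -
    define X where "X z = quiver_grassmannian Q d (?L z) e" for z
    have X: "X z = subtopology (subspace_space e) (subreps Q d (?L z) e)" for z
      unfolding X_def quiver_grassmannian_def subspace_space_def ..
    have topX: "topspace (X z) = subreps Q d (?L z) e" for z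
      unfolding X_def by (rule topspace_quiver_grassmannian)
    have XY: "W \<in> topspace (subspace_space e)" if "W \<in> topspace (X z)" for W z
      using that unfolding X by simp
    have XN: "subspace_projection W \<in> \<N>" if "W \<in> topspace (X z)" "z \<in> ball z0 r" for W z
      using near[OF that(2) subspace_projection_in_projections[OF XY[OF that(1)]]]
        subreps_iff_stable[OF XY[OF that(1)] L] that(1) unfolding topX by blast
    have \<rho>X: "\<rho> z W \<in> topspace (X z)"
      if "W \<in> topspace (subspace_space e)" "subspace_projection W \<in> \<N>" "z \<in> ball z0 r" for z W
      unfolding topX \<rho>_def using g[OF that(3,2)] by (intro deformed_idempotent(3)[OF that(1)] L) auto
    have \<rho>_id: "\<rho> z W = W" if "W \<in> topspace (X z)" "z \<in> ball z0 r" for z W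
    proof -
      have "g z (subspace_projection W) = 0"
        using g0[OF that(2) XN[OF that]] subreps_iff_stable[OF XY[OF that(1)] L] that(1) unfolding topX by blast
      then show ?thesis unfolding \<rho>_def by (simp add: subspaces_of_subspace_projection[OF XY[OF that(1)]])
    qed
    \<comment> \<open>Stated for an arbitrary source \<open>T\<close> and with both arguments
      varying, since it is applied to a Grassmannian and to the product of an interval with
      one.\<close>
    have \<rho>_cont: "continuous_map T (subspace_space e) (\<lambda>x. \<rho> (\<zeta> x) (w x))"
      if \<zeta>: "continuous_map T euclidean \<zeta>" "\<And>x. x \<in> topspace T \<Longrightarrow> \<zeta> x \<in> ball z0 r"
        and w: "continuous_map T (subspace_space e) w" "\<And>x. x \<in> topspace T \<Longrightarrow> subspace_projection (w x) \<in> \<N>"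
      for T :: "'t topology" and \<zeta> w
    proof -
      let ?P = "\<lambda>x. subspace_projection (w x)"
      have wT: "w x \<in> topspace (subspace_space e)" if "x \<in> topspace T" for x
        using continuous_map_image_subset_topspace[OF w(1)] that by blast
      have P: "continuous_map T euclidean ?P" by (rule continuous_map_subspace_projection[OF w(1)])
      have "continuous_map T (top_of_set (ball z0 r \<times> \<N>)) (\<lambda>x. (\<zeta> x, ?P x))"
        by (rule continuous_map_into_subtopology[OF continuous_map_euclidean_Pair[OF \<zeta>(1) P]])
          (use \<zeta>(2) w(2) in auto)
      then have "continuous_map T euclidean ((\<lambda>q. g (fst q) (snd q)) \<circ> (\<lambda>x. (\<zeta> x, ?P x)))"
        using cont by (intro continuous_map_compose) (auto simp: continuous_map_iff_continuous)
      then have "continuous_map T euclidean (\<lambda>x. ?P x + g (\<zeta> x) (?P x))"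
        using P by (intro continuous_map_add) (auto simp: o_def)
      note E = continuous_map_diag_block[OF this]
      show ?thesis
        unfolding subspace_space_def continuous_map_componentwise
      proof (intro conjI ballI)
        show "(\<lambda>x. \<rho> (\<zeta> x) (w x)) ` topspace T \<subseteq> extensional (verts Q)" unfolding \<rho>_def subspaces_of_def by auto
        fix i assume i: "i \<in> verts Q"
        have "continuous_map T (grassmannian_topology (d i) (e i))
            (\<lambda>x. range_of (d i) (diag_block (d i) i (?P x + g (\<zeta> x) (?P x))))"
          by (rule continuous_map_range_of[OF E])
            (use deformed_idempotent(1,2)[OF wT _ _ _ i] g \<zeta>(2) w(2) in auto)
        then show "continuous_map T (grassmannian_topology (d i) (e i)) (\<lambda>x. \<rho> (\<zeta> x) (w x) i)"
          using i by (simp add: \<rho>_def subspaces_of_def)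
      qed
    qed
    have into_X: "continuous_map T (X z) h"
      if "continuous_map T (subspace_space e) h" "\<And>x. x \<in> topspace T \<Longrightarrow> h x \<in> topspace (X z)"
      for T :: "'t topology" and h z
      using that unfolding X by (intro continuous_map_into_subtopology) auto
    have idY: "continuous_map (X z) (subspace_space e) (\<lambda>W. W)" for z
      unfolding X by (rule continuous_map_from_subtopology) (rule continuous_map_id[unfolded id_def])
    have map: "continuous_map (X u) (X v) (\<rho> v)" if uv: "u \<in> ball z0 r" "v \<in> ball z0 r" for u v
    proof (rule into_X)
      show "continuous_map (X u) (subspace_space e) (\<rho> v)"
        by (rule \<rho>_cont[of "X u" "\<lambda>_. v" "\<lambda>W. W"]) (use idY XN[OF _ uv(1)] uv(2) in auto)
      show "\<rho> v x \<in> topspace (X v)" if "x \<in> topspace (X u)" for x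
        by (rule \<rho>X[OF XY[OF that] XN[OF that uv(1)] uv(2)])
    qed
    \<comment> \<open>The homotopy is \<open>\<rho> u \<circ> \<rho> w\<close> with \<open>w\<close>
      on the segment from \<open>u\<close> to \<open>v\<close>; at \<open>w = u\<close> it is the
      identity because \<open>\<rho> u\<close> fixes \<open>X u\<close>. The ball is convex, so
      \<open>w\<close> stays in it, and the intermediate families are subrepresentations for
      \<open>w\<close>, hence in the domain of \<open>\<rho> u\<close>.\<close>
    have hom: "homotopic_with (\<lambda>_. True) (X u) (X u) (\<rho> u \<circ> \<rho> v) id" if uv: "u \<in> ball z0 r" "v \<in> ball z0 r" for u v
    proof -
      define T where "T = prod_topology (top_of_set {0..1 :: real}) (X u)"
      define \<zeta> where "\<zeta> q = u + of_real (fst q) * (v - u)" for q :: "real \<times> ('v \<Rightarrow> complex Matrix.vec set)"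
      have \<zeta>_ball: "\<zeta> q \<in> ball z0 r" if "q \<in> topspace T" for q
      proof -
        have "\<zeta> q = (1 - fst q) *\<^sub>R u + fst q *\<^sub>R v" unfolding \<zeta>_def by (simp add: scaleR_conv_of_real algebra_simps)
        then show ?thesis
          using that convexD[OF convex_ball uv, of "1 - fst q" "fst q"] unfolding T_def by auto
      qed
      have qX: "snd q \<in> topspace (X u)" if "q \<in> topspace T" for q using that unfolding T_def by auto
      have fst: "continuous_map T euclidean (\<lambda>q. fst q :: real)"
        unfolding T_def using continuous_map_fst continuous_map_in_subtopology by blast
      have \<zeta>: "continuous_map T euclidean \<zeta>"
        unfolding \<zeta>_def by (rule continuous_map_comp_continuous[OF fst, of "\<lambda>t. u + of_real t * (v - u)"]) (intro continuous_intros)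
      have snd: "continuous_map T (X u) snd" unfolding T_def by (rule continuous_map_snd)
      have sndY: "continuous_map T (subspace_space e) snd"
        using continuous_map_compose[OF snd idY] by (simp add: o_def)
      have N1: "subspace_projection (snd q) \<in> \<N>" if "q \<in> topspace T" for q using XN[OF qX[OF that] uv(1)] .
      have \<rho>\<zeta>: "\<rho> (\<zeta> q) (snd q) \<in> topspace (X (\<zeta> q))" if "q \<in> topspace T" for q
        using \<rho>X[OF XY[OF qX[OF that]] N1[OF that] \<zeta>_ball[OF that]] .
      have inner: "continuous_map T (subspace_space e) (\<lambda>q. \<rho> (\<zeta> q) (snd q))"
        by (rule \<rho>_cont[OF \<zeta> \<zeta>_ball sndY N1])
      have N2: "subspace_projection (\<rho> (\<zeta> q) (snd q)) \<in> \<N>" if "q \<in> topspace T" for q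
        using XN[OF \<rho>\<zeta>[OF that] \<zeta>_ball[OF that]] .
      have "continuous_map T (X u) (\<lambda>q. \<rho> u (\<rho> (\<zeta> q) (snd q)))"
      proof (rule into_X)
        show "continuous_map T (subspace_space e) (\<lambda>q. \<rho> u (\<rho> (\<zeta> q) (snd q)))"
          by (rule \<rho>_cont[of T "\<lambda>_. u", OF _ _ inner N2]) (use uv(1) in auto)
        show "\<rho> u (\<rho> (\<zeta> q) (snd q)) \<in> topspace (X u)" if "q \<in> topspace T" for q
          by (rule \<rho>X[OF XY[OF \<rho>\<zeta>[OF that]] N2[OF that] uv(1)])
      qed
      then have "homotopic_with (\<lambda>_. True) (X u) (X u) id (\<rho> u \<circ> \<rho> v)"
        unfolding T_def
        by (subst homotopic_with)
          (auto intro!: exI[of _ "\<lambda>q. \<rho> u (\<rho> (\<zeta> q) (snd q))"] simp: \<zeta>_def \<rho>_id[OF _ uv(1)])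
      then show ?thesis by (rule homotopic_with_symD)
    qed
    have z0: "z0 \<in> ball z0 r" using r by simp
    have "X z0 homotopy_equivalent_space X z1"
      unfolding homotopy_equivalent_space_def
      using map[OF z0 z1] map[OF z1 z0] hom[OF z0 z1] hom[OF z1 z0] by blast
    then show ?thesis unfolding X_def .
  qed
  then show ?thesis using r by blast
qed

end

section \<open>Betti numbers\<close>

lemma hom_finprod_image:
  assumes "comm_group G" "comm_group H" "\<phi> \<in> hom G H" "f \<in> S \<rightarrow> carrier G"
  shows "\<phi> (finprod G f S) = finprod H (\<lambda>x. \<phi> (f x)) S"
proof -
  interpret G: comm_group G by fact
  interpret H: comm_group H by fact
  interpret group_hom G H \<phi>
    using assms(3) by (simp add: group_hom_def group_hom_axioms_def G.group_axioms H.group_axioms)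
  show ?thesis
    using assms(4)
  proof (induction S rule: infinite_finite_induct)
    case (insert x F)
    have "\<phi> (f y) \<in> carrier H" if "y \<in> insert x F" for y
      using insert.prems that by (meson Pi_mem hom_closed)
    then have "(\<lambda>x. \<phi> (f x)) \<in> F \<rightarrow> carrier H" "\<phi> (f x) \<in> carrier H" by auto
    then show ?case using insert by simp
  qed auto
qed

lemma int_independent_image:
  fixes G :: "('x, 'm) monoid_scheme" and H :: "('y, 'n) monoid_scheme"
  assumes G: "comm_group G" and H: "comm_group H" and \<phi>: "\<phi> \<in> iso G H" and S: "int_independent G S"
  shows "int_independent H (\<phi> ` S) \<and> card (\<phi> ` S) = card S"
proof -
  interpret G: comm_group G by fact
  interpret H: comm_group H by fact
  have \<phi>h: "\<phi> \<in> hom G H" and bij: "bij_betw \<phi> (carrier G) (carrier H)" using \<phi> by (auto simp: iso_def)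
  interpret group_hom G H \<phi>
    using \<phi>h by (simp add: group_hom_def group_hom_axioms_def G.group_axioms H.group_axioms)
  have SG: "finite S" "S \<subseteq> carrier G" using S unfolding int_independent_def by auto
  have inj: "inj_on \<phi> S" using bij SG(2) inj_on_subset unfolding bij_betw_def by blast
  have "c y = 0" if fp: "finprod H (\<lambda>y. y [^]\<^bsub>H\<^esub> c y) (\<phi> ` S) = \<one>\<^bsub>H\<^esub>" and y: "y \<in> \<phi> ` S" for c :: "'y \<Rightarrow> int" and y
  proof -
    have "finprod H (\<lambda>y. y [^]\<^bsub>H\<^esub> c y) (\<phi> ` S) = finprod H (\<lambda>x. \<phi> x [^]\<^bsub>H\<^esub> c (\<phi> x)) S"
      by (rule H.finprod_reindex) (use SG inj in auto)
    also have "\<dots> = finprod H (\<lambda>x. \<phi> (x [^]\<^bsub>G\<^esub> c (\<phi> x))) S"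
      by (rule H.finprod_cong) (use SG in \<open>auto simp: group_hom.hom_int_pow[OF group_hom_axioms] simp_implies_def\<close>)
    also have "\<dots> = \<phi> (finprod G (\<lambda>x. x [^]\<^bsub>G\<^esub> c (\<phi> x)) S)"
      by (rule hom_finprod_image[OF G H \<phi>h, symmetric]) (use SG in auto)
    finally have "\<phi> (finprod G (\<lambda>x. x [^]\<^bsub>G\<^esub> c (\<phi> x)) S) = \<phi> \<one>\<^bsub>G\<^esub>" using fp by simp
    moreover have "finprod G (\<lambda>x. x [^]\<^bsub>G\<^esub> c (\<phi> x)) S \<in> carrier G" by (rule G.finprod_closed) (use SG in auto)
    ultimately have "finprod G (\<lambda>x. x [^]\<^bsub>G\<^esub> c (\<phi> x)) S = \<one>\<^bsub>G\<^esub>"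
      using bij unfolding bij_betw_def by (meson G.one_closed inj_onD)
    then have "\<forall>x\<in>S. c (\<phi> x) = 0"
      using S[unfolded int_independent_def, THEN conjunct2, THEN conjunct2, THEN spec[of _ "c \<circ> \<phi>"]] by simp
    then show ?thesis using y by auto
  qed
  then show ?thesis
    unfolding int_independent_def using SG inj by (auto simp: card_image)
qed

lemma abelian_rank_iso:
  assumes "comm_group G" "comm_group H" "G \<cong> H"
  shows "abelian_rank G = abelian_rank H"
proof -
  have sub: "card ` {S. int_independent G S} \<subseteq> card ` {S. int_independent H S}"
    if G: "comm_group G" "comm_group H" "G \<cong> H" for G :: "('x, 'm) monoid_scheme" and H :: "('y, 'n) monoid_scheme"
  proof -
    obtain \<phi> where "\<phi> \<in> iso G H" using G(3) unfolding is_iso_def by blast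
    from int_independent_image[OF G(1,2) this] show ?thesis by force
  qed
  have "H \<cong> G" using assms by (simp add: group.iso_sym comm_group_def)
  then have "card ` {S. int_independent G S} = card ` {S. int_independent H S}"
    using sub[OF assms] sub[OF assms(2,1)] by blast
  then show ?thesis unfolding abelian_rank_def by simp
qed

lemma euler_characteristic_homotopy_invariant:
  assumes "X homotopy_equivalent_space Y"
  shows "euler_characteristic X = euler_characteristic Y"
proof -
  have "betti p X = betti p Y" for p
    unfolding betti_def
    by (intro abelian_rank_iso abelian_homology_group homotopy_equivalent_space_imp_isomorphic_homology_groups assms)
  then show ?thesis unfolding euler_characteristic_def by simp
qed


section \<open>Generic constancy\<close>

lemma quiver_grassmannians_equivalent:
  assumes Q: "fin_digraph Q" and f: "f \<in> rep_poly_functions Q d"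
    and unobs: "\<And>M. M \<in> rep_space Q d \<Longrightarrow> f M \<noteq> 0 \<Longrightarrow> \<not> obstructed Q d (\<lambda>a. arrow_block Q a (M a))"
    and M: "M \<in> rep_space Q d" "f M \<noteq> 0" and N: "N \<in> rep_space Q d" "f N \<noteq> 0"
  shows "quiver_grassmannian Q d M e homotopy_equivalent_space quiver_grassmannian Q d N e"
proof -
  interpret block_families Q d by (rule block_families.intro) (rule Q)
  let ?L = "rep_line Q M N"
  obtain p where p: "\<And>z. f (?L z) = poly p z" using rep_poly_on_line[OF f M(1) N(1)] by blast
  define Z where "Z = - {z. poly p z = 0}"
  have L: "?L 0 = M" "?L 1 = N" by (rule rep_line_0_1[OF M(1) N(1)])+
  have "p \<noteq> 0" using p[of 0] M(2) L by auto
  then have "finite {z. poly p z = 0}" by (rule poly_roots_finite)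
  then have conn: "topological_space_class.connected Z"
    unfolding Z_def by (intro path_connected_imp_connected path_connected_complement_countable) (auto intro: countable_finite)
  have Z01: "0 \<in> Z" "1 \<in> Z" using p[of 0] p[of 1] M(2) N(2) L unfolding Z_def by auto
  define R where "R z w \<longleftrightarrow> quiver_grassmannian Q d (?L z) e homotopy_equivalent_space
      quiver_grassmannian Q d (?L w) e" for z w
  have local: "\<exists>T. openin (top_of_set Z) T \<and> z \<in> T \<and> (\<forall>w\<in>T. R z w)" if z: "z \<in> Z" for z
  proof -
    have "f (?L z) \<noteq> 0" using z p[of z] unfolding Z_def by simp
    then have "\<not> obstructed Q d (rep_matrices (?L z))"
      unfolding rep_matrices_def by (rule unobs[OF rep_line_in_rep_space[OF M(1) N(1)]])
    from nearby_quiver_grassmannians[OF M(1) N(1) this] obtain r where r: "r > 0"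
      and near: "\<forall>w\<in>ball z r. \<forall>e. quiver_grassmannian Q d (?L z) e homotopy_equivalent_space quiver_grassmannian Q d (?L w) e"
      by (elim exE conjE)
    have "openin (top_of_set Z) (Z \<inter> ball z r)" by (rule openin_open_Int) (rule open_ball)
    moreover have "z \<in> Z \<inter> ball z r" using z r by simp
    moreover have "\<forall>w\<in>Z \<inter> ball z r. R z w" using near unfolding R_def by simp
    ultimately show ?thesis by blast
  qed
  have "R 0 1"
  proof (rule connected_equivalence_relation[where R = R, OF conn Z01])
    show "R y x" if "R x y" for x y using that unfolding R_def by (rule homotopy_equivalent_space_sym[THEN iffD1])
    show "R x z" if "R x y" "R y z" for x y z using that unfolding R_def by (rule homotopy_eqv_trans)
  qed (rule local)
  then have "quiver_grassmannian Q d (?L 0) e homotopy_equivalent_space quiver_grassmannian Q d (?L 1) e"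
    unfolding R_def .
  then show ?thesis unfolding L .
qed

text \<open>Density is irreducibility: a nonempty open set contains all points where some polynomial
  function \<open>g\<close>, not identically zero, is nonzero; and \<open>f\<close> and
  \<open>g\<close> are nonzero simultaneously somewhere.\<close>

lemma dense_open_nonvanishing:
  assumes f: "f \<in> rep_poly_functions Q d" "\<exists>M\<in>rep_space Q d. f M \<noteq> 0"
  shows "dense_open (rep_zariski Q d) {M \<in> rep_space Q d. f M \<noteq> 0}"
  unfolding dense_open_def
proof
  show "openin (rep_zariski Q d) {M \<in> rep_space Q d. f M \<noteq> 0}"
    unfolding openin_rep_zariski using f(1) by (intro exI[of _ "{f}"]) auto
  have meets: "T \<inter> {M \<in> rep_space Q d. f M \<noteq> 0} \<noteq> {}"
    if T: "openin (rep_zariski Q d) T" "M \<in> T" for M T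
  proof -
    obtain F where F: "F \<subseteq> rep_poly_functions Q d"
      "T = rep_space Q d - {M \<in> rep_space Q d. \<forall>f\<in>F. f M = 0}"
      using T(1) unfolding openin_rep_zariski by blast
    then obtain g where g: "g \<in> F" "g M \<noteq> 0" "M \<in> rep_space Q d" using T(2) by blast
    have "\<exists>N\<in>rep_space Q d. f N * g N \<noteq> 0"
      by (rule rep_poly_mult_nonzero[OF f(1) _ f(2)]) (use F(1) g in auto)
    then obtain N where "N \<in> rep_space Q d" "f N \<noteq> 0" "g N \<noteq> 0" by auto
    then have "N \<in> T \<inter> {M \<in> rep_space Q d. f M \<noteq> 0}" using g(1) F(2) by auto
    then show ?thesis by blast
  qed
  show "rep_zariski Q d closure_of {M \<in> rep_space Q d. f M \<noteq> 0} = topspace (rep_zariski Q d)"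
  proof (intro equalityI closure_of_subset_topspace subsetI)
    fix M assume "M \<in> topspace (rep_zariski Q d)"
    then show "M \<in> rep_zariski Q d closure_of {M \<in> rep_space Q d. f M \<noteq> 0}"
      unfolding in_closure_of using meets by blast
  qed
qed

lemma dense_open_inter_nonempty:
  assumes "dense_open X U" "dense_open X U'" "U \<noteq> {}"
  shows "U \<inter> U' \<noteq> {}"
proof -
  obtain x where "x \<in> U" using assms(3) by blast
  moreover have "U \<subseteq> topspace X" using assms(1) openin_subset unfolding dense_open_def by blast
  ultimately have "x \<in> X closure_of U'" using assms(2) unfolding dense_open_def by blast
  then have "\<forall>T. x \<in> T \<and> openin X T \<longrightarrow> (\<exists>y. y \<in> U' \<and> y \<in> T)" unfolding in_closure_of by (rule conjunct2)
  then have "\<exists>y. y \<in> U' \<and> y \<in> U" using assms(1) \<open>x \<in> U\<close> unfolding dense_open_def by blast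
  then show ?thesis by blast
qed

theorem corollary3p3:
  fixes Q :: "('v, 'a) pre_digraph" and d :: "'v \<Rightarrow> nat"
  assumes "fin_digraph Q" and "Digraph_Component.connected Q"
    and "\<nexists>p. pre_digraph.cycle Q p"
  shows "\<exists>U. dense_open (rep_zariski Q d) U \<and> caldero_chapoton Q d constant_on U \<and>
    (\<forall>U'. dense_open (rep_zariski Q d) U' \<and> caldero_chapoton Q d constant_on U' \<longrightarrow>
      caldero_chapoton Q d ` U' = caldero_chapoton Q d ` U)"
proof -
  obtain f where f: "f \<in> rep_poly_functions Q d" and f': "(\<exists>M\<in>rep_space Q d. f M \<noteq> 0) \<and>
      (\<forall>M\<in>rep_space Q d. f M \<noteq> 0 \<longrightarrow> \<not> obstructed Q d (\<lambda>a. arrow_block Q a (M a)))"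
    using generic_unobstructed[OF assms(1), of d] by (elim bexE)
  note f = f f'[THEN conjunct1]
  note unobs = f'[THEN conjunct2, rule_format]
  define U where "U = {M \<in> rep_space Q d. f M \<noteq> 0}"
  have dense: "dense_open (rep_zariski Q d) U" unfolding U_def by (rule dense_open_nonvanishing[OF f])
  have const: "caldero_chapoton Q d M = caldero_chapoton Q d N" if "M \<in> U" "N \<in> U" for M N
  proof -
    \<comment> \<open>One \<open>f\<close> serves every \<open>e\<close>, and the exponents depend
      on \<open>d\<close> and \<open>e\<close> alone, so all terms of the sum agree at once.\<close>
    have "euler_characteristic (quiver_grassmannian Q d M e) = euler_characteristic (quiver_grassmannian Q d N e)" for e
      by (intro euler_characteristic_homotopy_invariant quiver_grassmannians_equivalent[OF assms(1) f(1) unobs])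
        (use that in \<open>auto simp: U_def\<close>)
    then show ?thesis unfolding caldero_chapoton_def by (simp only:)
  qed
  have "caldero_chapoton Q d ` U' = caldero_chapoton Q d ` U"
    if U': "dense_open (rep_zariski Q d) U'" "caldero_chapoton Q d constant_on U'" for U'
  proof -
    have "U \<noteq> {}" using f(2) unfolding U_def by blast
    \<comment> \<open>The two constant values are compared at a common point of the two
      sets.\<close>
    then obtain M where M: "M \<in> U" "M \<in> U'" using dense_open_inter_nonempty[OF dense U'(1)] by blast
    obtain c where c: "\<forall>N\<in>U'. caldero_chapoton Q d N = c" using U'(2) unfolding constant_on_def by (elim exE)
    have "caldero_chapoton Q d ` U = (\<lambda>N. c) ` U"
    proof (rule image_cong[OF refl])
      fix N assume "N \<in> U"
      then have "caldero_chapoton Q d N = caldero_chapoton Q d M" using M(1) by (rule const)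
      also have "\<dots> = c" using c M(2) by (rule bspec)
      finally show "caldero_chapoton Q d N = c" .
    qed
    also have "\<dots> = {c}" by (rule image_constant[OF M(1)])
    finally have "caldero_chapoton Q d ` U = {c}" .
    moreover have "caldero_chapoton Q d ` U' = (\<lambda>N. c) ` U'"
      by (rule image_cong[OF refl]) (rule bspec[OF c])
    ultimately show ?thesis using image_constant[OF M(2)] by simp
  qed
  moreover have "caldero_chapoton Q d constant_on U"
  proof -
    obtain M where "M \<in> U" using f(2) unfolding U_def by blast
    then have "\<forall>N\<in>U. caldero_chapoton Q d N = caldero_chapoton Q d M" using const by blast
    then show ?thesis unfolding constant_on_def by (rule exI)
  qed
  ultimately show ?thesis using dense by blast
qed

end
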